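(* For every continuous factorization $\bigl((\Omega,\mathcal F,P),(\mathcal F_{s,t})_{s\le t}\bigr)$ there exists one and only one $\sigma$-additive orthogonal decomposition $(H_{\mathcal M})$ of the Hilbert space $L_2(\Omega,\mathcal F,P)$ over the Borel $\sigma$-field of the space $\mathcal C$ of compact subsets of $\mathbb R$ such that $H_{\mathcal M_E}=L_2(\Omega,\mathcal F_E,P)$ for every elementary set $E\subset\mathbb R$, where $\mathcal M_E=\{M\in\mathcal C: M\subset E\}$. This orthogonal decomposition is related to spectral measures by $$\|\mathrm{Proj}_{H_{\mathcal M}}f\|^2=\mu_f(\mathcal M)$$ for all $f\in L_2(\Omega,\mathcal F,P)$ and all Borel sets $\mathcal M\subset\mathcal C$, where $\mathrm{Proj}_{H_{\mathcal M}}$ is the orthogonal projection onto $H_{\mathcal M}$.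
   Context: All probability spaces are Lebesgue–Rokhlin spaces; sub-$\sigma$-fields are understood mod 0 (they contain all null sets). For sub-$\sigma$-fields, $\mathcal A=\mathcal B\otimes\mathcal D$ means that $\mathcal B,\mathcal D$ are independent and together generate $\mathcal A$. A continuous factorization consists of a probability space $(\Omega,\mathcal F,P)$ and a family $(\mathcal F_{s,t})_{s\le t}$ ($s,t\in\mathbb R$) of sub-$\sigma$-fields of $\mathcal F$ such that (a) $\mathcal F_{r,t}=\mathcal F_{r,s}\otimes\mathcal F_{s,t}$ for $r\le s\le t$; (b) $\bigcup_{\varepsilon>0}\mathcal F_{s+\varepsilon,t-\varepsilon}$ generates $\mathcal F_{s,t}$ for $s<t$; (c) $\bigcup_n\mathcal F_{-n,n}$ generates $\mathcal F$. Put $\mathcal F_{-\infty,t}=\sigma(\bigcup_{s\le t}\mathcal F_{s,t})$, $\mathcal F_{s,\infty}=\sigma(\bigcup_{t\ge s}\mathcal F_{s,t})$, $\mathcal F_{-\infty,\infty}=\mathcal F$. An elementary set $E\subset\mathbb R$ is a finite union of (possibly unbounded) intervals, treated modulo finite sets; if $E=(s_1,t_1)\cup\dots\cup(s_n,t_n)$ (disjoint) modulo a finite set, then $\mathcal F_E=\mathcal F_{s_1,t_1}\otimes\dots\otimes\mathcal F_{s_n,t_n}$. $\mathcal C$ is the space of all compact subsets of $\mathbb R$ (including $\emptyset$) with the Hausdorff metric (and $\mathrm{dist}(\emptyset,M)=1$ for $M\ne\emptyset$). The spectral measure $\mu_f$ of $f\in L_2(\Omega,\mathcal F,P)$ is the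 unique finite positive Borel measure on $\mathcal C$ such that $\mu_f(\{M\in\mathcal C:M\subset E\})=\|\mathbb E(f\mid\mathcal F_E)\|^2$ for all elementary $E$; it exists and satisfies $\mu_f(\{M:M\ni t\})=0$ for every $t\in\mathbb R$. A $\sigma$-additive orthogonal decomposition of a Hilbert space $H$ over a $\sigma$-field of subsets of $\mathcal C$ is a family $(H_{\mathcal M})$ of closed linear subspaces of $H$, indexed by that $\sigma$-field, such that $H_{\mathcal C}=H$ and $H_{\mathcal M_1\cup\mathcal M_2\cup\cdots}=H_{\mathcal M_1}\oplus H_{\mathcal M_2}\oplus\cdots$ (the summands are pairwise orthogonal and the left side is the closure of their algebraic sum) whenever $\mathcal M_1,\mathcal M_2,\dots$ are pairwise disjoint. *)

theory Defs
  imports "HOL-Probability.Probability"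
begin

text \<open>
  A complete probability space that is isomorphic mod 0 to an interval with Lebesgue measure, a
  finite or countable set of atoms, or a combination of both. Below, \<open>A\<close> is the set of atoms,
  \<open>N\<close> and \<open>Z\<close> are the discarded null sets; \<open>a = 0\<close> is the purely atomic case.
\<close>

definition lebesgue_rokhlin :: "'a measure \<Rightarrow> bool" where
  "lebesgue_rokhlin M \<longleftrightarrow>
     prob_space M \<and> complete_measure M \<and>
     (\<exists>N A a Z f.
        N \<in> null_sets M \<and>
        countable A \<and> A \<subseteq> space M \<and> (\<forall>x\<in>A. {x} \<in> sets M) \<and>
        0 \<le> a \<and> Z \<in> null_sets lebesgue \<and>
        bij_betw f (space M - (N \<union> A)) ({0<..<a::real} - Z) \<and>
        (\<forall>X. X \<subseteq> space M - (N \<union> A) \<longrightarrow>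
           (X \<in> sets M \<longleftrightarrow> f ` X \<in> sets lebesgue) \<and>
           (X \<in> sets M \<longrightarrow> emeasure M X = emeasure lebesgue (f ` X))))"

text \<open>
  A sub-\<open>\<sigma>\<close>-field of \<open>M\<close> is represented, as in the library's \<open>subalgebra\<close>, by a measure of
  which only the space and the measurable sets matter. All sub-\<open>\<sigma>\<close>-fields contain all null sets.
\<close>

definition sub_sigma_field :: "'a measure \<Rightarrow> 'a measure \<Rightarrow> bool" where
  "sub_sigma_field M A \<longleftrightarrow> subalgebra M A \<and> null_sets M \<subseteq> sets A"

definition is_tensor :: "'a measure \<Rightarrow> 'a measure \<Rightarrow> 'a measure \<Rightarrow> 'a measure \<Rightarrow> bool" where
  "is_tensor M A B D \<longleftrightarrow>
     prob_space.indep_set M (sets B) (sets D) \<and>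
     sets A = sigma_sets (space M) (sets B \<union> sets D)"

locale continuous_factorization =
  fixes M :: "'a measure" and F :: "real \<Rightarrow> real \<Rightarrow> 'a measure"
  assumes lebesgue_rokhlin: "lebesgue_rokhlin M"
    and sub_sigma_field: "\<And>s t. s \<le> t \<Longrightarrow> sub_sigma_field M (F s t)"
    and tensor: "\<And>r s t. r \<le> s \<Longrightarrow> s \<le> t \<Longrightarrow> is_tensor M (F r t) (F r s) (F s t)"
    and inner_generates: "\<And>s t. s < t \<Longrightarrow>
      sets (F s t) =
        sigma_sets (space M) (\<Union>\<epsilon>\<in>{\<epsilon>. 0 < \<epsilon> \<and> s + \<epsilon> \<le> t - \<epsilon>}. sets (F (s + \<epsilon>) (t - \<epsilon>)))"
    and generates: "sets M = sigma_sets (space M) (\<Union>n::nat. sets (F (- real n) (real n)))"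

definition interval_field :: "'a measure \<Rightarrow> (real \<Rightarrow> real \<Rightarrow> 'a measure) \<Rightarrow> ereal \<Rightarrow> ereal \<Rightarrow> 'a measure"
  where
  "interval_field M F s t =
     (if s = -\<infinity> \<and> t = \<infinity> then M
      else if s = -\<infinity> then sigma (space M) (\<Union>r\<in>{..real_of_ereal t}. sets (F r (real_of_ereal t)))
      else if t = \<infinity> then sigma (space M) (\<Union>r\<in>{real_of_ereal s..}. sets (F (real_of_ereal s) r))
      else F (real_of_ereal s) (real_of_ereal t))"

text \<open>
  Elementary sets are kept as actual subsets of the line; statements about all elementary sets thus
  cover every representative modulo finite sets, and only \<open>elementary_field\<close> factors through that
  identification.
\<close>

definition elementary :: "real set \<Rightarrow> bool" where
  "elementary E \<longleftrightarrow> (\<exists>\<I>. finite \<I> \<and> (\<forall>J\<in>\<I>. is_interval J) \<and> E = \<Union>\<I>)"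

definition interval_decomposition :: "real set \<Rightarrow> (ereal \<times> ereal) set \<Rightarrow> bool" where
  "interval_decomposition E I \<longleftrightarrow>
     finite I \<and> (\<forall>(s, t)\<in>I. s < t) \<and>
     disjoint_family_on (\<lambda>(s, t). einterval s t) I \<and>
     finite (sym_diff E (\<Union>(s, t)\<in>I. einterval s t))"

text \<open>
  The choice of the decomposition is immaterial, and the fields of its intervals are automatically
  independent, both by the tensor property. The null sets matter only for finite \<open>E\<close>, where the
  decomposition is empty.
\<close>

definition elementary_field :: "'a measure \<Rightarrow> (real \<Rightarrow> real \<Rightarrow> 'a measure) \<Rightarrow> real set \<Rightarrow> 'a measure"
  where
  "elementary_field M F E =
     sigma (space M) (null_sets M \<union>
       (\<Union>(s, t)\<in>(SOME I. interval_decomposition E I). sets (interval_field M F s t)))"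

definition hausdorff_dist :: "real set \<Rightarrow> real set \<Rightarrow> real" where
  "hausdorff_dist K L =
     (if K = {} \<and> L = {} then 0
      else if K = {} \<or> L = {} then 1
      else max (SUP x\<in>K. infdist x L) (SUP y\<in>L. infdist y K))"

text \<open>
  With distance 1 between \<open>{}\<close> and all other sets the triangle inequality may fail for paths through
  \<open>{}\<close>, so the open sets are written out directly; \<open>{}\<close> is an isolated point.
\<close>

definition open_compacts :: "real set set \<Rightarrow> bool" where
  "open_compacts U \<longleftrightarrow>
     U \<subseteq> {K. compact K} \<and>
     (\<forall>K\<in>U. \<exists>e>0. \<forall>L. compact L \<and> hausdorff_dist K L < e \<longrightarrow> L \<in> U)"

definition borel_compacts :: "real set measure" where
  "borel_compacts = sigma {K. compact K} {U. open_compacts U}"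

definition compacts_in :: "real set \<Rightarrow> real set set" where
  "compacts_in E = {K. compact K \<and> K \<subseteq> E}"

text \<open>
  Elements of \<open>L\<^sub>2\<close> are represented by functions. Closedness with respect to the seminorm forces a
  closed subspace to contain, with a function, all functions that are almost everywhere equal to it,
  so closed subspaces in the sense below are exactly the closed subspaces of the quotient.
\<close>

definition L2 :: "'a measure \<Rightarrow> 'a measure \<Rightarrow> ('a \<Rightarrow> real) set" where
  "L2 M A = {f \<in> borel_measurable A. integrable M (\<lambda>x. (f x)\<^sup>2)}"

definition L2_inner :: "'a measure \<Rightarrow> ('a \<Rightarrow> real) \<Rightarrow> ('a \<Rightarrow> real) \<Rightarrow> real" where
  "L2_inner M f g = (\<integral>x. f x * g x \<partial>M)"

definition L2_norm :: "'a measure \<Rightarrow> ('a \<Rightarrow> real) \<Rightarrow> real" where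
  "L2_norm M f = sqrt (L2_inner M f f)"

definition L2_closure :: "'a measure \<Rightarrow> ('a \<Rightarrow> real) set \<Rightarrow> ('a \<Rightarrow> real) set" where
  "L2_closure M S = {f \<in> L2 M M. \<forall>e>0. \<exists>g\<in>S. L2_norm M (\<lambda>x. f x - g x) < e}"

definition closed_subspace :: "'a measure \<Rightarrow> ('a \<Rightarrow> real) set \<Rightarrow> bool" where
  "closed_subspace M S \<longleftrightarrow>
     S \<subseteq> L2 M M \<and> (\<lambda>_. 0) \<in> S \<and>
     (\<forall>f\<in>S. \<forall>g\<in>S. (\<lambda>x. f x + g x) \<in> S) \<and>
     (\<forall>c. \<forall>f\<in>S. (\<lambda>x. c * f x) \<in> S) \<and>
     L2_closure M S \<subseteq> S"

definition L2_orthogonal :: "'a measure \<Rightarrow> ('a \<Rightarrow> real) set \<Rightarrow> ('a \<Rightarrow> real) set \<Rightarrow> bool" where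
  "L2_orthogonal M S T \<longleftrightarrow> (\<forall>f\<in>S. \<forall>g\<in>T. L2_inner M f g = 0)"

definition algebraic_sum :: "(nat \<Rightarrow> ('a \<Rightarrow> real) set) \<Rightarrow> ('a \<Rightarrow> real) set" where
  "algebraic_sum S = {(\<lambda>x. \<Sum>i<n. g i x) | n g. \<forall>i<n. g i \<in> S i}"

text \<open>The orthogonal projection is determined up to almost everywhere equality.\<close>

definition L2_proj :: "'a measure \<Rightarrow> ('a \<Rightarrow> real) set \<Rightarrow> ('a \<Rightarrow> real) \<Rightarrow> ('a \<Rightarrow> real)" where
  "L2_proj M S f = (SOME g. g \<in> S \<and> (\<forall>h\<in>S. L2_inner M (\<lambda>x. f x - g x) h = 0))"

text \<open>
  Families indexed by the \<open>\<sigma>\<close>-field are extensional functions, so that equality of functions is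
  equality of families.
\<close>

definition orthogonal_decomposition ::
    "'a measure \<Rightarrow> 'b measure \<Rightarrow> ('b set \<Rightarrow> ('a \<Rightarrow> real) set) \<Rightarrow> bool" where
  "orthogonal_decomposition M B H \<longleftrightarrow>
     H \<in> sets B \<rightarrow>\<^sub>E {S. closed_subspace M S} \<and>
     H (space B) = L2 M M \<and>
     (\<forall>X :: nat \<Rightarrow> 'b set. range X \<subseteq> sets B \<longrightarrow> disjoint_family X \<longrightarrow>
        (\<forall>i j. i \<noteq> j \<longrightarrow> L2_orthogonal M (H (X i)) (H (X j))) \<and>
        H (\<Union>i. X i) = L2_closure M (algebraic_sum (\<lambda>i. H (X i))))"

definition is_spectral_measure ::
    "'a measure \<Rightarrow> (real \<Rightarrow> real \<Rightarrow> 'a measure) \<Rightarrow> ('a \<Rightarrow> real) \<Rightarrow> real set measure \<Rightarrow> bool" where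
  "is_spectral_measure M F f \<mu> \<longleftrightarrow>
     sets \<mu> = sets borel_compacts \<and> finite_measure \<mu> \<and>
     (\<forall>E. elementary E \<longrightarrow>
        measure \<mu> (compacts_in E) = (L2_norm M (real_cond_exp M (elementary_field M F E) f))\<^sup>2)"

definition spectral_measure ::
    "'a measure \<Rightarrow> (real \<Rightarrow> real \<Rightarrow> 'a measure) \<Rightarrow> ('a \<Rightarrow> real) \<Rightarrow> real set measure" where
  "spectral_measure M F f = (THE \<mu>. is_spectral_measure M F f \<mu>)"

end

theory Submission
  imports Defs
begin

text \<open>
  The conditional expectations onto the fields of elementary sets commute, the product for \<open>E\<close> and
  \<open>E'\<close> being the one for \<open>E \<inter> E'\<close>. Enumerate the finite unions of compact intervals with rational end
  points. Splitting \<open>f\<close> successively by the projections for these sets gives a binary tree of pairwise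
  orthogonal vectors whose squared norms are the weights of a measure on infinite paths. Along a path,
  intersecting those sets whose projections were chosen gives a random compact set. Compactness and the upward
  continuity of conditional expectations show that its distribution (of total mass \<open>\<parallel>f\<parallel>\<^sup>2\<close>)
  is the spectral measure of \<open>f\<close>. The Borel sets whose spectral measures come from a closed subspace
  form a Dynkin system containing the generating sets \<open>compacts_in E\<close>, which yields the decomposition.
  Conversely every decomposition produces spectral measures, and these determine it.
\<close>

section \<open>Geometry of L2\<close>

text \<open>The obstacle is that a general Borel set of compacts has no field attached to it, so its
  subspace cannot be written down directly. Spectral measures supply it: in any decomposition
  \<open>H X\<close> must consist of the \<open>f\<close> whose spectral measure puts its whole mass
  on \<open>X\<close>. This description is at once the candidate and the reason for uniqueness. The
  axioms give continuity only along increasing fields, whereas a measure on compacts seems to ask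
  for decreasing limits as well. Compactness fills the gap: an intersection of compact sets lies in
  an open set iff some finite subintersection does. Rational end points make the family countable,
  and closure under finite unions and intersections lets a finite subintersection be a member again.
  Only open elementary sets are treated in this way; the others follow because single points carry
  no mass. The weights of the tree are realized by Lebesgue measure on an interval of length
  \<open>\<parallel>f\<parallel>^2\<close>, so no extension theorem is invoked. Since vectors are
  functions, identities between projections hold almost everywhere, and most arguments compare
  norms.\<close>

lemma L2_measurable: "f \<in> L2 M A \<Longrightarrow> subalgebra M A \<Longrightarrow> f \<in> borel_measurable M"
  unfolding L2_def by (auto intro: measurable_from_subalg)

lemma subalgebra_refl: "subalgebra M M"
  by (simp add: subalgebra_def)

lemma L2_subset: "subalgebra M A \<Longrightarrow> L2 M A \<subseteq> L2 M M"
  unfolding L2_def by (auto intro: measurable_from_subalg)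

lemma L2_mono: "subalgebra B A \<Longrightarrow> L2 M A \<subseteq> L2 M B"
  unfolding L2_def by (auto intro: measurable_from_subalg)

lemma L2_mult_integrable:
  assumes "f \<in> L2 M M" "g \<in> L2 M M"
  shows "integrable M (\<lambda>x. f x * g x)"
proof (rule Bochner_Integration.integrable_bound)
  show "integrable M (\<lambda>x. (f x)\<^sup>2 + (g x)\<^sup>2)"
    using assms by (auto simp: L2_def)
  show "(\<lambda>x. f x * g x) \<in> borel_measurable M"
    using assms by (auto simp: L2_def)
  have "\<bar>a * b\<bar> \<le> a\<^sup>2 + b\<^sup>2" for a b :: real
  proof -
    have "2 * (\<bar>a\<bar> * \<bar>b\<bar>) \<le> a\<^sup>2 + b\<^sup>2"
      using sum_squares_bound[of "\<bar>a\<bar>" "\<bar>b\<bar>"] by simp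
    moreover have "0 \<le> \<bar>a\<bar> * \<bar>b\<bar>" by simp
    ultimately show ?thesis unfolding abs_mult by linarith
  qed
  then show "AE x in M. norm (f x * g x) \<le> norm ((f x)\<^sup>2 + (g x)\<^sup>2)"
    by (intro AE_I2) simp
qed

lemma L2_add:
  assumes "subalgebra M A" "f \<in> L2 M A" "g \<in> L2 M A"
  shows "(\<lambda>x. f x + g x) \<in> L2 M A"
proof -
  have "integrable M (\<lambda>x. f x * g x)"
    using assms L2_subset by (intro L2_mult_integrable) blast+
  then have "integrable M (\<lambda>x. (f x)\<^sup>2 + (g x)\<^sup>2 + 2 * (f x * g x))"
    using assms(2,3) by (auto simp: L2_def)
  moreover have "(\<lambda>x. (f x + g x)\<^sup>2) = (\<lambda>x. (f x)\<^sup>2 + (g x)\<^sup>2 + 2 * (f x * g x))"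
    by (simp add: fun_eq_iff power2_sum)
  ultimately show ?thesis
    using assms by (auto simp: L2_def)
qed

lemma L2_cmult: "f \<in> L2 M A \<Longrightarrow> (\<lambda>x. c * f x) \<in> L2 M A"
  unfolding L2_def by (auto simp: power_mult_distrib)

lemma L2_diff:
  assumes "subalgebra M A" "f \<in> L2 M A" "g \<in> L2 M A"
  shows "(\<lambda>x. f x - g x) \<in> L2 M A"
  using L2_add[OF assms(1,2) L2_cmult[OF assms(3), of "-1"]] by simp

lemma L2_zero: "(\<lambda>_. 0) \<in> L2 M A"
  unfolding L2_def by auto

lemma L2_sum:
  assumes "subalgebra M A" "\<And>i. i \<in> I \<Longrightarrow> f i \<in> L2 M A"
  shows "(\<lambda>x. \<Sum>i\<in>I. f i x) \<in> L2 M A"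
  using assms(2)
  by (induction I rule: infinite_finite_induct) (auto simp: L2_zero intro: L2_add[OF assms(1)])

lemmas L2_intros = L2_add[OF subalgebra_refl] L2_diff[OF subalgebra_refl] L2_cmult L2_zero
  L2_sum[OF subalgebra_refl]

lemma L2_inner_commute: "L2_inner M f g = L2_inner M g f"
  unfolding L2_inner_def by (simp add: mult.commute)

lemma L2_inner_add_left:
  "f \<in> L2 M M \<Longrightarrow> g \<in> L2 M M \<Longrightarrow> h \<in> L2 M M \<Longrightarrow>
    L2_inner M (\<lambda>x. f x + g x) h = L2_inner M f h + L2_inner M g h"
  unfolding L2_inner_def by (simp add: distrib_right L2_mult_integrable)

lemma L2_inner_diff_left:
  "f \<in> L2 M M \<Longrightarrow> g \<in> L2 M M \<Longrightarrow> h \<in> L2 M M \<Longrightarrow>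
    L2_inner M (\<lambda>x. f x - g x) h = L2_inner M f h - L2_inner M g h"
  unfolding L2_inner_def by (simp add: left_diff_distrib L2_mult_integrable)

lemma L2_inner_cmult_left: "L2_inner M (\<lambda>x. c * f x) h = c * L2_inner M f h"
  unfolding L2_inner_def by (simp add: mult.assoc)

lemma L2_inner_add_right:
  "f \<in> L2 M M \<Longrightarrow> g \<in> L2 M M \<Longrightarrow> h \<in> L2 M M \<Longrightarrow>
    L2_inner M h (\<lambda>x. f x + g x) = L2_inner M h f + L2_inner M h g"
  by (simp add: L2_inner_add_left L2_inner_commute[of _ h])

lemma L2_inner_diff_right:
  "f \<in> L2 M M \<Longrightarrow> g \<in> L2 M M \<Longrightarrow> h \<in> L2 M M \<Longrightarrow>
    L2_inner M h (\<lambda>x. f x - g x) = L2_inner M h f - L2_inner M h g"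
  by (simp add: L2_inner_diff_left L2_inner_commute[of _ h])

lemma L2_inner_cmult_right: "L2_inner M h (\<lambda>x. c * f x) = c * L2_inner M h f"
  by (simp add: L2_inner_cmult_left L2_inner_commute[of _ h])

lemma L2_inner_zero_left: "L2_inner M (\<lambda>_. 0) h = 0"
  unfolding L2_inner_def by simp

lemma L2_inner_sum_left:
  assumes "\<And>i. i \<in> I \<Longrightarrow> f i \<in> L2 M M" "h \<in> L2 M M"
  shows "L2_inner M (\<lambda>x. \<Sum>i\<in>I. f i x) h = (\<Sum>i\<in>I. L2_inner M (f i) h)"
  using assms(1)
  by (induction I rule: infinite_finite_induct)
    (auto simp: L2_inner_zero_left L2_inner_add_left assms(2) L2_intros)

lemmas L2_inner_simps = L2_inner_add_left L2_inner_diff_left L2_inner_cmult_left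
  L2_inner_add_right L2_inner_diff_right L2_inner_cmult_right

lemma L2_inner_nonneg: "0 \<le> L2_inner M f f"
  unfolding L2_inner_def by (intro integral_nonneg_AE) auto

lemma L2_norm_nonneg: "0 \<le> L2_norm M f"
  unfolding L2_norm_def by (simp add: L2_inner_nonneg)

lemma L2_norm_power2: "(L2_norm M f)\<^sup>2 = L2_inner M f f"
  unfolding L2_norm_def by (simp add: L2_inner_nonneg)

lemma L2_inner_cong_AE:
  assumes "AE x in M. f x = f' x" "AE x in M. g x = g' x"
    "f \<in> borel_measurable M" "f' \<in> borel_measurable M" "g \<in> borel_measurable M" "g' \<in> borel_measurable M"
  shows "L2_inner M f g = L2_inner M f' g'"
  unfolding L2_inner_def by (rule integral_cong_AE) (use assms in auto)

lemma L2_cong_AE: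
  assumes "AE x in M. f x = g x" "f \<in> L2 M M" "g \<in> borel_measurable M"
  shows "g \<in> L2 M M"
proof -
  have "integrable M (\<lambda>x. (f x)\<^sup>2)" using assms by (auto simp: L2_def)
  then have "integrable M (\<lambda>x. (g x)\<^sup>2)"
    by (rule Bochner_Integration.integrable_cong_AE_imp) (use assms in \<open>auto simp: L2_def\<close>)
  then show ?thesis using assms by (auto simp: L2_def)
qed

lemma L2_inner_self_eq_0:
  assumes "f \<in> L2 M M"
  shows "L2_inner M f f = 0 \<longleftrightarrow> (AE x in M. f x = 0)"
proof -
  have "L2_inner M f f = (\<integral>x. (f x)\<^sup>2 \<partial>M)"
    by (simp add: L2_inner_def power2_eq_square)
  also have "\<dots> = 0 \<longleftrightarrow> (AE x in M. (f x)\<^sup>2 = 0)"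
    using assms by (intro integral_nonneg_eq_0_iff_AE) (auto simp: L2_def)
  finally show ?thesis by simp
qed

lemma L2_norm_diff_eq_0:
  assumes f: "f \<in> L2 M M" and g: "g \<in> L2 M M"
  shows "L2_norm M (\<lambda>x. f x - g x) = 0 \<longleftrightarrow> (AE x in M. f x = g x)"
  using L2_inner_self_eq_0[OF L2_diff[OF subalgebra_refl f g]] by (simp add: L2_norm_def)

lemma L2_Cauchy_Schwarz:
  assumes f: "f \<in> L2 M M" and g: "g \<in> L2 M M"
  shows "\<bar>L2_inner M f g\<bar> \<le> L2_norm M f * L2_norm M g"
proof -
  define a b c where "a = L2_inner M f f" and "b = L2_inner M f g" and "c = L2_inner M g g"
  have q: "0 \<le> t\<^sup>2 * a + 2 * t * b + c" for t
  proof -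
    have "0 \<le> L2_inner M (\<lambda>x. t * f x + g x) (\<lambda>x. t * f x + g x)"
      by (rule L2_inner_nonneg)
    also have "\<dots> = t\<^sup>2 * a + 2 * t * b + c"
      using f g by (simp add: L2_inner_simps L2_intros a_def b_def c_def L2_inner_commute[of _ g f]
          power2_eq_square algebra_simps)
    finally show ?thesis .
  qed
  have "b\<^sup>2 \<le> a * c"
  proof (cases "a = 0")
    case True
    have "b = 0"
    proof (rule ccontr)
      assume "b \<noteq> 0"
      \<comment> \<open>For \<open>a = 0\<close> the polynomial is affine in \<open>t\<close>, and
        this \<open>t\<close> gives it the value -1.\<close>
      then show False using q[of "- (c + 1) / (2 * b)"] True by (simp add: field_simps)
    qed
    then show ?thesis using True by simp
  next
    case False
    then have "a > 0" using L2_inner_nonneg[of M f] by (simp add: a_def)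
    then show ?thesis using q[of "- b / a"] by (simp add: field_simps power2_eq_square)
  qed
  then have "b\<^sup>2 \<le> (L2_norm M f * L2_norm M g)\<^sup>2"
    by (simp add: power_mult_distrib L2_norm_power2 a_def c_def)
  then have "\<bar>b\<bar> \<le> \<bar>L2_norm M f * L2_norm M g\<bar>"
    by (simp add: abs_le_square_iff)
  then show ?thesis by (simp add: b_def L2_norm_nonneg)
qed

lemma L2_norm_triangle:
  assumes f: "f \<in> L2 M M" and g: "g \<in> L2 M M"
  shows "L2_norm M (\<lambda>x. f x + g x) \<le> L2_norm M f + L2_norm M g"
proof (rule power2_le_imp_le)
  have "(L2_norm M (\<lambda>x. f x + g x))\<^sup>2 = (L2_norm M f)\<^sup>2 + 2 * L2_inner M f g + (L2_norm M g)\<^sup>2"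
    using f g by (simp add: L2_norm_power2 L2_inner_simps L2_intros L2_inner_commute[of _ g f])
  also have "\<dots> \<le> (L2_norm M f + L2_norm M g)\<^sup>2"
    using L2_Cauchy_Schwarz[OF f g] by (simp add: power2_sum)
  finally show "(L2_norm M (\<lambda>x. f x + g x))\<^sup>2 \<le> (L2_norm M f + L2_norm M g)\<^sup>2" .
qed (simp add: L2_norm_nonneg)

lemma L2_parallelogram:
  assumes "f \<in> L2 M M" "g \<in> L2 M M"
  shows "L2_inner M (\<lambda>x. f x + g x) (\<lambda>x. f x + g x) + L2_inner M (\<lambda>x. f x - g x) (\<lambda>x. f x - g x)
    = 2 * L2_inner M f f + 2 * L2_inner M g g"
  using assms by (simp add: L2_inner_simps L2_intros)

lemma L2_norm_minus_commute: "L2_norm M (\<lambda>x. f x - g x) = L2_norm M (\<lambda>x. g x - f x)"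
  unfolding L2_norm_def L2_inner_def by (simp add: algebra_simps)

lemma L2_norm_triangle_diff:
  assumes "f \<in> L2 M M" "g \<in> L2 M M" "h \<in> L2 M M"
  shows "L2_norm M (\<lambda>x. f x - h x) \<le> L2_norm M (\<lambda>x. f x - g x) + L2_norm M (\<lambda>x. g x - h x)"
  using L2_norm_triangle[of "\<lambda>x. f x - g x" M "\<lambda>x. g x - h x"] assms by (simp add: L2_intros)

lemma L2_norm_diff_abs:
  assumes "f \<in> L2 M M" "g \<in> L2 M M"
  shows "\<bar>L2_norm M f - L2_norm M g\<bar> \<le> L2_norm M (\<lambda>x. f x - g x)"
  using L2_norm_triangle_diff[OF assms L2_zero] L2_norm_triangle_diff[OF assms(2,1) L2_zero]
  by (simp add: L2_norm_minus_commute[of _ g f])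

section \<open>Completeness of L2 over a probability space\<close>

context prob_space
begin

lemma L2_const: "(\<lambda>_. c) \<in> L2 M A"
  unfolding L2_def by simp

lemma L2_indicator: "S \<in> sets A \<Longrightarrow> subalgebra M A \<Longrightarrow> indicat_real S \<in> L2 M A"
  unfolding L2_def
  by (auto simp: subalgebra_def power2_eq_square indicator_inter_arith[symmetric] less_top[symmetric]
      intro!: integrable_real_indicator)

lemma L2_integrable: "f \<in> L2 M M \<Longrightarrow> integrable M f"
  using L2_mult_integrable[OF _ L2_const[of 1]] by simp

lemma L1_le_L2_norm:
  assumes "f \<in> L2 M M"
  shows "(\<integral>x. \<bar>f x\<bar> \<partial>M) \<le> L2_norm M f"
proof -
  have f: "(\<lambda>x. \<bar>f x\<bar>) \<in> L2 M M" using assms by (auto simp: L2_def)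
  have "(\<integral>x. \<bar>f x\<bar> \<partial>M) = L2_inner M (\<lambda>x. \<bar>f x\<bar>) (\<lambda>_. 1)"
    by (simp add: L2_inner_def)
  also have "\<dots> \<le> L2_norm M (\<lambda>x. \<bar>f x\<bar>) * L2_norm M (\<lambda>_. 1)"
    using L2_Cauchy_Schwarz[OF f L2_const[of 1]] by simp
  also have "\<dots> = L2_norm M f"
    by (simp add: L2_norm_def L2_inner_def prob_space)
  finally show ?thesis .
qed

text \<open>Riesz-Fischer: a fast subsequence has increments summable in L1, hence converges almost
  everywhere, and Fatou's lemma turns this into L2 convergence of the whole sequence. A limit
  measurable for \<open>A\<close>, not just for \<open>M\<close>, is what later makes
  \<open>L2 M A\<close> closed.\<close>

lemma L2_complete:
  fixes u :: "nat \<Rightarrow> 'a \<Rightarrow> real"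
  assumes A: "subalgebra M A" and u: "\<And>n. u n \<in> L2 M A"
    and Cauchy: "\<And>e. e > 0 \<Longrightarrow> \<exists>N. \<forall>m\<ge>N. \<forall>n\<ge>N. L2_norm M (\<lambda>x. u m x - u n x) < e"
  obtains g where "g \<in> L2 M A" "(\<lambda>n. L2_norm M (\<lambda>x. u n x - g x)) \<longlonglongrightarrow> 0"
proof -
  have uM: "u n \<in> L2 M M" for n using u L2_subset[OF A] by auto
  have [measurable]: "u n \<in> borel_measurable A" for n using u by (auto simp: L2_def)
  have [measurable]: "u n \<in> borel_measurable M" for n using uM by (auto simp: L2_def)
  have "\<exists>N. \<forall>m\<ge>N. \<forall>n\<ge>N. L2_norm M (\<lambda>x. u m x - u n x) < (1/2)^k" for k :: nat
    by (rule Cauchy) simp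
  then obtain N where N: "\<And>k m n. m \<ge> N k \<Longrightarrow> n \<ge> N k \<Longrightarrow> L2_norm M (\<lambda>x. u m x - u n x) < (1/2)^k"
    by metis
  \<comment> \<open>The sum makes \<open>r\<close> monotone and at least \<open>N k\<close>; the
    added \<open>k\<close> makes it unbounded, so that \<open>r j\<close> passes every
    \<open>N k\<close>.\<close>
  define r where "r k = (\<Sum>i\<le>k. N i) + k" for k
  have rN: "r k \<ge> N k" for k unfolding r_def by (simp add: sum.remove[of "{..k}" k])
  have rmono: "r k \<le> r (Suc k)" for k unfolding r_def by simp
  have rge: "r k \<ge> k" for k unfolding r_def by simp
  define d where "d k x = \<bar>u (r (Suc k)) x - u (r k) x\<bar>" for k x
  have [measurable]: "d k \<in> borel_measurable M" for k unfolding d_def by measurable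
  have d: "(\<integral>\<^sup>+x. ennreal (d k x) \<partial>M) \<le> ennreal ((1/2)^k)" for k
  proof -
    let ?w = "\<lambda>x. u (r (Suc k)) x - u (r k) x"
    have w: "?w \<in> L2 M M" by (intro L2_intros uM)
    have "(\<integral>\<^sup>+x. ennreal (d k x) \<partial>M) = ennreal (\<integral>x. \<bar>?w x\<bar> \<partial>M)"
      unfolding d_def by (rule nn_integral_eq_integral) (use L2_integrable[OF w] in auto)
    also have "\<dots> \<le> ennreal ((1/2)^k)"
      using L1_le_L2_norm[OF w] N[of k "r (Suc k)" "r k"] rN[of k] rmono[of k]
      by (intro ennreal_leI) linarith
    finally show ?thesis .
  qed
  have "(\<integral>\<^sup>+x. (\<Sum>k. ennreal (d k x)) \<partial>M) = (\<Sum>k. \<integral>\<^sup>+x. ennreal (d k x) \<partial>M)"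
    by (rule nn_integral_suminf) simp
  also have "\<dots> \<le> (\<Sum>k. ennreal ((1/2)^k))"
    by (intro suminf_le d summableI)
  also have "\<dots> = ennreal (\<Sum>k. (1/2)^k)"
    by (intro suminf_ennreal2) (auto intro: summable_geometric)
  also have "\<dots> < \<infinity>" by simp
  finally have "AE x in M. (\<Sum>k. ennreal (d k x)) \<noteq> \<infinity>"
    by (intro nn_integral_PInf_AE) auto
  then have conv: "AE x in M. (\<lambda>k. u (r k) x) \<longlonglongrightarrow> lim (\<lambda>k. u (r k) x)"
  proof (rule AE_mp, intro AE_I2 impI)
    fix x assume "(\<Sum>k. ennreal (d k x)) \<noteq> \<infinity>"
    then have "summable (\<lambda>k. d k x)"
      by (intro summable_suminf_not_top) (auto simp: d_def)
    then have "summable (\<lambda>k. u (r (Suc k)) x - u (r k) x)"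
      unfolding d_def by (rule summable_rabs_cancel)
    then have "convergent (\<lambda>k. u (r k) x)"
      using sum_lessThan_telescope[of "\<lambda>k. u (r k) x"]
      by (simp add: summable_iff_convergent convergent_diff_const_right_iff)
    then show "(\<lambda>k. u (r k) x) \<longlonglongrightarrow> lim (\<lambda>k. u (r k) x)"
      by (simp add: convergent_LIMSEQ_iff)
  qed
  \<comment> \<open>Where the subsequence diverges, \<open>lim\<close> has a fixed default value; so
    \<open>g\<close> is defined everywhere and exactly measurable for \<open>A\<close>.\<close>
  define g where "g x = lim (\<lambda>k. u (r k) x)" for x
  have gA [measurable]: "g \<in> borel_measurable A"
    unfolding g_def by (intro borel_measurable_lim_metric) measurable
  then have gM [measurable]: "g \<in> borel_measurable M"
    using A measurable_from_subalg by blast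
  have bound: "(\<lambda>x. u n x - g x) \<in> L2 M M \<and> L2_norm M (\<lambda>x. u n x - g x) \<le> (1/2)^k"
    if n: "n \<ge> N k" for n k
  proof -
    have "(\<integral>\<^sup>+x. ennreal ((u n x - g x)\<^sup>2) \<partial>M)
        = (\<integral>\<^sup>+x. liminf (\<lambda>j. ennreal ((u n x - u (r j) x)\<^sup>2)) \<partial>M)"
    proof (rule nn_integral_cong_AE, use conv in \<open>rule AE_mp\<close>, intro AE_I2 impI)
      fix x assume "(\<lambda>k. u (r k) x) \<longlonglongrightarrow> lim (\<lambda>k. u (r k) x)"
      then have "(\<lambda>j. ennreal ((u n x - u (r j) x)\<^sup>2)) \<longlonglongrightarrow> ennreal ((u n x - g x)\<^sup>2)"
        unfolding g_def by (intro tendsto_intros)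
      then show "ennreal ((u n x - g x)\<^sup>2) = liminf (\<lambda>j. ennreal ((u n x - u (r j) x)\<^sup>2))"
        by (metis lim_imp_Liminf sequentially_bot)
    qed
    also have "\<dots> \<le> liminf (\<lambda>j. \<integral>\<^sup>+x. ennreal ((u n x - u (r j) x)\<^sup>2) \<partial>M)"
      by (rule nn_integral_liminf) simp
    also have "\<dots> \<le> ennreal (((1/2)^k)\<^sup>2)"
    proof -
      have "(\<integral>\<^sup>+x. ennreal ((u n x - u (r j) x)\<^sup>2) \<partial>M) \<le> ennreal (((1/2)^k)\<^sup>2)" if "j \<ge> N k" for j
      proof -
        have w: "(\<lambda>x. u n x - u (r j) x) \<in> L2 M M" by (intro L2_intros uM)
        have "(\<integral>\<^sup>+x. ennreal ((u n x - u (r j) x)\<^sup>2) \<partial>M) = ennreal ((L2_norm M (\<lambda>x. u n x - u (r j) x))\<^sup>2)"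
          unfolding L2_norm_power2 L2_inner_def power2_eq_square[symmetric]
          by (rule nn_integral_eq_integral) (use w in \<open>auto simp: L2_def\<close>)
        also have "\<dots> \<le> ennreal (((1/2)^k)\<^sup>2)"
          using N[of k n "r j"] n that rge[of j]
          by (intro ennreal_leI power_mono) (auto simp: L2_norm_nonneg intro: less_imp_le)
        finally show ?thesis .
      qed
      then have "\<forall>\<^sub>F j in sequentially. (\<integral>\<^sup>+x. ennreal ((u n x - u (r j) x)\<^sup>2) \<partial>M) \<le> ennreal (((1/2)^k)\<^sup>2)"
        by (auto simp: eventually_sequentially)
      then show ?thesis
        by (intro order_trans[OF Liminf_le_Limsup Limsup_bounded]) auto
    qed
    finally have le: "(\<integral>\<^sup>+x. ennreal ((u n x - g x)\<^sup>2) \<partial>M) \<le> ennreal (((1/2)^k)\<^sup>2)" .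
    then have int: "integrable M (\<lambda>x. (u n x - g x)\<^sup>2)"
      by (intro integrableI_bounded) (auto simp: le_less_trans[OF _ ennreal_less_top])
    then have "ennreal (L2_inner M (\<lambda>x. u n x - g x) (\<lambda>x. u n x - g x)) \<le> ennreal (((1/2)^k)\<^sup>2)"
      unfolding L2_inner_def power2_eq_square[symmetric] using le
      by (simp add: nn_integral_eq_integral power2_eq_square[symmetric])
    then have "(L2_norm M (\<lambda>x. u n x - g x))\<^sup>2 \<le> ((1/2)^k)\<^sup>2"
      by (simp add: L2_norm_power2)
    then have "L2_norm M (\<lambda>x. u n x - g x) \<le> (1/2)^k"
      by (rule power2_le_imp_le) simp
    with int show ?thesis by (simp add: L2_def)
  qed
  \<comment> \<open>The bounds control only the differences \<open>u n - g\<close>; subtracting one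
    of them from \<open>u n\<close> shows that \<open>g\<close> is square integrable.\<close>
  have "(\<lambda>x. u (N 0) x - (u (N 0) x - g x)) \<in> L2 M M"
    using bound[of 0 "N 0"]
    by (intro L2_diff[where f = "u (N 0)" and g = "\<lambda>x. u (N 0) x - g x"] subalgebra_refl uM) simp
  then have "g \<in> L2 M A" using gA by (simp add: L2_def)
  moreover have "(\<lambda>n. L2_norm M (\<lambda>x. u n x - g x)) \<longlonglongrightarrow> 0"
  proof (rule LIMSEQ_I)
    fix e :: real assume "e > 0"
    then obtain k where "(1/2)^k < e" using real_arch_pow_inv[of e "1/2"] by auto
    then show "\<exists>n0. \<forall>n\<ge>n0. norm (L2_norm M (\<lambda>x. u n x - g x) - 0) < e"
      using bound by (intro exI[of _ "N k"]) (force simp: L2_norm_nonneg)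
  qed
  ultimately show ?thesis by (rule that)
qed

end

lemma closed_subspaceD:
  assumes "closed_subspace M S"
  shows "S \<subseteq> L2 M M" "(\<lambda>_. 0) \<in> S" "f \<in> S \<Longrightarrow> g \<in> S \<Longrightarrow> (\<lambda>x. f x + g x) \<in> S"
    "f \<in> S \<Longrightarrow> (\<lambda>x. c * f x) \<in> S" "f \<in> S \<Longrightarrow> g \<in> S \<Longrightarrow> (\<lambda>x. f x - g x) \<in> S"
    "L2_closure M S \<subseteq> S"
proof -
  show *: "S \<subseteq> L2 M M" "(\<lambda>_. 0) \<in> S" "f \<in> S \<Longrightarrow> g \<in> S \<Longrightarrow> (\<lambda>x. f x + g x) \<in> S"
    "f \<in> S \<Longrightarrow> (\<lambda>x. c * f x) \<in> S" "L2_closure M S \<subseteq> S" for f g c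
    using assms unfolding closed_subspace_def by auto
  show "f \<in> S \<Longrightarrow> g \<in> S \<Longrightarrow> (\<lambda>x. f x - g x) \<in> S"
    using *(3)[of f "\<lambda>x. - 1 * g x"] *(4)[of g "-1"] by simp
qed

lemma closed_subspace_limit:
  assumes S: "closed_subspace M S" and u: "\<And>n. u n \<in> S" and f: "f \<in> L2 M M"
    and lim: "(\<lambda>n. L2_norm M (\<lambda>x. u n x - f x)) \<longlonglongrightarrow> 0"
  shows "f \<in> S"
proof -
  have "\<exists>g\<in>S. L2_norm M (\<lambda>x. f x - g x) < e" if "e > 0" for e
  proof -
    have "\<exists>n. L2_norm M (\<lambda>x. u n x - f x) < e"
      using LIMSEQ_D[OF lim that] by (auto simp: L2_norm_nonneg)
    then show ?thesis using u L2_norm_minus_commute[of M f] by auto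
  qed
  then have "f \<in> L2_closure M S" using f by (simp add: L2_closure_def)
  then show ?thesis using closed_subspaceD(6)[OF S] by auto
qed

lemma closed_subspace_cong_AE:
  assumes S: "closed_subspace M S" and "f \<in> S" "AE x in M. f x = g x" "g \<in> borel_measurable M"
  shows "g \<in> S"
proof (rule closed_subspace_limit[OF S, where u = "\<lambda>_. f"])
  have f: "f \<in> L2 M M" using closed_subspaceD(1)[OF S] assms by auto
  show g: "g \<in> L2 M M" by (rule L2_cong_AE[OF assms(3) f assms(4)])
  have "L2_inner M (\<lambda>x. f x - g x) (\<lambda>x. f x - g x) = 0"
    using f g assms(3) by (subst L2_inner_self_eq_0) (auto intro: L2_intros)
  then show "(\<lambda>n. L2_norm M (\<lambda>x. f x - g x)) \<longlonglongrightarrow> 0" by (simp add: L2_norm_def)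
qed (use assms in auto)

text \<open>First-order condition at a minimum: a polynomial that vanishes at \<open>t = 0\<close>
  and is nonnegative everywhere has slope 0 there. It is applied to the squared distance along the
  line \<open>g + t h\<close>.\<close>

lemma real_quadratic_nonneg_imp_0:
  fixes a b :: real
  assumes "\<And>t. 0 \<le> t\<^sup>2 * a - 2 * t * b" "a \<ge> 0"
  shows "b = 0"
proof (rule ccontr)
  assume b: "b \<noteq> 0"
  show False
  proof (cases "a = 0")
    case True
    then show False using assms(1)[of b] b by (simp add: power2_eq_square mult_le_0_iff) linarith
  next
    case False
    then have "0 \<le> - (b\<^sup>2 / a)"
      using assms(1)[of "b / a"] by (simp add: power2_eq_square)
    moreover have "b\<^sup>2 / a > 0" using b False assms(2) by simp
    ultimately show False by simp
  qed
qed

section \<open>Orthogonal projections onto closed subspaces\<close>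

context prob_space
begin

text \<open>A minimizing sequence for the squared distance \<open>q\<close> is Cauchy by the
  parallelogram law. Its limit is a nearest point, and perturbing a nearest point inside
  \<open>S\<close> shows that the error is orthogonal to \<open>S\<close>.\<close>

theorem L2_projection_exists:
  assumes S: "closed_subspace M S" and f: "f \<in> L2 M M"
  obtains g where "g \<in> S" "\<And>h. h \<in> S \<Longrightarrow> L2_inner M (\<lambda>x. f x - g x) h = 0"
proof -
  note S' = closed_subspaceD[OF S]
  define q where "q h = L2_inner M (\<lambda>x. f x - h x) (\<lambda>x. f x - h x)" for h
  define d where "d = (INF h\<in>S. q h)"
  have SM: "h \<in> S \<Longrightarrow> h \<in> L2 M M" for h using S'(1) by auto
  have q_nonneg: "0 \<le> q h" for h unfolding q_def by (rule L2_inner_nonneg)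
  have bdd: "bdd_below (q ` S)" using q_nonneg by (auto intro!: bdd_belowI[of _ 0])
  have d_le: "d \<le> q h" if "h \<in> S" for h unfolding d_def by (rule cINF_lower[OF bdd that])
  have "\<exists>h\<in>S. q h < d + 1 / Suc n" for n
  proof -
    have "d < d + 1 / Suc n" by simp
    then show ?thesis unfolding d_def using S'(2) bdd by (subst (asm) cINF_less_iff) auto
  qed
  then obtain u where u: "\<And>n. u n \<in> S" "\<And>n. q (u n) < d + 1 / Suc n" by metis
  have uM: "u n \<in> L2 M M" for n using u SM by auto
  have para: "(L2_norm M (\<lambda>x. u m x - u n x))\<^sup>2 \<le> 2 / Suc m + 2 / Suc n" for m n
  proof -
    \<comment> \<open>The midpoint of \<open>u m\<close> and \<open>u n\<close> lies in
      \<open>S\<close>, so \<open>q w\<close> is at least \<open>d\<close>; the parallelogram law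
      then bounds the distance of \<open>u m\<close> and \<open>u n\<close> by how far both are from
      optimal.\<close>
    define w where "w x = (1/2) * (u m x + u n x)" for x
    have wS: "w \<in> S" unfolding w_def using S'(4)[OF S'(3)[OF u(1)[of m] u(1)[of n]], of "1/2"] by simp
    then have w: "w \<in> L2 M M" using SM by auto
    let ?a = "\<lambda>x. f x - u m x" and ?b = "\<lambda>x. f x - u n x"
    have ab: "?a \<in> L2 M M" "?b \<in> L2 M M" using f uM by (auto intro: L2_intros)
    have "(\<lambda>x. f x - w x) = (\<lambda>x. (1/2) * (?a x + ?b x))"
      by (simp add: w_def fun_eq_iff field_simps)
    then have "4 * q w = L2_inner M (\<lambda>x. ?a x + ?b x) (\<lambda>x. ?a x + ?b x)"
      unfolding q_def by (simp only: L2_inner_cmult_left L2_inner_cmult_right)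
    moreover have "(L2_norm M (\<lambda>x. u m x - u n x))\<^sup>2 = L2_inner M (\<lambda>x. ?a x - ?b x) (\<lambda>x. ?a x - ?b x)"
      by (subst L2_norm_minus_commute) (simp add: L2_norm_power2)
    ultimately have "4 * q w + (L2_norm M (\<lambda>x. u m x - u n x))\<^sup>2 = 2 * q (u m) + 2 * q (u n)"
      using L2_parallelogram[OF ab] by (simp add: q_def)
    then have "(L2_norm M (\<lambda>x. u m x - u n x))\<^sup>2 = 2 * q (u m) + 2 * q (u n) - 4 * q w"
      by simp
    also have "\<dots> \<le> 2 * (d + 1 / Suc m) + 2 * (d + 1 / Suc n) - 4 * d"
      using u(2)[of m] u(2)[of n] d_le[OF wS] by (intro diff_mono add_mono mult_left_mono) auto
    finally show ?thesis by (simp add: distrib_left)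
  qed
  have "\<exists>N. \<forall>m\<ge>N. \<forall>n\<ge>N. L2_norm M (\<lambda>x. u m x - u n x) < e" if e: "e > 0" for e
  proof -
    \<comment> \<open>For both indices at least \<open>N\<close> the estimate \<open>para\<close> is
      at most \<open>4 / Suc N\<close>.\<close>
    obtain N where N: "1 / Suc N < e\<^sup>2 / 4"
      using nat_approx_posE[of "e\<^sup>2 / 4"] e by auto
    have "L2_norm M (\<lambda>x. u m x - u n x) < e" if "m \<ge> N" "n \<ge> N" for m n
    proof -
      have "1 / real (Suc m) \<le> 1 / Suc N" "1 / real (Suc n) \<le> 1 / Suc N"
        using that by (auto simp: field_simps)
      then have "(L2_norm M (\<lambda>x. u m x - u n x))\<^sup>2 < e\<^sup>2"
        using para[of m n] N by simp
      then show ?thesis using e by (simp add: power_less_imp_less_base)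
    qed
    then show ?thesis by auto
  qed
  from L2_complete[OF subalgebra_refl uM this]
  obtain g where g: "g \<in> L2 M M" and lim: "(\<lambda>n. L2_norm M (\<lambda>x. u n x - g x)) \<longlonglongrightarrow> 0"
    by blast
  have gS: "g \<in> S" by (rule closed_subspace_limit[OF S u(1) g lim])
  have "sqrt (q g) \<le> sqrt (d + 0) + 0"
  proof (rule LIMSEQ_le_const)
    have "(\<lambda>n. 1 / real (Suc n)) \<longlonglongrightarrow> 0"
      using LIMSEQ_inverse_real_of_nat by (simp add: inverse_eq_divide)
    then show "(\<lambda>n. sqrt (d + 1 / Suc n) + L2_norm M (\<lambda>x. u n x - g x)) \<longlonglongrightarrow> sqrt (d + 0) + 0"
      by (intro tendsto_add tendsto_real_sqrt tendsto_const lim)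
    have "sqrt (q g) \<le> sqrt (d + 1 / Suc n) + L2_norm M (\<lambda>x. u n x - g x)" for n
    proof -
      have "sqrt (q (u n)) \<le> sqrt (d + 1 / Suc n)" using u(2)[of n] by simp
      then show ?thesis
        using L2_norm_triangle_diff[OF f uM g, of n] unfolding q_def L2_norm_def by linarith
    qed
    then show "\<exists>N. \<forall>n\<ge>N. sqrt (q g) \<le> sqrt (d + 1 / Suc n) + L2_norm M (\<lambda>x. u n x - g x)" by auto
  qed
  then have qg: "q g \<le> d" by simp
  have "L2_inner M (\<lambda>x. f x - g x) h = 0" if h: "h \<in> S" for h
  proof (rule real_quadratic_nonneg_imp_0)
    fix t
    have w: "(\<lambda>x. g x + t * h x) \<in> S" by (intro S'(3,4) gS h)
    have "q g \<le> q (\<lambda>x. g x + t * h x)" using d_le[OF w] qg by simp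
    also have "\<dots> = q g + (t\<^sup>2 * L2_inner M h h - 2 * t * L2_inner M (\<lambda>x. f x - g x) h)"
      unfolding q_def using f g SM[OF h]
      by (simp add: L2_inner_simps L2_intros L2_inner_commute[of _ g f] L2_inner_commute[of _ h f]
          L2_inner_commute[of _ h g] algebra_simps power2_eq_square)
    finally show "0 \<le> t\<^sup>2 * L2_inner M h h - 2 * t * L2_inner M (\<lambda>x. f x - g x) h" by simp
  qed (rule L2_inner_nonneg)
  with gS show ?thesis by (rule that)
qed

lemma
  assumes S: "closed_subspace M S" and f: "f \<in> L2 M M"
  shows L2_proj_in: "L2_proj M S f \<in> S"
    and L2_proj_orthogonal: "h \<in> S \<Longrightarrow> L2_inner M (\<lambda>x. f x - L2_proj M S f x) h = 0"
proof -
  have "L2_proj M S f \<in> S \<and> (\<forall>h\<in>S. L2_inner M (\<lambda>x. f x - L2_proj M S f x) h = 0)"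
    unfolding L2_proj_def
  proof (rule someI_ex[where P = "\<lambda>g. g \<in> S \<and> (\<forall>h\<in>S. L2_inner M (\<lambda>x. f x - g x) h = 0)"])
    obtain g where "g \<in> S" "\<And>h. h \<in> S \<Longrightarrow> L2_inner M (\<lambda>x. f x - g x) h = 0"
      using L2_projection_exists[OF S f] by blast
    then show "\<exists>g. g \<in> S \<and> (\<forall>h\<in>S. L2_inner M (\<lambda>x. f x - g x) h = 0)" by blast
  qed
  then show "L2_proj M S f \<in> S" "h \<in> S \<Longrightarrow> L2_inner M (\<lambda>x. f x - L2_proj M S f x) h = 0"
    by auto
qed

lemma L2_proj_L2: "closed_subspace M S \<Longrightarrow> f \<in> L2 M M \<Longrightarrow> L2_proj M S f \<in> L2 M M"
  using L2_proj_in closed_subspaceD(1) by blast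

lemma L2_inner_proj:
  assumes S: "closed_subspace M S" and f: "f \<in> L2 M M" and h: "h \<in> S"
  shows "L2_inner M f h = L2_inner M (L2_proj M S f) h"
  using L2_proj_orthogonal[OF S f h] f h L2_proj_L2[OF S f] closed_subspaceD(1)[OF S]
  by (simp add: L2_inner_simps subset_iff)

text \<open>The difference of two candidates lies in \<open>S\<close> and is orthogonal to
  \<open>S\<close>, hence to itself. As \<open>L2_proj\<close> is chosen by SOME, equality almost
  everywhere is all that can be said about its value.\<close>

lemma L2_proj_unique:
  assumes S: "closed_subspace M S" and f: "f \<in> L2 M M" and g: "g \<in> S"
    and orth: "\<And>h. h \<in> S \<Longrightarrow> L2_inner M (\<lambda>x. f x - g x) h = 0"
  shows "AE x in M. L2_proj M S f x = g x"
proof -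
  let ?p = "L2_proj M S f"
  have p: "?p \<in> S" "?p \<in> L2 M M" using L2_proj_in[OF S f] L2_proj_L2[OF S f] by auto
  have g2: "g \<in> L2 M M" using g closed_subspaceD(1)[OF S] by auto
  have d: "(\<lambda>x. ?p x - g x) \<in> S" using closed_subspaceD(5)[OF S p(1) g] .
  have "L2_inner M (\<lambda>x. ?p x - g x) (\<lambda>x. ?p x - g x) = 0"
    using orth[OF d] L2_proj_orthogonal[OF S f d] p(2) g2 f
    by (simp add: L2_inner_simps L2_intros)
  then have "AE x in M. ?p x - g x = 0"
    using p(2) g2 by (subst (asm) L2_inner_self_eq_0) (auto intro: L2_intros)
  then show ?thesis by auto
qed

lemma L2_norm_cong_AE:
  assumes "AE x in M. f x = g x" "f \<in> borel_measurable M" "g \<in> borel_measurable M"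
  shows "L2_norm M f = L2_norm M g"
  unfolding L2_norm_def using L2_inner_cong_AE[OF assms(1,1)] assms by simp

lemma L2_norm_proj_unique:
  assumes S: "closed_subspace M S" and f: "f \<in> L2 M M" and g: "g \<in> S"
    and orth: "\<And>h. h \<in> S \<Longrightarrow> L2_inner M (\<lambda>x. f x - g x) h = 0"
  shows "L2_norm M (L2_proj M S f) = L2_norm M g"
  using L2_proj_unique[OF assms] L2_proj_L2[OF S f] g closed_subspaceD(1)[OF S]
  by (intro L2_norm_cong_AE) (auto simp: L2_def)

lemma L2_proj_Pythagoras:
  assumes S: "closed_subspace M S" and f: "f \<in> L2 M M"
  shows "(L2_norm M f)\<^sup>2 =
    (L2_norm M (L2_proj M S f))\<^sup>2 + (L2_norm M (\<lambda>x. f x - L2_proj M S f x))\<^sup>2"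
proof -
  have p: "L2_proj M S f \<in> L2 M M" by (rule L2_proj_L2[OF S f])
  show ?thesis unfolding L2_norm_power2
    using L2_inner_proj[OF S f L2_proj_in[OF S f]] f p
    by (simp add: L2_inner_simps L2_intros L2_inner_commute[of _ "L2_proj M S f" f])
qed

text \<open>By Pythagoras equal norms make the error vanish almost everywhere, and a closed subspace
  absorbs changes on null sets. Membership can thus be read off from norms, which is the basis of
  \<open>spectral_subspace\<close>.\<close>

lemma L2_proj_norm_eq_iff:
  assumes S: "closed_subspace M S" and f: "f \<in> L2 M M"
  shows "(L2_norm M (L2_proj M S f))\<^sup>2 = (L2_norm M f)\<^sup>2 \<longleftrightarrow> f \<in> S"
proof
  assume "(L2_norm M (L2_proj M S f))\<^sup>2 = (L2_norm M f)\<^sup>2"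
  then have "L2_inner M (\<lambda>x. f x - L2_proj M S f x) (\<lambda>x. f x - L2_proj M S f x) = 0"
    using L2_proj_Pythagoras[OF assms] by (simp add: L2_norm_power2)
  then have "AE x in M. f x - L2_proj M S f x = 0"
    using f L2_proj_L2[OF assms] by (subst (asm) L2_inner_self_eq_0) (auto intro: L2_intros)
  then show "f \<in> S"
    using f by (intro closed_subspace_cong_AE[OF S L2_proj_in[OF assms]]) (auto simp: L2_def)
next
  assume "f \<in> S"
  then show "(L2_norm M (L2_proj M S f))\<^sup>2 = (L2_norm M f)\<^sup>2"
    by (subst L2_norm_proj_unique[OF assms]) (auto simp: L2_inner_zero_left)
qed

definition L2_orth_compl :: "('a \<Rightarrow> real) set \<Rightarrow> ('a \<Rightarrow> real) set" where
  "L2_orth_compl S = {f \<in> L2 M M. \<forall>h\<in>S. L2_inner M f h = 0}"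

lemma closed_subspaceI:
  assumes "S \<subseteq> L2 M M" "(\<lambda>_. 0) \<in> S" "\<And>f g. f \<in> S \<Longrightarrow> g \<in> S \<Longrightarrow> (\<lambda>x. f x + g x) \<in> S"
    "\<And>c f. f \<in> S \<Longrightarrow> (\<lambda>x. c * f x) \<in> S"
    and lim: "\<And>f u. f \<in> L2 M M \<Longrightarrow> (\<And>n. u n \<in> S) \<Longrightarrow>
      (\<lambda>n. L2_norm M (\<lambda>x. u n x - f x)) \<longlonglongrightarrow> 0 \<Longrightarrow> f \<in> S"
  shows "closed_subspace M S"
proof -
  have "f \<in> S" if f: "f \<in> L2_closure M S" for f
  proof -
    have "\<exists>g\<in>S. L2_norm M (\<lambda>x. f x - g x) < 1 / Suc n" for n
      using f by (auto simp: L2_closure_def)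
    then obtain u where u: "\<And>n. u n \<in> S" "\<And>n. L2_norm M (\<lambda>x. f x - u n x) < 1 / Suc n"
      by metis
    have "(\<lambda>n. L2_norm M (\<lambda>x. u n x - f x)) \<longlonglongrightarrow> 0"
    proof (rule tendsto_sandwich[where f = "\<lambda>_. 0" and h = "\<lambda>n. 1 / real (Suc n)"])
      show "(\<lambda>n. 1 / real (Suc n)) \<longlonglongrightarrow> 0"
        using LIMSEQ_inverse_real_of_nat by (simp add: inverse_eq_divide)
      show "(\<lambda>n. 0) \<longlonglongrightarrow> (0::real)" by simp
      show "\<forall>\<^sub>F n in sequentially. L2_norm M (\<lambda>x. u n x - f x) \<le> 1 / real (Suc n)"
        using u(2) by (auto simp: L2_norm_minus_commute[of M f] intro!: always_eventually less_imp_le)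
    qed (auto simp: L2_norm_nonneg)
    moreover have "f \<in> L2 M M" using f by (simp add: L2_closure_def)
    ultimately show ?thesis using u(1) by (intro lim[of f u])
  qed
  then show ?thesis using assms unfolding closed_subspace_def by auto
qed

lemma L2_inner_limit:
  assumes f: "f \<in> L2 M M" and u: "\<And>n. u n \<in> L2 M M" and h: "h \<in> L2 M M"
    and lim: "(\<lambda>n. L2_norm M (\<lambda>x. u n x - f x)) \<longlonglongrightarrow> 0"
  shows "(\<lambda>n. L2_inner M (u n) h) \<longlonglongrightarrow> L2_inner M f h"
proof -
  have "(\<lambda>n. L2_inner M (u n) h - L2_inner M f h) \<longlonglongrightarrow> 0"
  proof (rule Lim_null_comparison)
    show "\<forall>\<^sub>F n in sequentially. norm (L2_inner M (u n) h - L2_inner M f h)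
      \<le> L2_norm M (\<lambda>x. u n x - f x) * L2_norm M h"
      using L2_Cauchy_Schwarz[of "\<lambda>x. u _ x - f x" M h] f u h
      by (auto simp: L2_inner_simps L2_intros)
    show "(\<lambda>n. L2_norm M (\<lambda>x. u n x - f x) * L2_norm M h) \<longlonglongrightarrow> 0"
      using tendsto_mult_right[OF lim, of "L2_norm M h"] by simp
  qed
  then show ?thesis by (simp add: LIM_zero_iff)
qed

lemma L2_norm_limit:
  assumes f: "f \<in> L2 M M" and u: "\<And>n. u n \<in> L2 M M"
    and lim: "(\<lambda>n. L2_norm M (\<lambda>x. u n x - f x)) \<longlonglongrightarrow> 0"
  shows "(\<lambda>n. L2_norm M (u n)) \<longlonglongrightarrow> L2_norm M f"
proof -
  have "(\<lambda>n. L2_norm M (u n) - L2_norm M f) \<longlonglongrightarrow> 0"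
    by (rule Lim_null_comparison[OF _ lim]) (use L2_norm_diff_abs[OF u f] in auto)
  then show ?thesis by (simp add: LIM_zero_iff)
qed

lemma closed_subspace_orth_compl:
  assumes "S \<subseteq> L2 M M"
  shows "closed_subspace M (L2_orth_compl S)"
proof (rule closed_subspaceI)
  fix f u
  assume f: "f \<in> L2 M M" and u: "\<And>n. u n \<in> L2_orth_compl S"
    and lim: "(\<lambda>n. L2_norm M (\<lambda>x. u n x - f x)) \<longlonglongrightarrow> 0"
  have "L2_inner M f h = 0" if h: "h \<in> S" for h
  proof -
    have "(\<lambda>n. L2_inner M (u n) h) \<longlonglongrightarrow> L2_inner M f h"
      using u h assms by (intro L2_inner_limit[OF f _ _ lim]) (auto simp: L2_orth_compl_def)
    then show ?thesis using u h by (simp add: L2_orth_compl_def LIMSEQ_const_iff)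
  qed
  then show "f \<in> L2_orth_compl S" using f by (simp add: L2_orth_compl_def)
qed (use assms in \<open>auto simp: L2_orth_compl_def L2_intros L2_inner_simps L2_inner_zero_left subset_iff\<close>)

text \<open>The error of the projection onto \<open>S\<close> is itself the projection onto the
  complement. The formula mirrors the measure of a complement and carries that step of the Dynkin
  induction.\<close>

lemma L2_proj_orth_compl_norm:
  assumes S: "closed_subspace M S" and f: "f \<in> L2 M M"
  shows "(L2_norm M (L2_proj M (L2_orth_compl S) f))\<^sup>2 = (L2_norm M f)\<^sup>2 - (L2_norm M (L2_proj M S f))\<^sup>2"
proof -
  have p: "L2_proj M S f \<in> S" "L2_proj M S f \<in> L2 M M" using L2_proj_in[OF S f] L2_proj_L2[OF S f] by auto
  have "L2_norm M (L2_proj M (L2_orth_compl S) f) = L2_norm M (\<lambda>x. f x - L2_proj M S f x)"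
  proof (rule L2_norm_proj_unique[OF closed_subspace_orth_compl f])
    show "S \<subseteq> L2 M M" by (rule closed_subspaceD(1)[OF S])
    show "(\<lambda>x. f x - L2_proj M S f x) \<in> L2_orth_compl S"
      using f p L2_proj_orthogonal[OF S f] by (auto simp: L2_orth_compl_def L2_intros)
    fix h assume "h \<in> L2_orth_compl S"
    then show "L2_inner M (\<lambda>x. f x - (f x - L2_proj M S f x)) h = 0"
      using p L2_inner_commute[of M "L2_proj M S f" h] by (simp add: L2_orth_compl_def)
  qed
  then show ?thesis using L2_proj_Pythagoras[OF S f] by simp
qed

end

section \<open>Closures of sums of subspaces\<close>

lemma algebraic_sumI: "(\<And>i. i < n \<Longrightarrow> g i \<in> S i) \<Longrightarrow> (\<lambda>x. \<Sum>i<n. g i x) \<in> algebraic_sum S"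
  unfolding algebraic_sum_def by blast

lemma algebraic_sum_iff:
  "f \<in> algebraic_sum S \<longleftrightarrow> (\<exists>n g. f = (\<lambda>x. \<Sum>i<n. g i x) \<and> (\<forall>i<n. g i \<in> S i))"
  by (simp add: algebraic_sum_def)

lemma L2_closureE:
  assumes "f \<in> L2_closure M S" "e > 0"
  obtains g where "g \<in> S" "L2_norm M (\<lambda>x. f x - g x) < e"
  using assms unfolding L2_closure_def by blast

context prob_space
begin

lemma L2_closure_subset: "S \<subseteq> L2 M M \<Longrightarrow> S \<subseteq> L2_closure M S"
proof
  fix f assume S: "S \<subseteq> L2 M M" "f \<in> S"
  then have "f \<in> L2 M M" by auto
  moreover have "L2_norm M (\<lambda>x. f x - f x) = 0" by (simp add: L2_norm_def L2_inner_def)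
  ultimately show "f \<in> L2_closure M S"
    using S unfolding L2_closure_def by (auto intro!: bexI[of _ f])
qed

lemma closed_subspace_L2_closure:
  assumes V: "V \<subseteq> L2 M M" and zero: "(\<lambda>_. 0) \<in> V"
    and add: "\<And>f g. f \<in> V \<Longrightarrow> g \<in> V \<Longrightarrow> (\<lambda>x. f x + g x) \<in> V"
    and cmult: "\<And>c f. f \<in> V \<Longrightarrow> (\<lambda>x. c * f x) \<in> V"
  shows "closed_subspace M (L2_closure M V)"
proof (rule closed_subspaceI)
  show "L2_closure M V \<subseteq> L2 M M" by (auto simp: L2_closure_def)
  show "(\<lambda>_. 0) \<in> L2_closure M V" using L2_closure_subset[OF V] zero by auto
next
  fix f g assume f: "f \<in> L2_closure M V" and g: "g \<in> L2_closure M V"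
  have fg: "f \<in> L2 M M" "g \<in> L2 M M" using f g by (auto simp: L2_closure_def)
  have "\<exists>h\<in>V. L2_norm M (\<lambda>x. f x + g x - h x) < e" if "e > 0" for e
  proof -
    obtain f' g' where f': "f' \<in> V" "L2_norm M (\<lambda>x. f x - f' x) < e / 2"
      and g': "g' \<in> V" "L2_norm M (\<lambda>x. g x - g' x) < e / 2"
      using L2_closureE[OF f] L2_closureE[OF g] half_gt_zero[OF \<open>e > 0\<close>] by metis
    have "L2_norm M (\<lambda>x. (f x - f' x) + (g x - g' x)) < e"
      using L2_norm_triangle[of "\<lambda>x. f x - f' x" M "\<lambda>x. g x - g' x"] f' g' V fg
      by (simp add: L2_intros subset_iff)
    then show ?thesis using add[OF f'(1) g'(1)]
      by (intro bexI[of _ "\<lambda>x. f' x + g' x"]) (simp_all add: algebra_simps)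
  qed
  then show "(\<lambda>x. f x + g x) \<in> L2_closure M V"
    using fg by (simp add: L2_closure_def L2_intros)
next
  fix f and c :: real assume f: "f \<in> L2_closure M V"
  have f2: "f \<in> L2 M M" using f by (auto simp: L2_closure_def)
  have "\<exists>h\<in>V. L2_norm M (\<lambda>x. c * f x - h x) < e" if "e > 0" for e
  proof -
    obtain f' where f': "f' \<in> V" "L2_norm M (\<lambda>x. f x - f' x) < e / (\<bar>c\<bar> + 1)"
      using L2_closureE[OF f, of "e / (\<bar>c\<bar> + 1)"] \<open>e > 0\<close> by auto
    have "L2_norm M (\<lambda>x. c * (f x - f' x)) = \<bar>c\<bar> * L2_norm M (\<lambda>x. f x - f' x)"
      unfolding L2_norm_def by (simp only: L2_inner_cmult_left L2_inner_cmult_right)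
        (simp add: real_sqrt_mult mult.assoc[symmetric])
    also have "\<dots> \<le> (\<bar>c\<bar> + 1) * L2_norm M (\<lambda>x. f x - f' x)"
      by (intro mult_right_mono) (auto simp: L2_norm_nonneg)
    also have "\<dots> < e" using f'(2) by (simp add: field_simps)
    finally show ?thesis using cmult[OF f'(1), of c]
      by (intro bexI[of _ "\<lambda>x. c * f' x"]) (simp_all add: algebra_simps)
  qed
  then show "(\<lambda>x. c * f x) \<in> L2_closure M V"
    using f2 by (simp add: L2_closure_def L2_intros)
next
  fix f u
  assume f: "f \<in> L2 M M" and u: "\<And>n. u n \<in> L2_closure M V"
    and lim: "(\<lambda>n. L2_norm M (\<lambda>x. u n x - f x)) \<longlonglongrightarrow> 0"
  have uM: "u n \<in> L2 M M" for n using u by (auto simp: L2_closure_def)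
  have "\<exists>h\<in>V. L2_norm M (\<lambda>x. f x - h x) < e" if "e > 0" for e
  proof -
    have "e / 2 > 0" using that by simp
    from LIMSEQ_D[OF lim this] obtain n where n: "L2_norm M (\<lambda>x. u n x - f x) < e / 2"
      by (auto simp: L2_norm_nonneg)
    obtain h where h: "h \<in> V" "L2_norm M (\<lambda>x. u n x - h x) < e / 2"
      using u[of n] \<open>e / 2 > 0\<close> unfolding L2_closure_def by blast
    show ?thesis
      using L2_norm_triangle_diff[OF f uM[of n], of h] h V n
      by (intro bexI[of _ h]) (auto simp: L2_norm_minus_commute[of M f "u n"])
  qed
  then show "f \<in> L2_closure M V" using f by (simp add: L2_closure_def)
qed

lemma closed_subspace_sum:
  assumes S: "\<And>i. closed_subspace M (S i)"
  shows "algebraic_sum S \<subseteq> L2 M M" "closed_subspace M (L2_closure M (algebraic_sum S))"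
proof -
  have SM: "f \<in> L2 M M" if "f \<in> S i" for f i using closed_subspaceD(1)[OF S] that by auto
  show V: "algebraic_sum S \<subseteq> L2 M M"
    unfolding algebraic_sum_def using SM by (auto intro!: L2_intros)
  show "closed_subspace M (L2_closure M (algebraic_sum S))"
  proof (rule closed_subspace_L2_closure[OF V])
    show "(\<lambda>_. 0) \<in> algebraic_sum S" using algebraic_sumI[of 0 _ S] by simp
  next
    fix f g assume "f \<in> algebraic_sum S" "g \<in> algebraic_sum S"
    then obtain n f' m g' where f: "f = (\<lambda>x. \<Sum>i<n. f' i x)" "\<forall>i<n. f' i \<in> S i"
      and g: "g = (\<lambda>x. \<Sum>i<m. g' i x)" "\<forall>i<m. g' i \<in> S i"
      unfolding algebraic_sum_iff by (elim exE conjE)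
    \<comment> \<open>The two finite sums may have different lengths, so both are padded with zeros
      to length \<open>n + m\<close>.\<close>
    define F where "F i = (if i < n then f' i else (\<lambda>_. 0))" for i
    define G where "G i = (if i < m then g' i else (\<lambda>_. 0))" for i
    have "F i \<in> S i" "G i \<in> S i" for i
      using f(2) g(2) closed_subspaceD(2)[OF S] by (auto simp: F_def G_def)
    then have "(\<lambda>x. F i x + G i x) \<in> S i" for i by (intro closed_subspaceD(3)[OF S])
    then have "(\<lambda>x. \<Sum>i<n + m. F i x + G i x) \<in> algebraic_sum S"
      by (intro algebraic_sumI)
    moreover have "f x = (\<Sum>i<n+m. F i x)" "g x = (\<Sum>i<n+m. G i x)" for x
      unfolding f(1) g(1) F_def G_def
      by (safe intro!: sum.mono_neutral_cong_left) (auto split: if_splits)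
    ultimately show "(\<lambda>x. f x + g x) \<in> algebraic_sum S"
      by (simp add: sum.distrib)
  next
    fix f and c :: real assume "f \<in> algebraic_sum S"
    then obtain n f' where f: "f = (\<lambda>x. \<Sum>i<n. f' i x)" "\<forall>i<n. f' i \<in> S i"
      unfolding algebraic_sum_iff by (elim exE conjE)
    have "(\<lambda>x. \<Sum>i<n. c * f' i x) \<in> algebraic_sum S"
      using f(2) by (intro algebraic_sumI closed_subspaceD(4)[OF S]) simp
    then show "(\<lambda>x. c * f x) \<in> algebraic_sum S" by (simp add: f(1) sum_distrib_left)
  qed
qed

text \<open>The partial sum of the projections is the best approximation of \<open>g\<close> from
  the first \<open>n\<close> subspaces, and the errors tend to 0 because the algebraic sum is dense.
  This is the Hilbert space side of countable additivity.\<close>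

theorem L2_proj_sum_norm:
  assumes S: "\<And>i. closed_subspace M (S i)"
    and orth: "\<And>i j. i \<noteq> j \<Longrightarrow> L2_orthogonal M (S i) (S j)"
    and f: "f \<in> L2 M M"
  shows "(\<lambda>i. (L2_norm M (L2_proj M (S i) f))\<^sup>2) sums
    (L2_norm M (L2_proj M (L2_closure M (algebraic_sum S)) f))\<^sup>2"
proof -
  define T where "T = L2_closure M (algebraic_sum S)"
  have T: "closed_subspace M T"
    unfolding T_def by (rule closed_subspace_sum(2)[OF S])
  have VT: "algebraic_sum S \<subseteq> T"
    unfolding T_def by (rule L2_closure_subset[OF closed_subspace_sum(1)[OF S]])
  define p where "p i = L2_proj M (S i) f" for i
  define s where "s n x = (\<Sum>i<n. p i x)" for n x
  define g where "g = L2_proj M T f"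
  have SM: "h \<in> L2 M M" if "h \<in> S i" for h i using closed_subspaceD(1)[OF S] that by auto
  have pS: "p i \<in> S i" for i unfolding p_def by (rule L2_proj_in[OF S f])
  note p2 = SM[OF pS]
  have gT: "g \<in> T" unfolding g_def by (rule L2_proj_in[OF T f])
  have g2: "g \<in> L2 M M" unfolding g_def by (rule L2_proj_L2[OF T f])
  have sV: "s n \<in> algebraic_sum S" for n
    unfolding s_def[abs_def] by (intro algebraic_sumI pS)
  have s2: "s n \<in> L2 M M" for n unfolding s_def[abs_def] by (intro L2_intros p2)
  have sh: "L2_inner M (s n) h = (if i < n then L2_inner M (p i) h else 0)" if h: "h \<in> S i" for n h i
  proof -
    have "L2_inner M (s n) h = (\<Sum>j<n. L2_inner M (p j) h)"
      unfolding s_def[abs_def] by (rule L2_inner_sum_left) (use p2 SM[OF h] in auto)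
    also have "\<dots> = (\<Sum>j<n. if j = i then L2_inner M (p i) h else 0)"
      by (intro sum.cong) (use orth pS h in \<open>auto simp: L2_orthogonal_def\<close>)
    also have "\<dots> = (if i < n then L2_inner M (p i) h else 0)" by simp
    finally show ?thesis .
  qed
  have gh: "L2_inner M g h = L2_inner M f h" if "h \<in> T" for h
    unfolding g_def using L2_inner_proj[OF T f that] by simp
  have fh: "L2_inner M f h = L2_inner M (p i) h" if "h \<in> S i" for h i
    unfolding p_def by (rule L2_inner_proj[OF S f that])
  have gs_orth: "L2_inner M (\<lambda>x. g x - s n x) (\<lambda>x. \<Sum>i<n. v i x) = 0"
    if v: "\<And>i. i < n \<Longrightarrow> v i \<in> S i" for n v
  proof -
    have v2: "v i \<in> L2 M M" if "i < n" for i using v SM that by auto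
    have "L2_inner M (\<lambda>x. g x - s n x) (\<lambda>x. \<Sum>i<n. v i x)
      = (\<Sum>i<n. L2_inner M (v i) (\<lambda>x. g x - s n x))"
      unfolding L2_inner_commute[of M "\<lambda>x. g x - s n x"]
      by (rule L2_inner_sum_left) (use v2 g2 s2 in \<open>auto intro: L2_intros\<close>)
    also have "\<dots> = 0"
    proof (rule sum.neutral, intro ballI)
      fix i assume "i \<in> {..<n}"
      then have i: "i < n" by simp
      have "v i \<in> T"
      proof -
        have "(\<lambda>x. \<Sum>j<Suc i. (if j = i then v i else (\<lambda>_. 0)) x) \<in> algebraic_sum S"
          using v[OF i] closed_subspaceD(2)[OF S] by (intro algebraic_sumI) auto
        moreover have "(\<lambda>x. \<Sum>j<Suc i. (if j = i then v i else (\<lambda>_. 0)) x) = v i"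
          by (auto simp: fun_eq_iff if_distrib[of "\<lambda>f. f _"] intro!: sum.neutral)
        ultimately show ?thesis using VT by auto
      qed
      then show "L2_inner M (v i) (\<lambda>x. g x - s n x) = 0"
        using gh fh[OF v[OF i]] sh[OF v[OF i], of n] i v2[OF i] g2 s2
        by (simp add: L2_inner_commute[of M "v i"] L2_inner_simps)
    qed
    finally show ?thesis .
  qed
  have ss: "(L2_norm M (s n))\<^sup>2 = (\<Sum>i<n. (L2_norm M (p i))\<^sup>2)" for n
  proof -
    have "(L2_norm M (s n))\<^sup>2 = (\<Sum>i<n. L2_inner M (p i) (s n))"
      unfolding L2_norm_power2 by (subst (1) s_def[abs_def], rule L2_inner_sum_left) (use p2 s2 in auto)
    also have "\<dots> = (\<Sum>i<n. (L2_norm M (p i))\<^sup>2)"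
      by (intro sum.cong) (auto simp: L2_inner_commute[of M "p _" "s n"] sh[OF pS] L2_norm_power2)
    finally show ?thesis .
  qed
  \<comment> \<open>The squared error of any competitor from the first \<open>n\<close> subspaces
    exceeds that of \<open>s n\<close> by its squared distance from \<open>s n\<close>.\<close>
  have Pyth: "(L2_norm M (\<lambda>x. g x - (\<Sum>i<n. v i x)))\<^sup>2 =
      (L2_norm M (\<lambda>x. g x - s n x))\<^sup>2 + (L2_norm M (\<lambda>x. \<Sum>i<n. p i x - v i x))\<^sup>2"
    if v: "\<And>i. i < n \<Longrightarrow> v i \<in> S i" for n v
  proof -
    let ?a = "\<lambda>x. g x - s n x" and ?b = "\<lambda>x. \<Sum>i<n. p i x - v i x"
    have v2: "v i \<in> L2 M M" if "i < n" for i using v SM that by auto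
    have ab: "?a \<in> L2 M M" "?b \<in> L2 M M"
      using g2 s2 p2 v2 by (auto intro!: L2_intros)
    have "L2_inner M ?a ?b = 0"
      by (rule gs_orth) (intro closed_subspaceD(5)[OF S] pS v)
    then have "(L2_norm M (\<lambda>x. ?a x + ?b x))\<^sup>2 = (L2_norm M ?a)\<^sup>2 + (L2_norm M ?b)\<^sup>2"
      using ab by (simp add: L2_norm_power2 L2_inner_add_left L2_inner_add_right L2_intros
          L2_inner_commute[of M ?b ?a])
    moreover have "(\<lambda>x. ?a x + ?b x) = (\<lambda>x. g x - (\<Sum>i<n. v i x))"
      by (simp add: s_def fun_eq_iff sum_subtractf)
    ultimately show ?thesis by simp
  qed
  have gs: "(L2_norm M g)\<^sup>2 = (L2_norm M (\<lambda>x. g x - s n x))\<^sup>2 + (L2_norm M (s n))\<^sup>2" for n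
    using Pyth[of n "\<lambda>_ _. 0"] closed_subspaceD(2)[OF S] by (simp add: s_def[abs_def])
  have "(\<lambda>n. (L2_norm M (s n))\<^sup>2) \<longlonglongrightarrow> (L2_norm M g)\<^sup>2"
  proof (rule LIMSEQ_I)
    fix e :: real assume "e > 0"
    \<comment> \<open>One finite sum within \<open>sqrt e\<close> of \<open>g\<close> fixes the
      index \<open>n\<close>. There \<open>s n\<close> is at least as close, and the norms of later
      \<open>s m\<close> only increase towards that of \<open>g\<close>.\<close>
    obtain v where v: "v \<in> algebraic_sum S" "L2_norm M (\<lambda>x. g x - v x) < sqrt e"
      using L2_closureE[OF gT[unfolded T_def], of "sqrt e"] \<open>e > 0\<close> by auto
    obtain n w where w: "v = (\<lambda>x. \<Sum>i<n. w i x)" and "\<forall>i<n. w i \<in> S i"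
      using v(1) unfolding algebraic_sum_iff by (elim exE conjE)
    then have wS: "\<And>i. i < n \<Longrightarrow> w i \<in> S i" by simp
    have "(L2_norm M (\<lambda>x. g x - v x))\<^sup>2 < (sqrt e)\<^sup>2"
      using v(2) by (intro power_strict_mono) (auto simp: L2_norm_nonneg)
    then have "(L2_norm M (\<lambda>x. g x - (\<Sum>i<n. w i x)))\<^sup>2 < e"
      using \<open>e > 0\<close> by (simp add: w)
    moreover have "0 \<le> (L2_norm M (\<lambda>x. \<Sum>i<n. p i x - w i x))\<^sup>2" by simp
    ultimately have "(L2_norm M (\<lambda>x. g x - s n x))\<^sup>2 < e"
      using Pyth[of n w, OF wS] by linarith
    then have "(L2_norm M g)\<^sup>2 - (L2_norm M (s n))\<^sup>2 < e" using gs[of n] by simp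
    moreover have "(L2_norm M (s n))\<^sup>2 \<le> (L2_norm M (s m))\<^sup>2" if "n \<le> m" for m
      unfolding ss by (rule sum_mono2) (use that in auto)
    moreover have "(L2_norm M (s m))\<^sup>2 \<le> (L2_norm M g)\<^sup>2" for m using gs[of m] by simp
    ultimately show "\<exists>n0. \<forall>n\<ge>n0. norm ((L2_norm M (s n))\<^sup>2 - (L2_norm M g)\<^sup>2) < e"
      by (intro exI[of _ n]) (smt (verit) real_norm_def)
  qed
  then show ?thesis unfolding sums_def ss p_def g_def T_def .
qed

section \<open>L2 of a sub-sigma-field, and conditional expectation as projection\<close>

lemma sub_sigma_field_AE_measurable:
  assumes A: "sub_sigma_field M A" and g: "g \<in> borel_measurable A"
    and f: "f \<in> borel_measurable M" and eq: "AE x in M. f x = g x"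
  shows "(f :: 'a \<Rightarrow> real) \<in> borel_measurable A"
proof (rule measurableI)
  have sub: "subalgebra M A" and null: "null_sets M \<subseteq> sets A" and sp: "space A = space M"
    using A by (auto simp: sub_sigma_field_def subalgebra_def)
  have gM: "g \<in> borel_measurable M" by (rule measurable_from_subalg[OF sub g])
  fix X :: "real set" assume X: "X \<in> sets borel"
  \<comment> \<open>Off this null set \<open>f\<close> and \<open>g\<close> coincide, and every
    measurable part of it belongs to \<open>A\<close>; so the preimages under \<open>f\<close> and
    \<open>g\<close> differ by sets of \<open>A\<close>.\<close>
  define N where "N = {x \<in> space M. f x \<noteq> g x}"
  have "N \<in> sets M" unfolding N_def using f gM by measurable
  then have N: "N \<in> null_sets M"
    using eq unfolding N_def by (subst AE_iff_null[symmetric]) auto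
  have "f -` X \<inter> space M \<inter> N \<in> null_sets M"
    by (rule null_set_Int1[OF N measurable_sets[OF f X]])
  moreover have "f -` X \<inter> space M \<inter> N = f -` X \<inter> N" by (auto simp: N_def)
  ultimately have "f -` X \<inter> N \<in> null_sets M" by simp
  then have "f -` X \<inter> N \<in> sets A" "N \<in> sets A" using null N by auto
  moreover have "g -` X \<inter> space A \<in> sets A" by (rule measurable_sets[OF g X])
  ultimately have "(g -` X \<inter> space A - N) \<union> (f -` X \<inter> N) \<in> sets A" by auto
  moreover have "(g -` X \<inter> space A - N) \<union> (f -` X \<inter> N) = f -` X \<inter> space A"
    by (auto simp: N_def sp)
  ultimately show "f -` X \<inter> space A \<in> sets A" by simp
qed simp

text \<open>A limit in the seminorm agrees almost everywhere with the \<open>A\<close>-measurable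
  limit from \<open>L2_complete\<close>. As \<open>A\<close> contains all null sets, the given
  representative is \<open>A\<close>-measurable too.\<close>

lemma closed_subspace_L2:
  assumes A: "sub_sigma_field M A"
  shows "closed_subspace M (L2 M A)"
proof (rule closed_subspaceI)
  have sub: "subalgebra M A" using A by (simp add: sub_sigma_field_def)
  show "L2 M A \<subseteq> L2 M M" by (rule L2_subset[OF sub])
  show "(\<lambda>x. f x + g x) \<in> L2 M A" if "f \<in> L2 M A" "g \<in> L2 M A" for f g
    using that by (rule L2_add[OF sub])
  fix f u
  assume f: "f \<in> L2 M M" and u: "\<And>n. u n \<in> L2 M A"
    and lim: "(\<lambda>n. L2_norm M (\<lambda>x. u n x - f x)) \<longlonglongrightarrow> 0"
  have uM: "u n \<in> L2 M M" for n using u L2_subset[OF sub] by auto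
  have "\<exists>N. \<forall>m\<ge>N. \<forall>n\<ge>N. L2_norm M (\<lambda>x. u m x - u n x) < e" if "e > 0" for e
  proof -
    have "e / 2 > 0" using that by simp
    from LIMSEQ_D[OF lim this] obtain N where N: "\<And>n. n \<ge> N \<Longrightarrow> L2_norm M (\<lambda>x. u n x - f x) < e / 2"
      by (auto simp: L2_norm_nonneg)
    have "L2_norm M (\<lambda>x. u m x - u n x) < e" if "m \<ge> N" "n \<ge> N" for m n
      using L2_norm_triangle_diff[OF uM f uM, of m n] N[OF that(1)] N[OF that(2)]
        L2_norm_minus_commute[of M f "u n"] by simp
    then show ?thesis by auto
  qed
  from L2_complete[OF sub u this]
  obtain g where g: "g \<in> L2 M A" and lim': "(\<lambda>n. L2_norm M (\<lambda>x. u n x - g x)) \<longlonglongrightarrow> 0" by blast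
  have g2: "g \<in> L2 M M" using g L2_subset[OF sub] by auto
  have "L2_norm M (\<lambda>x. f x - g x) \<le> 0 + 0"
  proof (rule LIMSEQ_le_const)
    show "(\<lambda>n. L2_norm M (\<lambda>x. u n x - f x) + L2_norm M (\<lambda>x. u n x - g x)) \<longlonglongrightarrow> 0 + 0"
      by (intro tendsto_add lim lim')
    show "\<exists>N. \<forall>n\<ge>N. L2_norm M (\<lambda>x. f x - g x)
        \<le> L2_norm M (\<lambda>x. u n x - f x) + L2_norm M (\<lambda>x. u n x - g x)"
      using L2_norm_triangle_diff[OF f uM g2] L2_norm_minus_commute[of M f] by auto
  qed
  then have "AE x in M. f x = g x"
    using L2_norm_nonneg[of M "\<lambda>x. f x - g x"] by (simp add: L2_norm_diff_eq_0[OF f g2])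
  then have "f \<in> borel_measurable A"
    using f g by (intro sub_sigma_field_AE_measurable[OF A, of g f]) (auto simp: L2_def)
  then show "f \<in> L2 M A" using f by (simp add: L2_def)
qed (auto simp: L2_zero L2_cmult)

text \<open>Orthogonality of the error, tested on indicators of sets of \<open>A\<close>, is the
  integral identity that characterizes the conditional expectation.\<close>

lemma
  assumes A: "sub_sigma_field M A" and f: "f \<in> L2 M M"
  shows real_cond_exp_AE_proj: "AE x in M. real_cond_exp M A f x = L2_proj M (L2 M A) f x"
    and real_cond_exp_L2: "real_cond_exp M A f \<in> L2 M A"
    and L2_norm_real_cond_exp: "L2_norm M (real_cond_exp M A f) = L2_norm M (L2_proj M (L2 M A) f)"
proof -
  have sub: "subalgebra M A" using A by (simp add: sub_sigma_field_def)
  interpret A: finite_measure_subalgebra M A by standard (rule sub)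
  note S = closed_subspace_L2[OF A]
  let ?p = "L2_proj M (L2 M A) f"
  have p: "?p \<in> L2 M A" "?p \<in> L2 M M" using L2_proj_in[OF S f] L2_proj_L2[OF S f] by auto
  show AE: "AE x in M. real_cond_exp M A f x = ?p x"
  proof (rule A.real_cond_exp_charact)
    show "integrable M f" "integrable M ?p" using f p by (auto intro: L2_integrable)
    show "?p \<in> borel_measurable A" using p by (simp add: L2_def)
    fix X assume X: "X \<in> sets A"
    have "L2_inner M f (indicator X) = L2_inner M ?p (indicator X)"
      by (rule L2_inner_proj[OF S f L2_indicator[OF X sub]])
    then show "(\<integral>x\<in>X. f x \<partial>M) = (\<integral>x\<in>X. ?p x \<partial>M)"
      by (simp add: L2_inner_def set_lebesgue_integral_def mult.commute)
  qed
  have m: "real_cond_exp M A f \<in> borel_measurable A" "real_cond_exp M A f \<in> borel_measurable M"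
    by auto
  show "real_cond_exp M A f \<in> L2 M A"
    using L2_cong_AE[OF AE_symmetric[OF AE] p(2) m(2)] m(1) by (simp add: L2_def)
  show "L2_norm M (real_cond_exp M A f) = L2_norm M ?p"
    by (rule L2_norm_cong_AE[OF AE m(2)]) (use p in \<open>auto simp: L2_def\<close>)
qed

end

section \<open>Orthogonal decompositions from spectral measures\<close>

context prob_space
begin

text \<open>When \<open>\<mu> f X\<close> is the squared norm of a projection of \<open>f\<close>,
  equality with the full squared norm says that \<open>f\<close> lies in the range. The subspace is
  thus recovered from the measures without any choice.\<close>

definition spectral_subspace :: "(('a \<Rightarrow> real) \<Rightarrow> 'b measure) \<Rightarrow> 'b set \<Rightarrow> ('a \<Rightarrow> real) set" where
  "spectral_subspace \<mu> X = {f \<in> L2 M M. measure (\<mu> f) X = (L2_norm M f)\<^sup>2}"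

lemma spectral_subspace_eq:
  assumes "closed_subspace M S"
    and "\<And>f. f \<in> L2 M M \<Longrightarrow> (L2_norm M (L2_proj M S f))\<^sup>2 = measure (\<mu> f) X"
  shows "spectral_subspace \<mu> X = S"
  using L2_proj_norm_eq_iff[OF assms(1)] assms(2) closed_subspaceD(1)[OF assms(1)]
  by (auto simp: spectral_subspace_def)

text \<open>A vector of \<open>S\<close> spends its whole norm on \<open>S\<close>, so its
  projection onto \<open>T\<close> has norm 0.\<close>

lemma spectral_subspaces_orthogonal:
  assumes S: "closed_subspace M S" and T: "closed_subspace M T"
    and le: "\<And>f. f \<in> L2 M M \<Longrightarrow>
      (L2_norm M (L2_proj M S f))\<^sup>2 + (L2_norm M (L2_proj M T f))\<^sup>2 \<le> (L2_norm M f)\<^sup>2"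
  shows "L2_orthogonal M S T"
  unfolding L2_orthogonal_def
proof (intro ballI)
  fix f g assume f: "f \<in> S" and g: "g \<in> T"
  have f2: "f \<in> L2 M M" and g2: "g \<in> L2 M M"
    using f g closed_subspaceD(1)[OF S] closed_subspaceD(1)[OF T] by auto
  have "(L2_norm M (L2_proj M T f))\<^sup>2 \<le> 0"
    using le[OF f2] L2_proj_norm_eq_iff[OF S f2] f by simp
  then have "L2_norm M (L2_proj M T f) = 0" by simp
  then have "\<bar>L2_inner M (L2_proj M T f) g\<bar> \<le> 0"
    using L2_Cauchy_Schwarz[OF L2_proj_L2[OF T f2] g2] by simp
  then show "L2_inner M f g = 0" using L2_inner_proj[OF T f2 g] by simp
qed

text \<open>Two disjoint sets together have at most the total mass, which forces orthogonality; then
  both sides of the union formula are sums of the same series. It serves the Dynkin induction as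
  well as the sigma-additivity of the final family.\<close>

lemma spectral_sum:
  fixes \<mu> :: "('a \<Rightarrow> real) \<Rightarrow> 'b measure"
  assumes sets: "\<And>f. f \<in> L2 M M \<Longrightarrow> sets (\<mu> f) = sets B"
    and fin: "\<And>f. f \<in> L2 M M \<Longrightarrow> finite_measure (\<mu> f)"
    and total: "\<And>f. f \<in> L2 M M \<Longrightarrow> measure (\<mu> f) (space B) = (L2_norm M f)\<^sup>2"
    and S: "\<And>i. closed_subspace M (S i)"
      "\<And>i f. f \<in> L2 M M \<Longrightarrow> (L2_norm M (L2_proj M (S i) f))\<^sup>2 = measure (\<mu> f) (A i)"
    and A: "\<And>i. A i \<in> sets B" "disjoint_family A"
  shows "i \<noteq> j \<Longrightarrow> L2_orthogonal M (S i) (S j)"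
    and "f \<in> L2 M M \<Longrightarrow>
      (L2_norm M (L2_proj M (L2_closure M (algebraic_sum S)) f))\<^sup>2 = measure (\<mu> f) (\<Union>i. A i)"
proof -
  show orth: "L2_orthogonal M (S i) (S j)" if "i \<noteq> j" for i j
  proof (rule spectral_subspaces_orthogonal[OF S(1) S(1)])
    fix f assume f: "f \<in> L2 M M"
    interpret \<mu>: finite_measure "\<mu> f" by (rule fin[OF f])
    have "measure (\<mu> f) (A i) + measure (\<mu> f) (A j) = measure (\<mu> f) (A i \<union> A j)"
      using that A
      by (intro \<mu>.finite_measure_Union[symmetric]) (auto simp: disjoint_family_on_def sets[OF f])
    also have "\<dots> \<le> (L2_norm M f)\<^sup>2"
      using \<mu>.bounded_measure[of "A i \<union> A j"] total[OF f] sets_eq_imp_space_eq[OF sets[OF f]] by simp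
    finally show "(L2_norm M (L2_proj M (S i) f))\<^sup>2 + (L2_norm M (L2_proj M (S j) f))\<^sup>2 \<le> (L2_norm M f)\<^sup>2"
      by (simp add: S(2)[OF f])
  qed
  assume f: "f \<in> L2 M M"
  interpret \<mu>: finite_measure "\<mu> f" by (rule fin[OF f])
  have "(\<lambda>i. measure (\<mu> f) (A i)) sums measure (\<mu> f) (\<Union>i. A i)"
    using A by (intro \<mu>.finite_measure_UNION) (auto simp: sets[OF f])
  moreover have "(\<lambda>i. measure (\<mu> f) (A i)) sums
      (L2_norm M (L2_proj M (L2_closure M (algebraic_sum S)) f))\<^sup>2"
    using L2_proj_sum_norm[OF S(1) orth f] by (simp add: S(2)[OF f])
  ultimately show "(L2_norm M (L2_proj M (L2_closure M (algebraic_sum S)) f))\<^sup>2 =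
      measure (\<mu> f) (\<Union>i. A i)" by (simp add: sums_unique2)
qed

text \<open>The induction property asks for one subspace that serves all \<open>f\<close> at once.
  Orthogonal complements and closed orthogonal sums preserve it, but intersections have no such
  counterpart here; hence the induction over complements and disjoint unions, with \<open>G\<close>
  closed under intersection.\<close>

lemma spectral_subspace_Dynkin:
  fixes \<mu> :: "('a \<Rightarrow> real) \<Rightarrow> 'b measure"
  assumes sets: "\<And>f. f \<in> L2 M M \<Longrightarrow> sets (\<mu> f) = sets B"
    and fin: "\<And>f. f \<in> L2 M M \<Longrightarrow> finite_measure (\<mu> f)"
    and total: "\<And>f. f \<in> L2 M M \<Longrightarrow> measure (\<mu> f) (space B) = (L2_norm M f)\<^sup>2"
    and gen: "sets B = sigma_sets (space B) G" "Int_stable G"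
    and proj: "\<And>X. X \<in> G \<Longrightarrow> \<exists>S. closed_subspace M S \<and>
      (\<forall>f\<in>L2 M M. (L2_norm M (L2_proj M S f))\<^sup>2 = measure (\<mu> f) X)"
    and X: "X \<in> sets B"
  shows "closed_subspace M (spectral_subspace \<mu> X)"
    and "f \<in> L2 M M \<Longrightarrow> (L2_norm M (L2_proj M (spectral_subspace \<mu> X) f))\<^sup>2 = measure (\<mu> f) X"
proof -
  have space: "space (\<mu> f) = space B" if "f \<in> L2 M M" for f
    by (rule sets_eq_imp_space_eq[OF sets[OF that]])
  have GB: "G \<subseteq> sets B" unfolding gen(1) by auto
  let ?P = "\<lambda>X. \<exists>S. closed_subspace M S \<and>
    (\<forall>f\<in>L2 M M. (L2_norm M (L2_proj M S f))\<^sup>2 = measure (\<mu> f) X)"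
  have "?P X"
    using gen(2) GB[THEN order_trans, OF sets.space_closed] X[unfolded gen(1)]
  proof (induction rule: sigma_sets_induct_disjoint)
    case (basic A)
    then show ?case by (rule proj)
  next
    case empty
    show ?case
    proof (intro exI conjI ballI)
      \<comment> \<open>The complement of the whole space is the zero subspace: the functions that
        vanish almost everywhere.\<close>
      show "closed_subspace M (L2_orth_compl (L2 M M))"
        by (rule closed_subspace_orth_compl) simp
      fix f assume f: "f \<in> L2 M M"
      have "closed_subspace M (L2 M M)"
        by (rule closed_subspace_L2) (simp add: sub_sigma_field_def subalgebra_refl null_sets_def)
      then show "(L2_norm M (L2_proj M (L2_orth_compl (L2 M M)) f))\<^sup>2 = measure (\<mu> f) {}"
        using f by (simp add: L2_proj_orth_compl_norm L2_proj_norm_eq_iff[OF \<open>closed_subspace M (L2 M M)\<close> f, THEN iffD2])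
    qed
  next
    case (compl A)
    then obtain S where S: "closed_subspace M S"
      "\<And>f. f \<in> L2 M M \<Longrightarrow> (L2_norm M (L2_proj M S f))\<^sup>2 = measure (\<mu> f) A" by blast
    show ?case
    proof (intro exI conjI ballI)
      show "closed_subspace M (L2_orth_compl S)"
        by (rule closed_subspace_orth_compl[OF closed_subspaceD(1)[OF S(1)]])
      fix f assume f: "f \<in> L2 M M"
      interpret \<mu>: finite_measure "\<mu> f" by (rule fin[OF f])
      show "(L2_norm M (L2_proj M (L2_orth_compl S) f))\<^sup>2 = measure (\<mu> f) (space B - A)"
        using \<mu>.finite_measure_compl[of A] compl(1)
        by (simp add: L2_proj_orth_compl_norm[OF S(1) f] S(2)[OF f] total[OF f] space[OF f] sets[OF f] gen(1))
    qed
  next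
    case (union A)
    then have "\<forall>i. \<exists>S. closed_subspace M S \<and>
      (\<forall>f\<in>L2 M M. (L2_norm M (L2_proj M S f))\<^sup>2 = measure (\<mu> f) (A i))" by blast
    then obtain S where S: "\<And>i. closed_subspace M (S i)"
      "\<And>i f. f \<in> L2 M M \<Longrightarrow> (L2_norm M (L2_proj M (S i) f))\<^sup>2 = measure (\<mu> f) (A i)" by metis
    have AB: "A i \<in> sets B" for i using union(2) unfolding gen(1) by auto
    show ?case
    proof (intro exI conjI ballI)
      show "closed_subspace M (L2_closure M (algebraic_sum S))"
        by (rule closed_subspace_sum(2)[OF S(1)])
      show "(L2_norm M (L2_proj M (L2_closure M (algebraic_sum S)) f))\<^sup>2 = measure (\<mu> f) (\<Union>i. A i)"
        if "f \<in> L2 M M" for f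
        by (rule spectral_sum(2)[of \<mu> B S A, OF sets fin total S AB union(1) that])
    qed
  qed
  then obtain S where S: "closed_subspace M S"
      "\<And>f. f \<in> L2 M M \<Longrightarrow> (L2_norm M (L2_proj M S f))\<^sup>2 = measure (\<mu> f) X" by blast
  then have "spectral_subspace \<mu> X = S" by (intro spectral_subspace_eq)
  with S show "closed_subspace M (spectral_subspace \<mu> X)"
    "f \<in> L2 M M \<Longrightarrow> (L2_norm M (L2_proj M (spectral_subspace \<mu> X) f))\<^sup>2 = measure (\<mu> f) X"
    by auto
qed

theorem orthogonal_decomposition_spectral:
  fixes \<mu> :: "('a \<Rightarrow> real) \<Rightarrow> 'b measure"
  assumes sets: "\<And>f. f \<in> L2 M M \<Longrightarrow> sets (\<mu> f) = sets B"
    and fin: "\<And>f. f \<in> L2 M M \<Longrightarrow> finite_measure (\<mu> f)"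
    and total: "\<And>f. f \<in> L2 M M \<Longrightarrow> measure (\<mu> f) (space B) = (L2_norm M f)\<^sup>2"
    and closed: "\<And>X. X \<in> sets B \<Longrightarrow> closed_subspace M (spectral_subspace \<mu> X)"
    and proj: "\<And>f X. f \<in> L2 M M \<Longrightarrow> X \<in> sets B \<Longrightarrow>
      (L2_norm M (L2_proj M (spectral_subspace \<mu> X) f))\<^sup>2 = measure (\<mu> f) X"
  shows "orthogonal_decomposition M B (restrict (spectral_subspace \<mu>) (sets B))"
  unfolding orthogonal_decomposition_def
proof (intro conjI allI impI)
  let ?H = "restrict (spectral_subspace \<mu>) (sets B)"
  show "?H \<in> sets B \<rightarrow>\<^sub>E {S. closed_subspace M S}" using closed by auto
  show "?H (space B) = L2 M M" using total by (auto simp: spectral_subspace_def)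
  fix X :: "nat \<Rightarrow> 'b set" assume X: "range X \<subseteq> sets B" and disj: "disjoint_family X"
  have XB: "X i \<in> sets B" for i using X by auto
  then have H: "?H (X i) = spectral_subspace \<mu> (X i)" for i by simp
  have cl: "closed_subspace M (?H (X i))" for i unfolding H by (rule closed[OF XB])
  have pr: "(L2_norm M (L2_proj M (?H (X i)) f))\<^sup>2 = measure (\<mu> f) (X i)" if "f \<in> L2 M M" for f i
    unfolding H by (rule proj[OF that XB])
  show "L2_orthogonal M (?H (X i)) (?H (X j))" if "i \<noteq> j" for i j
    by (rule spectral_sum(1)[of \<mu> B "\<lambda>i. ?H (X i)" X, OF sets fin total cl pr XB disj that])
  have "?H (\<Union>i. X i) = spectral_subspace \<mu> (\<Union>i. X i)" using XB by auto
  also have "\<dots> = L2_closure M (algebraic_sum (\<lambda>i. ?H (X i)))"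
    by (rule spectral_subspace_eq[OF closed_subspace_sum(2)[OF cl]
          spectral_sum(2)[of \<mu> B "\<lambda>i. ?H (X i)" X, OF sets fin total cl pr XB disj]])
  finally show "?H (\<Union>i. X i) = L2_closure M (algebraic_sum (\<lambda>i. ?H (X i)))" .
qed

section \<open>Measures obtained from a decomposition\<close>

lemma orthogonal_decompositionD:
  assumes "orthogonal_decomposition M B H"
  shows "X \<in> sets B \<Longrightarrow> closed_subspace M (H X)" "H (space B) = L2 M M"
    "H \<in> extensional (sets B)"
    "range A \<subseteq> sets B \<Longrightarrow> disjoint_family A \<Longrightarrow> i \<noteq> j \<Longrightarrow> L2_orthogonal M (H (A i)) (H (A j))"
    "range A \<subseteq> sets B \<Longrightarrow> disjoint_family A \<Longrightarrow>
      H (\<Union>i. A i) = L2_closure M (algebraic_sum (\<lambda>i. H (A i)))"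
  using assms unfolding orthogonal_decomposition_def by (auto simp: PiE_def)

definition decomposition_measure ::
    "'b measure \<Rightarrow> ('b set \<Rightarrow> ('a \<Rightarrow> real) set) \<Rightarrow> ('a \<Rightarrow> real) \<Rightarrow> 'b measure" where
  "decomposition_measure B H f =
     measure_of (space B) (sets B) (\<lambda>X. ennreal ((L2_norm M (L2_proj M (H X) f))\<^sup>2))"

lemma decomposition_measure:
  assumes H: "orthogonal_decomposition M B H" and f: "f \<in> L2 M M"
  shows "sets (decomposition_measure B H f) = sets B"
    and "finite_measure (decomposition_measure B H f)"
    and "X \<in> sets B \<Longrightarrow> measure (decomposition_measure B H f) X = (L2_norm M (L2_proj M (H X) f))\<^sup>2"
proof -
  let ?\<mu> = "\<lambda>X. (L2_norm M (L2_proj M (H X) f))\<^sup>2"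
  note HD = orthogonal_decompositionD[OF H]
  have "?\<mu> {} = 0"
  proof -
    \<comment> \<open>The constant family of empty sets is disjoint, so \<open>H {}\<close> is
      orthogonal to itself and all its vectors have norm 0.\<close>
    have "L2_orthogonal M (H {}) (H {})" using HD(4)[of "\<lambda>_. {}" 0 1] by (simp add: disjoint_family_on_def)
    then show ?thesis
      using L2_proj_in[OF HD(1) f, of "{}"] by (simp add: L2_orthogonal_def L2_norm_power2)
  qed
  then have pos: "positive (sets B) (\<lambda>X. ennreal (?\<mu> X))" by (simp add: positive_def)
  have ca: "countably_additive (sets B) (\<lambda>X. ennreal (?\<mu> X))"
    unfolding countably_additive_def
  proof (intro allI impI)
    fix A :: "nat \<Rightarrow> 'b set" assume A: "range A \<subseteq> sets B" "disjoint_family A"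
    have "closed_subspace M (H (A i))" for i using A by (intro HD(1)) auto
    from L2_proj_sum_norm[OF this HD(4)[OF A] f]
    have "(\<lambda>i. ?\<mu> (A i)) sums ?\<mu> (\<Union>i. A i)"
      by (simp add: HD(5)[OF A])
    then show "(\<Sum>i. ennreal (?\<mu> (A i))) = ennreal (?\<mu> (\<Union> (range A)))"
      by (intro suminf_ennreal_eq) auto
  qed
  show s: "sets (decomposition_measure B H f) = sets B"
    unfolding decomposition_measure_def by (simp add: sets.sigma_sets_eq sets.space_closed)
  have em: "emeasure (decomposition_measure B H f) X = ennreal (?\<mu> X)" if "X \<in> sets B" for X
    unfolding decomposition_measure_def
    by (rule emeasure_measure_of_sigma[OF sets.sigma_algebra_axioms pos ca that])
  then show "X \<in> sets B \<Longrightarrow> measure (decomposition_measure B H f) X = ?\<mu> X"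
    by (simp add: measure_def)
  show "finite_measure (decomposition_measure B H f)"
    by (rule finite_measureI) (simp add: sets_eq_imp_space_eq[OF s] em)
qed

end

section \<open>Elementary sets\<close>

text \<open>\<open>T\<close> contains all points where the indicator of \<open>E\<close> may jump.
  In this form Boolean operations merely unite the cut sets, whereas complements of unions of
  intervals would require sorting the end points.\<close>

definition cuts :: "real set \<Rightarrow> real set \<Rightarrow> bool" where
  "cuts T E \<longleftrightarrow> finite T \<and> (\<forall>x y. x \<le> y \<longrightarrow> {x..y} \<inter> T = {} \<longrightarrow> (x \<in> E \<longleftrightarrow> y \<in> E))"

text \<open>Leaving \<open>J\<close> upwards between \<open>x\<close> and \<open>y\<close> bounds
  \<open>J\<close> above and places \<open>Sup J\<close> in \<open>{x..y}\<close>; downwards the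
  same holds for \<open>Inf J\<close>. Where \<open>J\<close> is unbounded, \<open>Inf\<close> or
  \<open>Sup\<close> is an arbitrary number and only adds a harmless cut.\<close>

lemma cuts_interval:
  assumes J: "is_interval (J :: real set)"
  shows "cuts {Inf J, Sup J} J"
  unfolding cuts_def
proof (intro conjI allI impI)
  fix x y assume xy: "x \<le> y" "{x..y} \<inter> {Inf J, Sup J} = {}"
  have J': "z \<in> J" if "u \<in> J" "v \<in> J" "u \<le> z" "z \<le> v" for u v z
    using J that unfolding is_interval_1 by blast
  show "x \<in> J \<longleftrightarrow> y \<in> J"
  proof (rule iffI; rule ccontr)
    assume x: "x \<in> J" and y: "y \<notin> J"
    have le: "z \<le> y" if "z \<in> J" for z using J'[OF x that xy(1)] y by force
    then have "Sup J \<le> y" "x \<le> Sup J"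
      using x by (auto intro!: cSup_least cSup_upper bdd_aboveI[of _ y])
    then show False using xy by auto
  next
    assume y: "y \<in> J" and x: "x \<notin> J"
    have le: "x \<le> z" if "z \<in> J" for z using J'[OF that y _ xy(1)] x by force
    then have "x \<le> Inf J" "Inf J \<le> y"
      using y by (auto intro!: cInf_greatest cInf_lower bdd_belowI[of _ x])
    then show False using xy by auto
  qed
qed simp

lemma cuts_mono: "cuts T E \<Longrightarrow> T \<subseteq> T' \<Longrightarrow> finite T' \<Longrightarrow> cuts T' E"
  unfolding cuts_def by blast

lemma cuts_Un:
  assumes "cuts T E" "cuts T' E'" shows "cuts (T \<union> T') (E \<union> E')"
proof -
  have "cuts (T \<union> T') E" "cuts (T \<union> T') E'"
    using cuts_mono[OF assms(1), of "T \<union> T'"] cuts_mono[OF assms(2), of "T \<union> T'"] assms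
    by (simp_all add: cuts_def[of T] cuts_def[of T'])
  then show ?thesis unfolding cuts_def by blast
qed

lemma cuts_compl: "cuts T E \<Longrightarrow> cuts T (- E)"
  unfolding cuts_def by blast

lemma cuts_Int: "cuts T E \<Longrightarrow> cuts T' E' \<Longrightarrow> cuts (T \<union> T') (E \<inter> E')"
  using cuts_compl[OF cuts_Un[OF cuts_compl cuts_compl], of T E T' E'] by simp

lemma cuts_constant:
  assumes "cuts T E" "{c<..<d} \<inter> T = {}" "x \<in> {c<..<d}" "y \<in> {c<..<d}"
  shows "x \<in> E \<longleftrightarrow> y \<in> E"
proof -
  have "{x..y} \<subseteq> {c<..<d}" "{y..x} \<subseteq> {c<..<d}" using assms(3,4) by auto
  then have "{x..y} \<inter> T = {}" "{y..x} \<inter> T = {}" using assms(2) by blast+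
  then show ?thesis using assms(1) unfolding cuts_def by (cases "x \<le> y") (blast, metis linear)
qed

lemma elementary_cuts:
  assumes "elementary E" shows "\<exists>T. cuts T E"
proof -
  obtain I where I: "finite I" "\<forall>J\<in>I. is_interval J" "E = \<Union>I"
    using assms by (auto simp: elementary_def)
  have "\<exists>T. cuts T (\<Union>I)" using I(1,2)
  proof (induction I)
    case empty
    then show ?case by (intro exI[of _ "{}"]) (simp add: cuts_def)
  next
    case (insert J I)
    then show ?case using cuts_Un[OF cuts_interval[of J]] by auto
  qed
  then show ?thesis using I(3) by simp
qed

lemma cuts_elementary:
  assumes T: "cuts T E" shows "elementary E"
proof -
  \<comment> \<open>Points of \<open>E\<close> with the same set \<open>S\<close> of cuts to their
    left form one gap between cuts. Indexing by subsets of \<open>T\<close> keeps the family finite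
    without sorting \<open>T\<close>.\<close>
  define J where "J S = {x \<in> E. x \<notin> T \<and> {t \<in> T. t < x} = S}" for S
  have fin: "finite T" using T by (simp add: cuts_def)
  have "is_interval (J S)" for S
    unfolding is_interval_1
  proof (intro ballI allI impI, elim conjE)
    fix x y z assume *: "x \<in> J S" "y \<in> J S" "x \<le> z" "z \<le> y"
    have noT: "{x..y} \<inter> T = {}"
    proof (rule ccontr)
      assume "{x..y} \<inter> T \<noteq> {}"
      then obtain t where t: "t \<in> T" "x \<le> t" "t \<le> y" by auto
      then have "t < y" using *(2) by (auto simp: J_def order_le_less)
      then have "t \<in> S" using t(1) *(2) by (auto simp: J_def)
      then show False using t(2) *(1) by (auto simp: J_def)
    qed
    moreover have "{x..z} \<subseteq> {x..y}" using *(4) by auto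
    ultimately have "{x..z} \<inter> T = {}" by blast
    then have "z \<in> E" using T *(1,3) unfolding cuts_def by (auto simp: J_def)
    moreover have "{t \<in> T. t < z} = {t \<in> T. t < x}"
      using noT * by (auto simp: disjoint_iff) (meson less_imp_le linorder_not_less order_trans)
    moreover have "z \<notin> T" using noT * by auto
    ultimately show "z \<in> J S" using *(1) by (simp add: J_def)
  qed
  moreover have "is_interval {t}" for t :: real
    by (auto simp: is_interval_1)
  moreover have "E = \<Union>((\<lambda>t. {t}) ` (T \<inter> E) \<union> J ` Pow T)"
  proof (intro equalityI subsetI)
    fix x assume "x \<in> E"
    then show "x \<in> \<Union>((\<lambda>t. {t}) ` (T \<inter> E) \<union> J ` Pow T)"
      by (cases "x \<in> T") (auto intro!: bexI[of _ "{t \<in> T. t < x}"] simp: J_def)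
  next
    fix x assume "x \<in> \<Union>((\<lambda>t. {t}) ` (T \<inter> E) \<union> J ` Pow T)"
    then show "x \<in> E" unfolding J_def by blast
  qed
  ultimately show ?thesis
    unfolding elementary_def using fin
    by (intro exI[of _ "(\<lambda>t. {t}) ` (T \<inter> E) \<union> J ` Pow T"]) auto
qed

lemma elementary_iff_cuts: "elementary E \<longleftrightarrow> (\<exists>T. cuts T E)"
  using elementary_cuts cuts_elementary by blast

lemma elementary_compl: "elementary E \<Longrightarrow> elementary (- E)"
  unfolding elementary_iff_cuts using cuts_compl by blast

lemma elementary_Un: "elementary E \<Longrightarrow> elementary E' \<Longrightarrow> elementary (E \<union> E')"
  unfolding elementary_iff_cuts using cuts_Un by blast

lemma elementary_Int: "elementary E \<Longrightarrow> elementary E' \<Longrightarrow> elementary (E \<inter> E')"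
  unfolding elementary_iff_cuts using cuts_Int by blast

lemma elementary_Diff: "elementary E \<Longrightarrow> elementary E' \<Longrightarrow> elementary (E - E')"
  unfolding Diff_eq by (intro elementary_Int elementary_compl)

lemma elementary_interval: "is_interval J \<Longrightarrow> elementary J"
  unfolding elementary_def by (intro exI[of _ "{J}"]) simp

lemma elementary_UN: "finite I \<Longrightarrow> (\<And>i. i \<in> I \<Longrightarrow> elementary (E i)) \<Longrightarrow> elementary (\<Union>i\<in>I. E i)"
proof (induction rule: finite_induct)
  case empty
  then show ?case by (simp add: elementary_interval)
qed (simp add: elementary_Un)

lemma interval_decomposition_exists:
  assumes "elementary E" shows "\<exists>I. interval_decomposition E I"
proof -
  obtain T where T: "cuts T E" using elementary_cuts[OF assms] by auto
  then have fin: "finite T" by (simp add: cuts_def)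
  define I where "I = {(s, t). s \<in> insert (-\<infinity>) (ereal ` T) \<and> t \<in> insert \<infinity> (ereal ` T) \<and> s < t \<and>
    einterval s t \<inter> T = {} \<and> einterval s t \<subseteq> E}"
  have "finite I"
    by (rule finite_subset[of _ "insert (-\<infinity>) (ereal ` T) \<times> insert \<infinity> (ereal ` T)"])
      (use fin in \<open>auto simp: I_def\<close>)
  moreover have "disjoint_family_on (\<lambda>(s, t). einterval s t) I"
  proof -
    \<comment> \<open>If two such intervals meet, an end point of one strictly inside the other
      would be a cut there; applied both ways, this makes the end points equal.\<close>
    have le: "s' \<le> s \<and> t \<le> t'"
      if I: "(s, t) \<in> I" "(s', t') \<in> I" and x: "x \<in> einterval s t" "x \<in> einterval s' t'" for s t s' t' x
    proof (rule conjI; rule ccontr)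
      assume "\<not> s' \<le> s"
      then have "s < s'" "s' < t" using x by (auto simp: einterval_def)
      moreover have "s' \<in> ereal ` T" using I(2) \<open>s < s'\<close> by (auto simp: I_def)
      ultimately show False using I(1) by (auto simp: I_def einterval_def)
    next
      assume "\<not> t \<le> t'"
      then have "t' < t" "s < t'" using x by (auto simp: einterval_def)
      moreover have "t' \<in> ereal ` T" using I(2) \<open>t' < t\<close> by (auto simp: I_def)
      ultimately show False using I(1) by (auto simp: I_def einterval_def)
    qed
    show ?thesis
      unfolding disjoint_family_on_def using le
      by (auto simp: disjoint_iff) (metis order_antisym)+
  qed
  moreover have "finite (sym_diff E (\<Union>(s, t)\<in>I. einterval s t))"
  proof (rule finite_subset[OF _ fin])
    have "x \<in> (\<Union>(s, t)\<in>I. einterval s t)" if x: "x \<in> E" "x \<notin> T" for x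
    proof -
      \<comment> \<open>The infinite elements keep \<open>A\<close> and \<open>B\<close> nonempty,
        so \<open>Max A\<close> and \<open>Min B\<close> are the end points nearest to
        \<open>x\<close> on either side.\<close>
      define A where "A = insert (-\<infinity>) (ereal ` {t \<in> T. t < x})"
      define B where "B = insert \<infinity> (ereal ` {t \<in> T. x < t})"
      have AB: "finite A" "A \<noteq> {}" "finite B" "B \<noteq> {}" using fin by (auto simp: A_def B_def)
      have m: "Max A \<in> A" "Min B \<in> B" using AB by auto
      have lt: "Max A < ereal x" "ereal x < Min B" using AB by (auto simp: A_def B_def)
      have noT: "einterval (Max A) (Min B) \<inter> T = {}"
      proof (rule ccontr)
        assume "einterval (Max A) (Min B) \<inter> T \<noteq> {}"
        then obtain t where t: "t \<in> T" "Max A < ereal t" "ereal t < Min B" by (auto simp: einterval_def)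
        have "t < x \<or> x < t" using t(1) x by (metis linorder_neqE)
        then show False
        proof
          assume "t < x"
          then have "ereal t \<in> A" using t by (auto simp: A_def)
          then show False using Max_ge[OF AB(1)] t(2) by fastforce
        next
          assume "x < t"
          then have "ereal t \<in> B" using t by (auto simp: B_def)
          then show False using Min_le[OF AB(3)] t(3) by fastforce
        qed
      qed
      have "y \<in> E" if y: "y \<in> einterval (Max A) (Min B)" for y
      proof -
        define lo hi where "lo = min x y" and "hi = max x y"
        have lohi: "Max A < ereal lo" "ereal hi < Min B"
          using y lt by (auto simp: lo_def hi_def min_def max_def einterval_def)
        have "{lo..hi} \<inter> T = {}"
        proof (rule ccontr)
          assume "{lo..hi} \<inter> T \<noteq> {}"
          then obtain t where t: "t \<in> T" "lo \<le> t" "t \<le> hi" by auto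
          then have "Max A < ereal t" "ereal t < Min B"
            using lohi by (auto intro: less_le_trans[of _ "ereal lo"] le_less_trans[of _ "ereal hi"])
          then have "t \<in> einterval (Max A) (Min B)"
            by (simp add: einterval_def)
          then show False using noT t(1) by auto
        qed
        then have "{min x y..max x y} \<inter> T = {}" by (simp add: lo_def hi_def)
        then have "min x y \<in> E \<longleftrightarrow> max x y \<in> E" using T unfolding cuts_def by auto
        then show ?thesis using x(1) by (auto simp: min_def max_def split: if_splits)
      qed
      moreover have "Max A < Min B" using lt by (rule less_trans)
      moreover have "Max A \<in> insert (-\<infinity>) (ereal ` T)" "Min B \<in> insert \<infinity> (ereal ` T)"
        using m by (auto simp: A_def B_def)
      ultimately have "(Max A, Min B) \<in> I" using noT by (auto simp: I_def)
      moreover have "x \<in> einterval (Max A) (Min B)" using lt by (simp add: einterval_def)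
      ultimately show ?thesis by auto
    qed
    moreover have "(\<Union>(s, t)\<in>I. einterval s t) \<subseteq> E" by (auto simp: I_def)
    ultimately show "sym_diff E (\<Union>(s, t)\<in>I. einterval s t) \<subseteq> T" by blast
  qed
  moreover have "\<forall>(s, t)\<in>I. s < t" by (auto simp: I_def)
  ultimately show ?thesis unfolding interval_decomposition_def by blast
qed

section \<open>The field of an elementary set\<close>

lemma (in prob_space) indep_set_mono:
  "indep_set A B \<Longrightarrow> A' \<subseteq> A \<Longrightarrow> B' \<subseteq> B \<Longrightarrow> indep_set A' B'"
  unfolding indep_set_def by (rule indep_sets_mono_sets) (auto split: bool.split)

text \<open>The probability of \<open>a1 \<inter> b1 \<inter> a2 \<inter> b2\<close> is first split
  between \<open>F1\<close> and \<open>F2\<close> and then within each of them; regrouping the four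
  factors gives independence on a generating pi-system. It glues independence over two adjacent
  intervals.\<close>

lemma (in prob_space) indep_set_sigma_Un:
  assumes F: "sigma_algebra (space M) F1" "sigma_algebra (space M) F2" "indep_set F1 F2"
    and A: "sigma_algebra (space M) A1" "sigma_algebra (space M) A2" "A1 \<subseteq> F1" "A2 \<subseteq> F1" "indep_set A1 A2"
    and B: "sigma_algebra (space M) B1" "sigma_algebra (space M) B2" "B1 \<subseteq> F2" "B2 \<subseteq> F2" "indep_set B1 B2"
  shows "indep_set (sigma_sets (space M) (A1 \<union> B1)) (sigma_sets (space M) (A2 \<union> B2))"
proof -
  interpret F1: sigma_algebra "space M" F1 by fact
  interpret F2: sigma_algebra "space M" F2 by fact
  interpret A1: sigma_algebra "space M" A1 by fact
  interpret A2: sigma_algebra "space M" A2 by fact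
  interpret B1: sigma_algebra "space M" B1 by fact
  interpret B2: sigma_algebra "space M" B2 by fact
  have ev: "F1 \<subseteq> events" "F2 \<subseteq> events"
    using F(3) unfolding indep_set_def indep_sets_def by (auto split: bool.splits)
  \<comment> \<open>These intersections form a pi-system, and it contains both \<open>A\<close> and
    \<open>B\<close> because the whole space lies in each.\<close>
  let ?G = "\<lambda>A B. (\<lambda>(a, b). a \<inter> b) ` (A \<times> B)"
  have G: "A \<union> B \<subseteq> ?G A B" if "space M \<in> A" "space M \<in> B" "A \<subseteq> Pow (space M)" "B \<subseteq> Pow (space M)" for A B
  proof
    fix x assume "x \<in> A \<union> B"
    then consider "x \<in> A" | "x \<in> B" by auto
    then show "x \<in> ?G A B"
    proof cases
      case 1
      then have "x = x \<inter> space M" using that by auto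
      then show ?thesis using 1 that by (auto simp: image_iff intro!: bexI[of _ "(x, space M)"])
    next
      case 2
      then have "x = space M \<inter> x" using that by auto
      then show ?thesis using 2 that by (auto simp: image_iff intro!: bexI[of _ "(space M, x)"])
    qed
  qed
  have stable: "Int_stable (?G A B)" if "sigma_algebra (space M) A" "sigma_algebra (space M) B" for A B
  proof -
    interpret A: sigma_algebra "space M" A by fact
    interpret B: sigma_algebra "space M" B by fact
    show ?thesis
    proof (rule Int_stableI)
      fix x y assume "x \<in> ?G A B" "y \<in> ?G A B"
      then obtain a b a' b' where *: "x = a \<inter> b" "y = a' \<inter> b'" "a \<in> A" "b \<in> B" "a' \<in> A" "b' \<in> B"
        by auto
      then have "x \<inter> y = (a \<inter> a') \<inter> (b \<inter> b')" by auto
      moreover have "(a \<inter> a', b \<inter> b') \<in> A \<times> B" using * by auto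
      ultimately show "x \<inter> y \<in> ?G A B" by (intro image_eqI[of _ _ "(a \<inter> a', b \<inter> b')"]) simp_all
    qed
  qed
  have "indep_set (?G A1 B1) (?G A2 B2)"
  proof (rule indep_setI)
    have "?G A B \<subseteq> events" if "A \<subseteq> F1" "B \<subseteq> F2" for A B
    proof
      fix x assume "x \<in> ?G A B"
      then obtain a b where "x = a \<inter> b" "a \<in> A" "b \<in> B" by auto
      then have "a \<in> events" "b \<in> events" using that ev by blast+
      then show "x \<in> events" unfolding \<open>x = a \<inter> b\<close> by (rule sets.Int)
    qed
    from this[OF A(3) B(3)] this[OF A(4) B(4)]
    show "?G A1 B1 \<subseteq> events" "?G A2 B2 \<subseteq> events" .
    fix x y assume "x \<in> ?G A1 B1" "y \<in> ?G A2 B2"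
    then obtain a1 b1 a2 b2 where *: "x = a1 \<inter> b1" "y = a2 \<inter> b2" "a1 \<in> A1" "b1 \<in> B1" "a2 \<in> A2" "b2 \<in> B2"
      by auto
    then have ab: "a1 \<in> F1" "a2 \<in> F1" "b1 \<in> F2" "b2 \<in> F2" using A B by auto
    have "prob (x \<inter> y) = prob ((a1 \<inter> a2) \<inter> (b1 \<inter> b2))" by (simp add: * Int_ac)
    also have "\<dots> = prob (a1 \<inter> a2) * prob (b1 \<inter> b2)"
      using ab by (intro indep_setD[OF F(3)]) auto
    also have "\<dots> = (prob a1 * prob b1) * (prob a2 * prob b2)"
      using * by (simp add: indep_setD[OF A(5)] indep_setD[OF B(5)])
    also have "\<dots> = prob x * prob y"
      using * ab by (simp add: indep_setD[OF F(3)])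
    finally show "prob (x \<inter> y) = prob x * prob y" .
  qed
  then have "indep_set (sigma_sets (space M) (?G A1 B1)) (sigma_sets (space M) (?G A2 B2))"
    by (rule indep_set_sigma_sets) (intro stable A B)+
  then show ?thesis
    by (rule indep_set_mono)
      (rule sigma_sets_mono', rule G, rule A1.top A2.top, rule B1.top B2.top,
        rule A1.space_closed A2.space_closed, rule B1.space_closed B2.space_closed)+
qed

lemma (in prob_space) indep_set_trivial:
  assumes A: "A \<subseteq> events" "\<And>a. a \<in> A \<Longrightarrow> prob a = 0 \<or> prob a = 1" and B: "B \<subseteq> events"
  shows "indep_set A B" "indep_set B A"
proof -
  have *: "prob (a \<inter> b) = prob a * prob b" if "a \<in> A" "b \<in> B" for a b
  proof -
    have ab: "a \<in> events" "b \<in> events" using that A B by auto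
    show ?thesis
    proof (cases "prob a = 0")
      case True
      have "prob (a \<inter> b) \<le> prob a" using ab by (intro finite_measure_mono) auto
      then show ?thesis using True measure_nonneg[of M "a \<inter> b"] by simp
    next
      case False
      then have "AE x in M. x \<in> a" using A(2)[OF that(1)] ab by (simp add: prob_eq_1)
      then have "prob (a \<inter> b) = prob b"
        using ab by (intro finite_measure_eq_AE) auto
      then show ?thesis using A(2)[OF that(1)] False by simp
    qed
  qed
  show "indep_set A B" using * A B by (intro indep_setI) auto
  show "indep_set B A"
  proof (rule indep_setI)
    show "prob (b \<inter> a) = prob b * prob a" if "b \<in> B" "a \<in> A" for a b
      using *[OF that(2,1)] by (simp add: Int_commute mult.commute)
  qed (fact B, fact A)
qed

section \<open>The fields of the factorization and their extension to sets\<close>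

sublocale continuous_factorization \<subseteq> prob_space M
  using lebesgue_rokhlin by (simp add: lebesgue_rokhlin_def)

context continuous_factorization
begin

lemma F_sets: "a \<le> b \<Longrightarrow> sets (F a b) \<subseteq> sets M" and F_space: "a \<le> b \<Longrightarrow> space (F a b) = space M"
  and F_null: "a \<le> b \<Longrightarrow> null_sets M \<subseteq> sets (F a b)"
  using sub_sigma_field[of a b] by (auto simp: sub_sigma_field_def subalgebra_def)

lemma F_Pow: "a \<le> b \<Longrightarrow> sets (F a b) \<subseteq> Pow (space M)"
  using sets.space_closed[of "F a b"] by (simp add: F_space)

lemma F_sigma_algebra: "a \<le> b \<Longrightarrow> sigma_algebra (space M) (sets (F a b))"
  using sets.sigma_algebra_axioms[of "F a b"] by (simp add: F_space)

lemma F_split: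
  "a \<le> c \<Longrightarrow> c \<le> b \<Longrightarrow> sets (F a b) = sigma_sets (space M) (sets (F a c) \<union> sets (F c b))"
  using tensor[of a c b] by (simp add: is_tensor_def)

lemma F_indep: "a \<le> c \<Longrightarrow> c \<le> b \<Longrightarrow> indep_set (sets (F a c)) (sets (F c b))"
  using tensor[of a c b] by (simp add: is_tensor_def)

lemma F_mono:
  assumes "a \<le> c" "c \<le> d" "d \<le> b" shows "sets (F c d) \<subseteq> sets (F a b)"
proof -
  have "sets (F c d) \<subseteq> sets (F c b)" using assms by (subst F_split[of c d b]) auto
  also have "\<dots> \<subseteq> sets (F a b)" using assms by (subst F_split[of a c b]) auto
  finally show ?thesis .
qed

text \<open>The tensor property with \<open>r = s = t\<close> makes \<open>F a a\<close> independent
  of itself.\<close>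

lemma F_refl_trivial:
  assumes "A \<in> sets (F a a)" shows "prob A = 0 \<or> prob A = 1"
proof -
  have "prob (A \<inter> A) = prob A * prob A" by (rule indep_setD[OF F_indep[of a a a]]) (use assms in auto)
  then show ?thesis by simp
qed

text \<open>Events of \<open>F a a\<close> are null or have a null complement. Degenerate intervals
  therefore never obstruct the inclusions below.\<close>

lemma F_refl_least:
  assumes "sigma_algebra (space M) G" "null_sets M \<subseteq> G"
  shows "sets (F a a) \<subseteq> G"
proof
  interpret sigma_algebra "space M" G by fact
  fix A assume A: "A \<in> sets (F a a)"
  then have ev: "A \<in> events" using F_sets[of a a] by auto
  from F_refl_trivial[OF A] show "A \<in> G"
  proof
    assume "prob A = 0"
    then have "A \<in> null_sets M" using ev by (simp add: null_sets_def emeasure_eq_measure)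
    then show ?thesis using assms(2) by auto
  next
    assume "prob A = 1"
    then have "prob (space M - A) = 0" using prob_compl[OF ev] by simp
    then have "space M - A \<in> null_sets M" using ev by (simp add: null_sets_def emeasure_eq_measure)
    then have "space M - (space M - A) \<in> G" using assms(2) by auto
    moreover have "space M - (space M - A) = A" using sets.sets_into_space[OF ev] by auto
    ultimately show ?thesis by simp
  qed
qed

lemma F_refl_le: "c \<le> d \<Longrightarrow> sets (F a a) \<subseteq> sets (F c d)"
  by (rule F_refl_least[OF F_sigma_algebra F_null])

text \<open>Each point of \<open>S\<close> inside the interval splits its field in two by
  \<open>F_split\<close>, so induction on \<open>S\<close> applies. Finite exceptional sets are
  disposed of in this way throughout.\<close>

lemma F_le_pieces:
  assumes G: "sigma_algebra (space M) G" and "finite S" "a \<le> b"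
    and "\<And>c d. a \<le> c \<Longrightarrow> c \<le> d \<Longrightarrow> d \<le> b \<Longrightarrow> {c<..<d} \<inter> S = {} \<Longrightarrow> sets (F c d) \<subseteq> G"
  shows "sets (F a b) \<subseteq> G"
  using assms(2-4)
proof (induction S arbitrary: a b rule: finite_induct)
  case empty
  then show ?case by auto
next
  case (insert s S)
  show ?case
  proof (rule insert.IH[OF insert.prems(1)])
    fix c d assume cd: "a \<le> c" "c \<le> d" "d \<le> b" "{c<..<d} \<inter> S = {}"
    show "sets (F c d) \<subseteq> G"
    proof (cases "s \<in> {c<..<d}")
      case True
      then have s: "c \<le> s" "s \<le> d" by auto
      have "{c<..<s} \<subseteq> {c<..<d} - {s}" "{s<..<d} \<subseteq> {c<..<d} - {s}" using s by auto
      then have "{c<..<s} \<inter> insert s S = {}" "{s<..<d} \<inter> insert s S = {}" using cd(4) by blast+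
      then have "sets (F c s) \<subseteq> G" "sets (F s d) \<subseteq> G"
        using insert.prems(2)[OF cd(1) s(1)] insert.prems(2)[OF order_trans[OF cd(1) s(1)] s(2) cd(3)]
          order_trans[OF s(2) cd(3)] by blast+
      then have "sigma_sets (space M) (sets (F c s) \<union> sets (F s d)) \<subseteq> G"
        by (intro sigma_algebra.sigma_sets_subset[OF G]) auto
      then show ?thesis using F_split[OF s] by simp
    next
      case False
      then show ?thesis using cd by (intro insert.prems(2)) auto
    qed
  qed
qed

text \<open>The generators see \<open>E\<close> only up to finite sets and involve no chosen
  decomposition, so monotonicity and invariance are immediate. The case \<open>a = b\<close> is
  included and brings in the null sets.\<close>

definition field_of :: "real set \<Rightarrow> 'a measure" where
  "field_of E = sigma (space M) (\<Union>(a, b)\<in>{(a, b). a \<le> b \<and> finite ({a<..<b} - E)}. sets (F a b))"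

lemma field_of_generator: "(\<Union>(a, b)\<in>{(a, b). a \<le> b \<and> finite ({a<..<b} - E)}. sets (F a b)) \<subseteq> Pow (space M)"
  using F_sets sets.space_closed[of M] by fastforce

lemma sets_field_of: "sets (field_of E) =
    sigma_sets (space M) (\<Union>(a, b)\<in>{(a, b). a \<le> b \<and> finite ({a<..<b} - E)}. sets (F a b))"
  unfolding field_of_def by (rule sets_measure_of[OF field_of_generator])

lemma space_field_of: "space (field_of E) = space M"
  unfolding field_of_def by (rule space_measure_of[OF field_of_generator])

lemma field_of_sigma_algebra: "sigma_algebra (space M) (sets (field_of E))"
  using sets.sigma_algebra_axioms[of "field_of E"] by (simp add: space_field_of)

lemma F_le_field_of: "a \<le> b \<Longrightarrow> finite ({a<..<b} - E) \<Longrightarrow> sets (F a b) \<subseteq> sets (field_of E)"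
  unfolding sets_field_of by (auto intro!: sigma_sets.Basic)

lemma field_of_least:
  assumes "sigma_algebra (space M) G"
    and "\<And>a b. a \<le> b \<Longrightarrow> finite ({a<..<b} - E) \<Longrightarrow> sets (F a b) \<subseteq> G"
  shows "sets (field_of E) \<subseteq> G"
  unfolding sets_field_of by (rule sigma_algebra.sigma_sets_subset[OF assms(1)]) (use assms(2) in auto)

lemma field_of_mono:
  assumes "finite (E - E')" shows "sets (field_of E) \<subseteq> sets (field_of E')"
proof (rule field_of_least[OF field_of_sigma_algebra])
  fix a b :: real assume ab: "a \<le> b" "finite ({a<..<b} - E)"
  then have "finite ({a<..<b} - E')"
    by (intro finite_subset[OF _ finite_UnI[OF ab(2) assms]]) auto
  then show "sets (F a b) \<subseteq> sets (field_of E')" by (rule F_le_field_of[OF ab(1)])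
qed

lemma field_of_subset: "E \<subseteq> E' \<Longrightarrow> sets (field_of E) \<subseteq> sets (field_of E')"
  by (rule field_of_mono) (simp add: Diff_eq_empty_iff[THEN iffD2])

lemma sub_sigma_field_field_of: "sub_sigma_field M (field_of E)"
proof -
  have "sets (field_of E) \<subseteq> sets M"
    by (rule field_of_least[OF sets.sigma_algebra_axioms F_sets])
  moreover have "null_sets M \<subseteq> sets (field_of E)"
    using F_null[of 0 0] F_le_field_of[of 0 0 E] by auto
  ultimately show ?thesis by (simp add: sub_sigma_field_def subalgebra_def space_field_of)
qed

lemma field_of_subset_F:
  assumes "a \<le> b" "finite (E - {a<..<b})"
  shows "sets (field_of E) \<subseteq> sets (F a b)"
proof (rule field_of_least[OF F_sigma_algebra[OF assms(1)]])
  fix c d assume cd: "c \<le> d" "finite ({c<..<d} - E)"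
  show "sets (F c d) \<subseteq> sets (F a b)"
  proof (cases "c = d")
    case False
    have "finite ({c<..<d} - {a<..<b})"
      by (rule finite_subset[OF _ finite_UnI[OF cd(2) assms(2)]]) auto
    moreover have "{c<..<min a d} \<subseteq> {c<..<d} - {a<..<b}" "{max b c<..<d} \<subseteq> {c<..<d} - {a<..<b}"
      by auto
    ultimately have "finite {c<..<min a d}" "finite {max b c<..<d}" by (auto intro: finite_subset)
    \<comment> \<open>A finite open interval of reals is empty, so \<open>{c<..<d}\<close> cannot
      stick out of \<open>{a<..<b}\<close> on either side.\<close>
    then have "min a d \<le> c" "d \<le> max b c" using infinite_Ioo by (meson not_le)+
    then have "a \<le> c" "d \<le> b" using False cd(1) by (auto simp: min_def max_def split: if_splits)
    then show ?thesis using cd(1) by (intro F_mono)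
  qed (simp add: F_refl_le[OF assms(1)])
qed

lemma field_of_empty_trivial:
  assumes "A \<in> sets (field_of {})" shows "prob A = 0 \<or> prob A = 1"
  using field_of_subset_F[of 0 0 "{}"] F_refl_trivial[of A 0] assms by auto

text \<open>Between neighbouring cuts of \<open>E1\<close> an interval either lies in
  \<open>E1\<close> or misses it. In the latter case it lies in \<open>E2\<close> once the finitely
  many points outside \<open>E1 \<union> E2\<close> are also used for cutting.\<close>

lemma field_of_Un:
  assumes T: "cuts T E1"
  shows "sets (field_of (E1 \<union> E2)) = sigma_sets (space M) (sets (field_of E1) \<union> sets (field_of E2))"
    (is "_ = ?G")
proof
  have G: "sigma_algebra (space M) ?G"
    by (rule sigma_algebra_sigma_sets)
      (use sets.space_closed[of "field_of E1"] sets.space_closed[of "field_of E2"] in \<open>simp add: space_field_of\<close>)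
  have inG: "sets (field_of E1) \<subseteq> ?G" "sets (field_of E2) \<subseteq> ?G" by auto
  show "sets (field_of (E1 \<union> E2)) \<subseteq> ?G"
  proof (rule field_of_least[OF G])
    fix a b assume ab: "a \<le> b" "finite ({a<..<b} - (E1 \<union> E2))"
    show "sets (F a b) \<subseteq> ?G"
    proof (rule F_le_pieces[OF G _ ab(1), where S = "T \<union> ({a<..<b} - (E1 \<union> E2))"])
      show "finite (T \<union> ({a<..<b} - (E1 \<union> E2)))" using T ab(2) by (simp add: cuts_def)
      fix c d
      assume cd: "a \<le> c" "c \<le> d" "d \<le> b" "{c<..<d} \<inter> (T \<union> ({a<..<b} - (E1 \<union> E2))) = {}"
      then have E: "{c<..<d} \<subseteq> E1 \<union> E2" by force
      have "{c<..<d} \<subseteq> E1 \<or> {c<..<d} \<subseteq> E2"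
      proof (cases "{c<..<d} \<inter> E1 = {}")
        case False
        then obtain x where "x \<in> {c<..<d}" "x \<in> E1" by blast
        then have "{c<..<d} \<subseteq> E1" using cuts_constant[OF T, of c d x] cd(4) by blast
        then show ?thesis by simp
      qed (use E in blast)
      then have "finite ({c<..<d} - E1) \<or> finite ({c<..<d} - E2)"
        by (metis Diff_eq_empty_iff finite.emptyI)
      then show "sets (F c d) \<subseteq> ?G"
        using F_le_field_of[OF cd(2), of E1] F_le_field_of[OF cd(2), of E2] inG by blast
    qed
  qed
  show "?G \<subseteq> sets (field_of (E1 \<union> E2))"
    by (intro sigma_algebra.sigma_sets_subset[OF field_of_sigma_algebra] Un_least field_of_subset) auto
qed

text \<open>Induction on the number of cuts inside the interval. Without cuts one of the two sets
  misses it and has a trivial field; otherwise a cut \<open>t\<close> splits both fields, and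
  \<open>F a t\<close>, \<open>F t b\<close> are independent by the tensor property.\<close>

lemma field_of_indep_interval:
  assumes "cuts T E1" "cuts T E2" "E1 \<inter> E2 = {}" "a \<le> b"
  shows "indep_set (sets (field_of (E1 \<inter> {a<..<b}))) (sets (field_of (E2 \<inter> {a<..<b})))"
  using assms(4)
proof (induction "card (T \<inter> {a<..<b})" arbitrary: a b rule: less_induct)
  case less
  have sub: "sets (field_of E) \<subseteq> events" for E
    using sub_sigma_field_field_of[of E] by (simp add: sub_sigma_field_def subalgebra_def)
  show ?case
  proof (cases "T \<inter> {a<..<b} = {}")
    case True
    have "E1 \<inter> {a<..<b} = {} \<or> E2 \<inter> {a<..<b} = {}"
    proof (rule ccontr)
      assume "\<not> (E1 \<inter> {a<..<b} = {} \<or> E2 \<inter> {a<..<b} = {})"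
      then obtain x y where "x \<in> E1" "x \<in> {a<..<b}" "y \<in> E2" "y \<in> {a<..<b}" by blast
      then have "y \<in> E1 \<inter> E2" using cuts_constant[OF assms(1), of a b x y] True by blast
      then show False using assms(3) by auto
    qed
    then show ?thesis
      using indep_set_trivial[OF sub field_of_empty_trivial sub] by auto
  next
    case False
    then obtain t where t: "t \<in> T" "a < t" "t < b" by auto
    have fin: "finite (T \<inter> {a<..<b})" using assms(1) by (simp add: cuts_def)
    have less1: "card (T \<inter> {a<..<t}) < card (T \<inter> {a<..<b})" "card (T \<inter> {t<..<b}) < card (T \<inter> {a<..<b})"
      using t by (auto intro!: psubset_card_mono[OF fin])
    have split: "sets (field_of (E \<inter> {a<..<b})) =
        sigma_sets (space M) (sets (field_of (E \<inter> {a<..<t})) \<union> sets (field_of (E \<inter> {t<..<b})))"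
      if "cuts T E" for E
    proof -
      have "\<exists>T. cuts T {a<..<t}" by (intro elementary_cuts elementary_interval) (simp add: is_interval_1)
      then obtain T' where "cuts T' {a<..<t}" by auto
      from cuts_Int[OF that this]
      have "sets (field_of ((E \<inter> {a<..<t}) \<union> (E \<inter> {t<..<b}))) =
        sigma_sets (space M) (sets (field_of (E \<inter> {a<..<t})) \<union> sets (field_of (E \<inter> {t<..<b})))"
        by (rule field_of_Un)
      moreover have "sets (field_of ((E \<inter> {a<..<t}) \<union> (E \<inter> {t<..<b}))) = sets (field_of (E \<inter> {a<..<b}))"
      proof
        have "finite (E \<inter> {a<..<b} - (E \<inter> {a<..<t} \<union> E \<inter> {t<..<b}))"
          by (rule finite_subset[of _ "{t}"]) auto
        then show "sets (field_of (E \<inter> {a<..<b})) \<subseteq> sets (field_of (E \<inter> {a<..<t} \<union> E \<inter> {t<..<b}))"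
          by (rule field_of_mono)
        show "sets (field_of (E \<inter> {a<..<t} \<union> E \<inter> {t<..<b})) \<subseteq> sets (field_of (E \<inter> {a<..<b}))"
          by (rule field_of_subset) (use t in auto)
      qed
      ultimately show ?thesis by simp
    qed
    have subF: "sets (field_of (E \<inter> {c<..<d})) \<subseteq> sets (F c d)" if "c \<le> d" for E c d
      by (rule field_of_subset_F[OF that]) (auto intro: finite_subset[of _ "{}"])
    have at: "a \<le> t" "t \<le> b" using t by auto
    show ?thesis
      unfolding split[OF assms(1)] split[OF assms(2)]
      by (rule indep_set_sigma_Un[OF F_sigma_algebra[OF at(1)] F_sigma_algebra[OF at(2)] F_indep[OF at]
            field_of_sigma_algebra field_of_sigma_algebra subF[OF at(1)] subF[OF at(1)] less.hyps[OF less1(1) at(1)]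
            field_of_sigma_algebra field_of_sigma_algebra subF[OF at(2)] subF[OF at(2)] less.hyps[OF less1(2) at(2)]])
  qed
qed

text \<open>Every generator \<open>F a b\<close> lives in a bounded window \<open>{-n<..<n}\<close>,
  and the increasing union of the window fields is a pi-system; so the bounded case
  suffices.\<close>

lemma field_of_indep:
  assumes "elementary E1" "elementary E2" "E1 \<inter> E2 = {}"
  shows "indep_set (sets (field_of E1)) (sets (field_of E2))"
proof -
  obtain T1 T2 where T12: "cuts T1 E1" "cuts T2 E2"
    using elementary_cuts[OF assms(1)] elementary_cuts[OF assms(2)] by auto
  then have T: "cuts (T1 \<union> T2) E1" "cuts (T1 \<union> T2) E2"
    using cuts_mono[OF T12(1), of "T1 \<union> T2"] cuts_mono[OF T12(2), of "T1 \<union> T2"]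
    by (simp_all add: cuts_def[of T1] cuts_def[of T2])
  let ?B = "\<lambda>n::nat. {- real n<..<real n}"
  let ?G = "\<lambda>E. \<Union>n. sets (field_of (E \<inter> ?B n))"
  have gen: "sets (field_of E) \<subseteq> sigma_sets (space M) (?G E)" for E
  proof (rule field_of_least[OF sigma_algebra_sigma_sets])
    show "?G E \<subseteq> Pow (space M)"
      using sets.space_closed[of "field_of _"] by (auto simp: space_field_of)
    fix a b assume ab: "a \<le> b" "finite ({a<..<b} - E)"
    obtain n where n: "max \<bar>a\<bar> \<bar>b\<bar> < real n" using reals_Archimedean2 by blast
    have "sets (F a b) \<subseteq> sets (field_of (E \<inter> ?B n))"
      by (intro F_le_field_of ab finite_subset[OF _ ab(2)]) (use n in auto)
    then show "sets (F a b) \<subseteq> sigma_sets (space M) (?G E)" by (auto intro!: sigma_sets.Basic)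
  qed
  have mono: "sets (field_of (E \<inter> ?B m)) \<subseteq> sets (field_of (E \<inter> ?B n))" if "m \<le> n" for E m n
    by (rule field_of_subset) (use that in auto)
  have stable: "Int_stable (?G E)" for E
  proof (rule Int_stableI)
    fix a b assume "a \<in> ?G E" "b \<in> ?G E"
    then obtain m n where "a \<in> sets (field_of (E \<inter> ?B m))" "b \<in> sets (field_of (E \<inter> ?B n))" by auto
    then have "a \<inter> b \<in> sets (field_of (E \<inter> ?B (max m n)))"
      using mono[of m "max m n" E] mono[of n "max m n" E] by auto
    then show "a \<inter> b \<in> ?G E" by auto
  qed
  have "indep_set (?G E1) (?G E2)"
  proof (rule indep_setI)
    have "sets (field_of E) \<subseteq> events" for E
      using sub_sigma_field_field_of[of E] by (simp add: sub_sigma_field_def subalgebra_def)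
    then show "?G E1 \<subseteq> events" "?G E2 \<subseteq> events" by blast+
    fix a b assume "a \<in> ?G E1" "b \<in> ?G E2"
    then obtain m n where "a \<in> sets (field_of (E1 \<inter> ?B m))" "b \<in> sets (field_of (E2 \<inter> ?B n))" by auto
    then have "a \<in> sets (field_of (E1 \<inter> ?B (max m n)))" "b \<in> sets (field_of (E2 \<inter> ?B (max m n)))"
      using mono[of m "max m n" E1] mono[of n "max m n" E2] by auto
    then show "prob (a \<inter> b) = prob a * prob b"
      by (rule indep_setD[OF field_of_indep_interval[OF T assms(3)], rotated]) simp
  qed
  then have "indep_set (sigma_sets (space M) (?G E1)) (sigma_sets (space M) (?G E2))"
    by (rule indep_set_sigma_sets[OF _ stable stable])
  then show ?thesis by (rule indep_set_mono[OF _ gen gen])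
qed

lemma interval_field_field_of:
  assumes "s < t" "finite (einterval s t - E)"
  shows "sets (interval_field M F s t) \<subseteq> sets (field_of E)"
proof -
  have fin: "finite ({a<..<b} - E)" if "s \<le> ereal a" "ereal b \<le> t" for a b
    by (rule finite_subset[OF _ assms(2)])
      (use that in \<open>auto simp: einterval_def intro: le_less_trans[of _ "ereal a"] less_le_trans[of _ "ereal b"]\<close>)
  have sig: "sets (sigma (space M) G) \<subseteq> sets (field_of E)" if "G \<subseteq> sets (field_of E)" for G
  proof -
    have "G \<subseteq> Pow (space M)" using that sets.space_closed[of "field_of E"] by (auto simp: space_field_of)
    then show ?thesis
      using that by (simp add: sets_measure_of sigma_algebra.sigma_sets_subset[OF field_of_sigma_algebra])
  qed
  consider "s = -\<infinity>" "t = \<infinity>" | r where "s = -\<infinity>" "t = ereal r" | r where "s = ereal r" "t = \<infinity>"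
    | a b where "s = ereal a" "t = ereal b"
    using assms(1) by (cases s; cases t) auto
  then show ?thesis
  proof cases
    case 1
    have "sets (F (- real n) (real n)) \<subseteq> sets (field_of E)" for n
      by (rule F_le_field_of[OF _ fin]) (simp_all add: 1)
    then have "sets M \<subseteq> sets (field_of E)"
      unfolding generates
      by (intro sigma_algebra.sigma_sets_subset[OF field_of_sigma_algebra] UN_least)
    then show ?thesis using 1 by (simp add: interval_field_def)
  next
    case (2 r)
    have "sets (F q r) \<subseteq> sets (field_of E)" if "q \<le> r" for q
      by (rule F_le_field_of[OF that fin]) (simp_all add: 2)
    then show ?thesis using 2 by (simp add: interval_field_def) (intro sig UN_least, simp)
  next
    case (3 r)
    have "sets (F r q) \<subseteq> sets (field_of E)" if "r \<le> q" for q
      by (rule F_le_field_of[OF that fin]) (simp_all add: 3)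
    then show ?thesis using 3 by (simp add: interval_field_def) (intro sig UN_least, simp)
  next
    case (4 a b)
    then have "sets (F a b) \<subseteq> sets (field_of E)"
      using assms(1) by (intro F_le_field_of fin) auto
    then show ?thesis using 4 by (simp add: interval_field_def)
  qed
qed

lemma F_le_interval_field:
  assumes "s \<le> ereal a" "ereal b \<le> t" "a \<le> b"
  shows "sets (F a b) \<subseteq> sets (interval_field M F s t)"
proof -
  consider "s = -\<infinity>" "t = \<infinity>" | r where "s = -\<infinity>" "t = ereal r" | r where "s = ereal r" "t = \<infinity>"
    | c d where "s = ereal c" "t = ereal d"
    using assms by (cases s; cases t) auto
  then show ?thesis
  proof cases
    case 1
    then show ?thesis using F_sets[OF assms(3)] by (simp add: interval_field_def)
  next
    case (2 r)
    have "(\<Union>q\<in>{..r}. sets (F q r)) \<subseteq> Pow (space M)" by (intro UN_least F_Pow) simp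
    moreover have "sets (F a b) \<subseteq> sets (F a r)" "a \<le> r"
      using assms 2 F_mono[of a a b r] by simp_all
    then have "sets (F a b) \<subseteq> (\<Union>q\<in>{..r}. sets (F q r))" by auto
    ultimately show ?thesis
      using 2 sigma_sets_superset_generator[of "\<Union>q\<in>{..r}. sets (F q r)" "space M"]
      by (simp add: interval_field_def)
  next
    case (3 r)
    have "(\<Union>q\<in>{r..}. sets (F r q)) \<subseteq> Pow (space M)" by (intro UN_least F_Pow) simp
    moreover have "sets (F a b) \<subseteq> sets (F r b)" "r \<le> b"
      using assms 3 F_mono[of r a b b] by simp_all
    then have "sets (F a b) \<subseteq> (\<Union>q\<in>{r..}. sets (F r q))" by auto
    ultimately show ?thesis
      using 3 sigma_sets_superset_generator[of "\<Union>q\<in>{r..}. sets (F r q)" "space M"]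
      by (simp add: interval_field_def)
  next
    case (4 c d)
    then show ?thesis using assms F_mono[of c a b d] by (simp add: interval_field_def)
  qed
qed

text \<open>\<open>elementary_field\<close> depends on a decomposition picked by SOME. Cutting any
  admissible interval at the end points of that decomposition shows that the result is the
  choice-free \<open>field_of\<close>.\<close>

lemma elementary_field_eq:
  assumes "elementary E" shows "elementary_field M F E = field_of E"
proof -
  define I where "I = (SOME I. interval_decomposition E I)"
  have "interval_decomposition E I"
    unfolding I_def by (rule someI_ex[OF interval_decomposition_exists[OF assms]])
  then have I: "finite I" "\<And>s t. (s, t) \<in> I \<Longrightarrow> s < t"
    and fin: "finite (sym_diff E (\<Union>(s, t)\<in>I. einterval s t))"
    by (auto simp: interval_decomposition_def)
  let ?G = "null_sets M \<union> (\<Union>(s, t)\<in>I. sets (interval_field M F s t))"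
  have sub: "?G \<subseteq> sets (field_of E)"
  proof -
    have "sets (interval_field M F s t) \<subseteq> sets (field_of E)" if "(s, t) \<in> I" for s t
      by (rule interval_field_field_of[OF I(2)[OF that] finite_subset[OF _ fin]]) (use that in auto)
    then show ?thesis using sub_sigma_field_field_of[of E] by (auto simp: sub_sigma_field_def)
  qed
  then have Pow: "?G \<subseteq> Pow (space M)"
    using sets.space_closed[of "field_of E"] by (auto simp: space_field_of)
  note sigma = sigma_algebra_sigma_sets[OF Pow]
  have F_refl: "sets (F c c) \<subseteq> sigma_sets (space M) ?G" for c
    by (rule F_refl_least[OF sigma]) (auto intro: sigma_sets.Basic)
  have "sets (field_of E) \<subseteq> sigma_sets (space M) ?G"
  proof (rule field_of_least[OF sigma])
    fix a b assume ab: "a \<le> b" "finite ({a<..<b} - E)"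
    \<comment> \<open>The points missed by the decomposition and all its end points. An infinite end
      point becomes 0 under \<open>real_of_ereal\<close>, which is just one more cut.\<close>
    define S where "S = ({a<..<b} - (\<Union>(s, t)\<in>I. einterval s t)) \<union> real_of_ereal ` (fst ` I \<union> snd ` I)"
    have "finite ({a<..<b} - (\<Union>(s, t)\<in>I. einterval s t))"
      by (rule finite_subset[OF _ finite_UnI[OF ab(2) fin]]) auto
    then have "finite S" using I(1) by (simp add: S_def)
    then show "sets (F a b) \<subseteq> sigma_sets (space M) ?G"
    proof (rule F_le_pieces[OF sigma _ ab(1)])
      fix c d assume cd: "a \<le> c" "c \<le> d" "d \<le> b" "{c<..<d} \<inter> S = {}"
      show "sets (F c d) \<subseteq> sigma_sets (space M) ?G"
      proof (cases "c = d")
        case False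
        \<comment> \<open>The midpoint detects the interval of the decomposition that contains the
          whole piece \<open>{c<..<d}\<close>.\<close>
        define m where "m = (c + d) / 2"
        have m: "c < m" "m < d" using False cd(2) by (auto simp: m_def)
        then have "m \<in> {c<..<d}" "m \<in> {a<..<b}" using cd by auto
        then have "m \<in> (\<Union>(s, t)\<in>I. einterval s t)" using cd(4) unfolding S_def by blast
        then obtain s t where st: "(s, t) \<in> I" "s < ereal m" "ereal m < t" by (auto simp: einterval_def)
        have "s \<in> fst ` I" "t \<in> snd ` I"
          using imageI[OF st(1), of fst] imageI[OF st(1), of snd] by simp_all
        then have S: "real_of_ereal s \<in> S" "real_of_ereal t \<in> S"
          unfolding S_def by (simp_all add: imageI)
        have "s \<le> ereal c"
        proof (rule ccontr)
          assume *: "\<not> s \<le> ereal c"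
          then have "s = ereal (real_of_ereal s)" using st(2) by (cases s) auto
          moreover have "real_of_ereal s \<in> {c<..<d}" using * st(2) m by (cases s) auto
          ultimately show False using cd(4) S(1) by blast
        qed
        moreover have "ereal d \<le> t"
        proof (rule ccontr)
          assume *: "\<not> ereal d \<le> t"
          have "real_of_ereal t \<in> {c<..<d}" using * st(3) m by (cases t) auto
          then show False using cd(4) S(2) by blast
        qed
        ultimately have "sets (F c d) \<subseteq> sets (interval_field M F s t)"
          using cd(2) by (intro F_le_interval_field)
        then show ?thesis using st(1) by (auto intro!: sigma_sets.Basic)
      qed (simp add: F_refl)
    qed
  qed
  moreover have "sigma_sets (space M) ?G \<subseteq> sets (field_of E)"
    by (rule sigma_algebra.sigma_sets_subset[OF field_of_sigma_algebra sub])
  ultimately have "sets (sigma (space M) ?G) = sets (field_of E)"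
    using Pow by simp
  \<comment> \<open>Both are built by \<open>sigma\<close> and carry the zero measure, so equal sets
    make them equal as measures.\<close>
  then have "sigma (space M) ?G = field_of E"
    unfolding field_of_def by (intro measure_eqI) (simp_all add: emeasure_sigma)
  then show ?thesis unfolding elementary_field_def I_def by simp
qed

text \<open>The axiom \<open>inner_generates\<close> writes the field of an interval inside
  \<open>U\<close> through slightly shorter ones. Their closures are compact subsets of
  \<open>U\<close>, hence swallowed by some \<open>K n\<close>. This is the upward continuity behind
  the limit in the construction of the measure.\<close>

lemma field_of_UN:
  assumes U: "open U" and K: "\<And>C. compact C \<Longrightarrow> C \<subseteq> U \<Longrightarrow> \<exists>n::nat. C \<subseteq> K n" "\<And>n. K n \<subseteq> U"
  shows "sets (field_of U) = sigma_sets (space M) (\<Union>n. sets (field_of (K n)))" (is "_ = ?G")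
proof
  have G: "sigma_algebra (space M) ?G"
    using sets.space_closed[of "field_of _"] by (intro sigma_algebra_sigma_sets) (auto simp: space_field_of)
  have sub: "sets (F a b) \<subseteq> ?G" if "a \<le> b" "{a..b} \<subseteq> U" for a b
  proof -
    obtain n where "{a..b} \<subseteq> K n" using K(1)[of "{a..b}"] \<open>{a..b} \<subseteq> U\<close> by auto
    then have "{a<..<b} - K n = {}" by auto
    then have "finite ({a<..<b} - K n)" by (metis finite.emptyI)
    then have "sets (F a b) \<subseteq> sets (field_of (K n))" using that by (intro F_le_field_of)
    then show ?thesis by (auto intro!: sigma_sets.Basic)
  qed
  show "sets (field_of U) \<subseteq> ?G"
  proof (rule field_of_least[OF G])
    fix a b assume ab: "a \<le> b" "finite ({a<..<b} - U)"
    show "sets (F a b) \<subseteq> ?G"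
    proof (rule F_le_pieces[OF G ab(2) ab(1)])
      fix c d assume cd: "a \<le> c" "c \<le> d" "d \<le> b" "{c<..<d} \<inter> ({a<..<b} - U) = {}"
      then have U': "{c<..<d} \<subseteq> U" by force
      show "sets (F c d) \<subseteq> ?G"
      proof (cases "c = d")
        case True
        have "sets (F c c) \<subseteq> sets (field_of (K 0))" by (rule F_le_field_of) auto
        then show ?thesis using True by (auto intro!: sigma_sets.Basic)
      next
        case False
        then have "c < d" using cd by simp
        have "sets (F (c + e) (d - e)) \<subseteq> ?G" if "0 < e" "c + e \<le> d - e" for e
          by (rule sub) (use that U' in auto)
        then show ?thesis
          unfolding inner_generates[OF \<open>c < d\<close>] by (intro sigma_algebra.sigma_sets_subset[OF G]) auto
      qed
    qed
  qed
  have "sets (field_of (K n)) \<subseteq> sets (field_of U)" for n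
    by (rule field_of_mono) (metis K(2) Diff_eq_empty_iff finite.emptyI)
  then show "?G \<subseteq> sets (field_of U)"
    by (intro sigma_algebra.sigma_sets_subset[OF field_of_sigma_algebra]) auto
qed

end

section \<open>Conditional expectations\<close>

context prob_space
begin

text \<open>Pi-lambda argument for two signed densities; \<open>total\<close> covers the whole
  space, which \<open>G\<close> may miss, in the complement step.\<close>

lemma set_integral_eq_sigma_sets:
  fixes f g :: "'a \<Rightarrow> real"
  assumes G: "Int_stable G" "G \<subseteq> events" and f: "integrable M f" and g: "integrable M g"
    and total: "integral\<^sup>L M f = integral\<^sup>L M g"
    and eq: "\<And>X. X \<in> G \<Longrightarrow> (\<integral>x\<in>X. f x \<partial>M) = (\<integral>x\<in>X. g x \<partial>M)"
    and X: "X \<in> sigma_sets (space M) G"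
  shows "(\<integral>x\<in>X. f x \<partial>M) = (\<integral>x\<in>X. g x \<partial>M)"
proof -
  have sub: "A \<in> events" if "A \<in> sigma_sets (space M) G" for A
    using sets.sigma_sets_subset[OF G(2)] that by auto
  have int: "set_integrable M A h" if "integrable M h" "A \<in> events" for A and h :: "'a \<Rightarrow> real"
    using that(2,1) unfolding set_integrable_def by (rule integrable_mult_indicator)
  show ?thesis
    using G(1) order_trans[OF G(2) sets.space_closed] X
  proof (induction rule: sigma_sets_induct_disjoint)
    case (compl A)
    have "(\<integral>x\<in>space M - A. h x \<partial>M) = integral\<^sup>L M h - (\<integral>x\<in>A. h x \<partial>M)"
      if h: "integrable M h" for h :: "'a \<Rightarrow> real"
    proof -
      have "(\<integral>x\<in>(space M - A) \<union> A. h x \<partial>M) = (\<integral>x\<in>space M - A. h x \<partial>M) + (\<integral>x\<in>A. h x \<partial>M)"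
        using sub[OF compl(1)] by (intro set_integral_Un int h) auto
      moreover have "(space M - A) \<union> A = space M" using sets.sets_into_space[OF sub[OF compl(1)]] by auto
      ultimately show ?thesis using set_integral_space[OF h] by simp
    qed
    then show ?case using compl(2) total f g by simp
  next
    case (union A)
    have "(\<integral>x\<in>(\<Union>i. A i). h x \<partial>M) = (\<Sum>i. \<integral>x\<in>A i. h x \<partial>M)"
      if h: "integrable M h" for h :: "'a \<Rightarrow> real"
    proof (rule lebesgue_integral_countable_add)
      have A: "A i \<in> events" for i using sub union(2) by auto
      then show "A i \<in> events" for i .
      show "A i \<inter> A j = {}" if "i \<noteq> j" for i j using union(1) that by (auto simp: disjoint_family_on_def)
      show "set_integrable M (\<Union>i. A i) h" using A by (intro int h) auto
    qed
    then show ?case using union(3) f g by simp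
  qed (use eq in \<open>simp_all add: set_lebesgue_integral_def\<close>)
qed

lemma indep_set_integral_mult:
  fixes X Y :: "'a \<Rightarrow> real"
  assumes "sub_sigma_field M A" "sub_sigma_field M C" "indep_set (sets A) (sets C)"
    and X: "X \<in> borel_measurable A" "integrable M X" and Y: "Y \<in> borel_measurable C" "integrable M Y"
  shows "(\<integral>x. X x * Y x \<partial>M) = (\<integral>x. X x \<partial>M) * (\<integral>x. Y x \<partial>M)"
proof -
  have sub: "subalgebra M A" "subalgebra M C" using assms by (auto simp: sub_sigma_field_def)
  have *: "sigma_sets (space M) {Z -` S \<inter> space M |S. S \<in> sets borel} \<subseteq> sets B"
    if "subalgebra M B" "Z \<in> borel_measurable B" for Z :: "'a \<Rightarrow> real" and B
  proof -
    have "{Z -` S \<inter> space M |S. S \<in> sets borel} \<subseteq> sets B"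
      using measurable_sets[OF that(2)] that(1) by (auto simp: subalgebra_def)
    then have "sigma_sets (space B) {Z -` S \<inter> space M |S. S \<in> sets borel} \<subseteq> sets B"
      by (rule sets.sigma_sets_subset)
    then show ?thesis using that(1) by (simp add: subalgebra_def)
  qed
  have "indep_var borel X borel Y"
    unfolding indep_var_eq
    using indep_set_mono[OF assms(3) *[OF sub(1) X(1)] *[OF sub(2) Y(1)]] X Y by auto
  then show ?thesis by (rule indep_var_lebesgue_integral[OF _ X(2) Y(2)])
qed

text \<open>On a set \<open>b \<inter> c\<close> the integral of an \<open>A\<close>-measurable
  function factors into its integral over \<open>b\<close> times the probability of
  \<open>c\<close>. So \<open>f\<close> and its conditional expectation on \<open>B\<close> have
  equal integrals on a pi-system generating \<open>G\<close>.\<close>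

lemma real_cond_exp_indep_join:
  assumes A: "sub_sigma_field M A" and B: "sub_sigma_field M B" and C: "sub_sigma_field M C"
    and G: "sub_sigma_field M G"
    and BA: "sets B \<subseteq> sets A" and indep: "indep_set (sets A) (sets C)"
    and gen: "sets G = sigma_sets (space M) (sets B \<union> sets C)"
    and f: "f \<in> L2 M A"
  shows "AE x in M. real_cond_exp M G f x = real_cond_exp M B f x"
proof -
  have sub: "subalgebra M A" "subalgebra M B" "subalgebra M C" "subalgebra M G"
    using A B C G by (auto simp: sub_sigma_field_def)
  have space: "space A = space M" "space B = space M" "space C = space M" "space G = space M"
    and ev: "sets A \<subseteq> events" "sets B \<subseteq> events" "sets C \<subseteq> events"
    using sub by (auto simp: subalgebra_def)
  interpret G: finite_measure_subalgebra M G by standard (rule sub)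
  interpret B: finite_measure_subalgebra M B by standard (rule sub)
  have fM: "f \<in> L2 M M" using f L2_subset[OF sub(1)] by auto
  define g where "g = real_cond_exp M B f"
  have gB: "g \<in> L2 M B" unfolding g_def by (rule real_cond_exp_L2[OF B fM])
  have gM: "g \<in> L2 M M" using gB L2_subset[OF sub(2)] by auto
  have BA': "subalgebra A B" using BA by (simp add: subalgebra_def space)
  have gA: "g \<in> borel_measurable A"
    using gB measurable_from_subalg[OF BA'] by (auto simp: L2_def)
  have fA: "f \<in> borel_measurable A" using f by (simp add: L2_def)
  have "subalgebra G B" unfolding subalgebra_def space gen by auto
  then have gG: "g \<in> borel_measurable G"
    using gB measurable_from_subalg by (auto simp: L2_def)
  let ?G = "(\<lambda>(b, c). b \<inter> c) ` (sets B \<times> sets C)"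
  have stable: "Int_stable ?G"
  proof (rule Int_stableI)
    fix x y assume "x \<in> ?G" "y \<in> ?G"
    then obtain b c b' c' where *: "x = b \<inter> c" "y = b' \<inter> c'" "b \<in> sets B" "c \<in> sets C" "b' \<in> sets B" "c' \<in> sets C"
      by auto
    then have "x \<inter> y = (b \<inter> b') \<inter> (c \<inter> c')" by auto
    moreover have "(b \<inter> b', c \<inter> c') \<in> sets B \<times> sets C" using * by auto
    ultimately show "x \<inter> y \<in> ?G" by (intro image_eqI[of _ _ "(b \<inter> b', c \<inter> c')"]) simp_all
  qed
  have Gev: "?G \<subseteq> events"
  proof
    fix x assume "x \<in> ?G"
    then obtain b c where "x = b \<inter> c" "b \<in> sets B" "c \<in> sets C" by auto
    then show "x \<in> events" using ev by auto
  qed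
  have sup: "sets B \<union> sets C \<subseteq> ?G"
  proof
    fix x assume "x \<in> sets B \<union> sets C"
    then show "x \<in> ?G"
    proof
      assume x: "x \<in> sets B"
      then have "x = x \<inter> space M" using sets.sets_into_space[OF x] by (auto simp: space)
      then show ?thesis using x sets.top[of C] by (intro image_eqI[of _ _ "(x, space M)"]) (auto simp: space)
    next
      assume x: "x \<in> sets C"
      then have "x = space M \<inter> x" using sets.sets_into_space[OF x] by (auto simp: space)
      then show ?thesis using x sets.top[of B] by (intro image_eqI[of _ _ "(space M, x)"]) (auto simp: space)
    qed
  qed
  have total: "integral\<^sup>L M f = integral\<^sup>L M g"
    unfolding g_def using B.real_cond_exp_int(2)[OF L2_integrable[OF fM]] by simp
  have basic: "(\<integral>x\<in>b \<inter> c. f x \<partial>M) = (\<integral>x\<in>b \<inter> c. g x \<partial>M)" if b: "b \<in> sets B" and c: "c \<in> sets C" for b c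
  proof -
    \<comment> \<open>\<open>h\<close> will be both \<open>f\<close> and \<open>g\<close>; the
      latter is \<open>A\<close>-measurable because \<open>B\<close> is contained in
      \<open>A\<close>.\<close>
    have *: "(\<integral>x\<in>b \<inter> c. h x \<partial>M) = (\<integral>x\<in>b. h x \<partial>M) * prob c"
      if h: "h \<in> borel_measurable A" "integrable M h" for h
    proof -
      have bA: "b \<in> sets A" using b BA by auto
      have cev: "c \<in> events" and bev: "b \<in> events" using b c ev by auto
      have "(\<integral>x\<in>b \<inter> c. h x \<partial>M) = (\<integral>x. (indicator b x * h x) * indicator c x \<partial>M)"
        unfolding set_lebesgue_integral_def by (intro Bochner_Integration.integral_cong) (auto simp: indicator_def)
      also have "\<dots> = (\<integral>x. indicator b x * h x \<partial>M) * (\<integral>x. indicator c x \<partial>M)"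
      proof (rule indep_set_integral_mult[OF A C indep])
        show "(\<lambda>x. indicator b x * h x) \<in> borel_measurable A" using bA h by measurable
        show "integrable M (\<lambda>x. indicator b x * h x)"
          using integrable_mult_indicator[OF bev h(2)] by simp
        show "indicat_real c \<in> borel_measurable C" using c by measurable
        show "integrable M (indicat_real c)" using cev by (simp add: less_top[symmetric])
      qed
      also have "\<dots> = (\<integral>x\<in>b. h x \<partial>M) * prob c"
        using cev by (simp add: set_lebesgue_integral_def Int_absorb2 sets.sets_into_space)
      finally show ?thesis .
    qed
    have "(\<integral>x\<in>b. f x \<partial>M) = (\<integral>x\<in>b. g x \<partial>M)"
      unfolding g_def by (rule B.real_cond_exp_intA[OF L2_integrable[OF fM] b])
    then show ?thesis using *[OF fA L2_integrable[OF fM]] *[OF gA L2_integrable[OF gM]] by simp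
  qed
  show ?thesis
    unfolding g_def[symmetric]
  proof (rule G.real_cond_exp_charact[OF _ L2_integrable[OF fM] L2_integrable[OF gM] gG])
    fix X assume "X \<in> sets G"
    then have "X \<in> sigma_sets (space M) ?G"
      unfolding gen using sigma_sets_mono'[OF sup] by auto
    then show "(\<integral>x\<in>X. f x \<partial>M) = (\<integral>x\<in>X. g x \<partial>M)"
      by (rule set_integral_eq_sigma_sets[OF stable Gev L2_integrable[OF fM] L2_integrable[OF gM] total, rotated])
        (use basic in auto)
  qed
qed

lemma
  assumes A: "sub_sigma_field M A" and f: "f \<in> L2 M M"
  shows real_cond_exp_L2M: "real_cond_exp M A f \<in> L2 M M"
    and real_cond_exp_Pythagoras: "(L2_norm M f)\<^sup>2 =
      (L2_norm M (real_cond_exp M A f))\<^sup>2 + (L2_norm M (\<lambda>x. f x - real_cond_exp M A f x))\<^sup>2"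
    and L2_inner_real_cond_exp: "h \<in> L2 M A \<Longrightarrow> L2_inner M (real_cond_exp M A f) h = L2_inner M f h"
proof -
  have sub: "subalgebra M A" using A by (simp add: sub_sigma_field_def)
  note S = closed_subspace_L2[OF A]
  let ?p = "L2_proj M (L2 M A) f" and ?c = "real_cond_exp M A f"
  note AE = real_cond_exp_AE_proj[OF A f]
  show c: "?c \<in> L2 M M" using real_cond_exp_L2[OF A f] L2_subset[OF sub] by auto
  have p: "?p \<in> L2 M M" by (rule L2_proj_L2[OF S f])
  have m: "f \<in> borel_measurable M" "?c \<in> borel_measurable M" "?p \<in> borel_measurable M"
    using c p f by (auto simp: L2_def)
  have "L2_norm M (\<lambda>x. f x - ?c x) = L2_norm M (\<lambda>x. f x - ?p x)"
    by (rule L2_norm_cong_AE) (use AE m in auto)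
  then show "(L2_norm M f)\<^sup>2 = (L2_norm M ?c)\<^sup>2 + (L2_norm M (\<lambda>x. f x - ?c x))\<^sup>2"
    using L2_proj_Pythagoras[OF S f] L2_norm_real_cond_exp[OF A f] by simp
  show "L2_inner M ?c h = L2_inner M f h" if h: "h \<in> L2 M A"
  proof -
    have hm: "h \<in> borel_measurable M" using h L2_measurable[OF _ sub] by auto
    have "L2_inner M ?c h = L2_inner M ?p h"
      by (rule L2_inner_cong_AE[OF AE _ m(2,3) hm hm]) simp
    then show ?thesis using L2_inner_proj[OF S f h] by simp
  qed
qed

text \<open>Increments of the martingale are orthogonal, so the squared norms increase; bounded by
  that of \<open>f\<close>, they form a Cauchy sequence and the martingale converges in L2. Testing
  on sets of the \<open>G n\<close> identifies the limit.\<close>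

theorem L2_martingale_norm:
  fixes G :: "nat \<Rightarrow> 'a measure"
  assumes G: "\<And>n. sub_sigma_field M (G n)" and mono: "\<And>n. sets (G n) \<subseteq> sets (G (Suc n))"
    and G': "sub_sigma_field M G'" and gen: "sets G' = sigma_sets (space M) (\<Union>n. sets (G n))"
    and f: "f \<in> L2 M M"
  shows "(\<lambda>n. (L2_norm M (real_cond_exp M (G n) f))\<^sup>2) \<longlonglongrightarrow> (L2_norm M (real_cond_exp M G' f))\<^sup>2"
proof -
  have sub: "subalgebra M (G n)" "subalgebra M G'" for n using G G' by (auto simp: sub_sigma_field_def)
  have space: "space (G n) = space M" "space G' = space M" for n using sub by (auto simp: subalgebra_def)
  have mono': "sets (G m) \<subseteq> sets (G n)" if "m \<le> n" for m n
    by (rule lift_Suc_mono_le[of "\<lambda>n. sets (G n)", OF mono that])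
  have subG: "subalgebra (G n) (G m)" if "m \<le> n" for m n
    using mono'[OF that] by (simp add: subalgebra_def space)
  have subG': "subalgebra G' (G n)" for n unfolding subalgebra_def space gen by auto
  define u where "u n = real_cond_exp M (G n) f" for n
  have u: "u n \<in> L2 M (G n)" "u n \<in> L2 M M" "u n \<in> L2 M G'" for n
    using real_cond_exp_L2[OF G f, of n] real_cond_exp_L2M[OF G f, of n] L2_mono[OF subG'[of n], of M]
    by (auto simp: u_def)
  have diff: "(L2_norm M (\<lambda>x. u n x - u m x))\<^sup>2 = (L2_norm M (u n))\<^sup>2 - (L2_norm M (u m))\<^sup>2"
    if "m \<le> n" for m n
  proof -
    have um: "u m \<in> L2 M (G n)" using u(1)[of m] L2_mono[OF subG[OF that]] by auto
    have "L2_inner M (u n) (u m) = L2_inner M f (u m)"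
      unfolding u_def[of n] by (rule L2_inner_real_cond_exp[OF G f um])
    also have "\<dots> = L2_inner M (u m) (u m)"
      unfolding u_def[of m] by (rule L2_inner_real_cond_exp[OF G f, symmetric]) (use u(1)[of m] in \<open>simp add: u_def\<close>)
    finally show ?thesis
      using u(2) by (simp add: L2_norm_power2 L2_inner_simps L2_intros L2_inner_commute[of M "u m" "u n"])
  qed
  let ?a = "\<lambda>n. (L2_norm M (u n))\<^sup>2"
  have "incseq ?a"
  proof (rule incseq_SucI)
    fix n
    have "0 \<le> (L2_norm M (\<lambda>x. u (Suc n) x - u n x))\<^sup>2" by simp
    then show "?a n \<le> ?a (Suc n)" using diff[of n "Suc n"] by linarith
  qed
  moreover have "?a n \<le> (L2_norm M f)\<^sup>2" for n
    using real_cond_exp_Pythagoras[OF G f, of n] unfolding u_def by simp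
  ultimately have "convergent ?a"
    by (intro Bseq_mono_convergent BseqI'[of _ "(L2_norm M f)\<^sup>2"]) (auto simp: incseq_def)
  then have Cauchy_a: "Cauchy ?a" by (rule convergent_Cauchy)
  have "\<exists>N. \<forall>m\<ge>N. \<forall>n\<ge>N. L2_norm M (\<lambda>x. u m x - u n x) < e" if e: "e > 0" for e
  proof -
    obtain N where N: "\<And>m n. m \<ge> N \<Longrightarrow> n \<ge> N \<Longrightarrow> dist (?a m) (?a n) < e\<^sup>2"
      using Cauchy_a e unfolding Cauchy_def by (metis zero_less_power)
    have *: "L2_norm M (\<lambda>x. u n x - u m x) < e" if "N \<le> m" "m \<le> n" for m n
    proof -
      have "(L2_norm M (\<lambda>x. u n x - u m x))\<^sup>2 < e\<^sup>2"
        using N[of n m] that diff[OF that(2)] by (auto simp: dist_real_def)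
      then show ?thesis using e by (simp add: power_less_imp_less_base)
    qed
    have "L2_norm M (\<lambda>x. u m x - u n x) < e" if "N \<le> m" "N \<le> n" for m n
      using *[of m n] *[of n m] that L2_norm_minus_commute[of M "u m" "u n"] by (cases "m \<le> n") auto
    then show ?thesis by auto
  qed
  from L2_complete[OF sub(2) u(3) this]
  obtain g where g: "g \<in> L2 M G'" and lim: "(\<lambda>n. L2_norm M (\<lambda>x. u n x - g x)) \<longlonglongrightarrow> 0" by blast
  have gM: "g \<in> L2 M M" using g L2_subset[OF sub(2)] by auto
  have eq: "(\<integral>x\<in>X. f x \<partial>M) = (\<integral>x\<in>X. g x \<partial>M)" if X: "X \<in> sets (G n)" for X n
  proof -
    have ind: "indicat_real X \<in> L2 M (G m)" if "n \<le> m" for m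
      using L2_indicator[OF _ sub(1), of X] X mono'[OF that] by blast
    have indM: "indicat_real X \<in> L2 M M" using ind[of n] L2_subset[OF sub(1)] by blast
    have "(\<lambda>m. L2_inner M (u m) (indicator X)) \<longlonglongrightarrow> L2_inner M g (indicator X)"
      by (rule L2_inner_limit[OF gM u(2) indM lim])
    \<comment> \<open>As soon as \<open>m\<close> reaches \<open>n\<close>, the set \<open>X\<close>
      belongs to \<open>G m\<close> and the inner product no longer changes.\<close>
    moreover have "\<forall>\<^sub>F m in sequentially. L2_inner M (u m) (indicator X) = L2_inner M f (indicator X)"
      unfolding eventually_sequentially u_def using ind
      by (intro exI[of _ n] allI impI L2_inner_real_cond_exp[OF G f])
    ultimately have "(\<lambda>m. L2_inner M f (indicator X)) \<longlonglongrightarrow> L2_inner M g (indicator X)"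
      by (rule Lim_transform_eventually)
    then have "L2_inner M f (indicator X) = L2_inner M g (indicator X)"
      by (simp add: LIMSEQ_const_iff)
    then show ?thesis by (simp add: L2_inner_def set_lebesgue_integral_def mult.commute)
  qed
  interpret G': finite_measure_subalgebra M G' by standard (rule sub)
  have AE: "AE x in M. real_cond_exp M G' f x = g x"
  proof (rule G'.real_cond_exp_charact[OF _ L2_integrable[OF f] L2_integrable[OF gM]])
    show "g \<in> borel_measurable G'" using g by (simp add: L2_def)
    fix X assume X: "X \<in> sets G'"
    show "(\<integral>x\<in>X. f x \<partial>M) = (\<integral>x\<in>X. g x \<partial>M)"
    proof (rule set_integral_eq_sigma_sets[OF _ _ L2_integrable[OF f] L2_integrable[OF gM] _ _ X[unfolded gen]])
      show "Int_stable (\<Union>n. sets (G n))"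
      proof (rule Int_stableI)
        fix a b assume "a \<in> (\<Union>n. sets (G n))" "b \<in> (\<Union>n. sets (G n))"
        then obtain m n where "a \<in> sets (G m)" "b \<in> sets (G n)" by auto
        then have "a \<inter> b \<in> sets (G (max m n))"
          using mono'[of m "max m n"] mono'[of n "max m n"] by auto
        then show "a \<inter> b \<in> (\<Union>n. sets (G n))" by auto
      qed
      show "(\<Union>n. sets (G n)) \<subseteq> events" using sub by (auto simp: subalgebra_def)
      have "space M \<in> sets (G 0)" using sets.top[of "G 0"] by (simp add: space)
      then show "integral\<^sup>L M f = integral\<^sup>L M g"
        using eq[of "space M" 0] set_integral_space[OF L2_integrable[OF f]] set_integral_space[OF L2_integrable[OF gM]]
        by simp
      show "(\<integral>x\<in>X. f x \<partial>M) = (\<integral>x\<in>X. g x \<partial>M)" if "X \<in> (\<Union>n. sets (G n))" for X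
        using that eq by auto
    qed
  qed
  have "(\<lambda>n. (L2_norm M (u n))\<^sup>2) \<longlonglongrightarrow> (L2_norm M g)\<^sup>2"
    by (intro tendsto_power L2_norm_limit[OF gM u(2) lim])
  moreover have "L2_norm M (real_cond_exp M G' f) = L2_norm M g"
    by (rule L2_norm_cong_AE[OF AE]) (use gM in \<open>auto simp: L2_def\<close>)
  ultimately show ?thesis unfolding u_def by simp
qed

end

section \<open>Conditional expectations for elementary sets\<close>

context continuous_factorization
begin

abbreviation condE :: "real set \<Rightarrow> ('a \<Rightarrow> real) \<Rightarrow> 'a \<Rightarrow> real" where
  "condE E \<equiv> real_cond_exp M (field_of E)"

lemma field_of_subalgebra: "subalgebra M (field_of E)"
  using sub_sigma_field_field_of[of E] by (simp add: sub_sigma_field_def)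

lemma condE_L2: "f \<in> L2 M M \<Longrightarrow> condE E f \<in> L2 M (field_of E)" "f \<in> L2 M M \<Longrightarrow> condE E f \<in> L2 M M"
  using real_cond_exp_L2[OF sub_sigma_field_field_of] real_cond_exp_L2M[OF sub_sigma_field_field_of] by auto

text \<open>\<open>field_of E'\<close> is the join of the fields of \<open>E \<inter> E'\<close> and
  \<open>E' - E\<close>. The second is independent of \<open>field_of E\<close>, so conditioning
  \<open>condE E f\<close> on the join only sees the first; the tower property does the
  rest.\<close>

lemma condE_commute:
  assumes E: "elementary E" "elementary E'" and f: "f \<in> L2 M M"
  shows "AE x in M. condE E' (condE E f) x = condE (E \<inter> E') f x"
proof -
  interpret finite_measure_subalgebra M "field_of (E \<inter> E')"
    by standard (rule field_of_subalgebra)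
  have "\<exists>T. cuts T (E \<inter> E')" by (intro elementary_cuts elementary_Int E)
  then obtain T where "cuts T (E \<inter> E')" by auto
  note * = field_of_Un[OF this, of "E' - E"]
  have gen: "sets (field_of E') = sigma_sets (space M) (sets (field_of (E \<inter> E')) \<union> sets (field_of (E' - E)))"
  proof -
    have "(E \<inter> E') \<union> (E' - E) = E'" by auto
    then show ?thesis using * by simp
  qed
  have "AE x in M. condE E' (condE E f) x = condE (E \<inter> E') (condE E f) x"
  proof (rule real_cond_exp_indep_join[OF sub_sigma_field_field_of sub_sigma_field_field_of
          sub_sigma_field_field_of sub_sigma_field_field_of _ _ gen condE_L2(1)[OF f]])
    show "sets (field_of (E \<inter> E')) \<subseteq> sets (field_of E)" by (rule field_of_subset) simp
    show "indep_set (sets (field_of E)) (sets (field_of (E' - E)))"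
      by (rule field_of_indep[OF E(1) elementary_Diff[OF E(2,1)]]) auto
  qed
  moreover have "AE x in M. condE (E \<inter> E') (condE E f) x = condE (E \<inter> E') f x"
    by (rule real_cond_exp_nested_subalg[OF field_of_subalgebra _ L2_integrable[OF f]])
      (use field_of_subset[of "E \<inter> E'" E] in \<open>simp add: subalgebra_def space_field_of\<close>)
  ultimately show ?thesis by auto
qed

lemma condE_norm_Int:
  assumes "elementary E" "elementary E'" "f \<in> L2 M M"
  shows "L2_norm M (condE E' (condE E f)) = L2_norm M (condE (E \<inter> E') f)"
  by (rule L2_norm_cong_AE[OF condE_commute[OF assms]]) auto

text \<open>By commutation \<open>condE E\<close> carries the splitting of \<open>f\<close> along
  \<open>E'\<close> to the splitting of \<open>condE E f\<close> along \<open>E'\<close>, which is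
  orthogonal.\<close>

lemma condE_norm_split:
  assumes E: "elementary E" "elementary E'" and f: "f \<in> L2 M M"
  shows "(L2_norm M (condE E f))\<^sup>2 =
    (L2_norm M (condE E (condE E' f)))\<^sup>2 + (L2_norm M (condE E (\<lambda>x. f x - condE E' f x)))\<^sup>2"
proof -
  interpret finite_measure_subalgebra M "field_of E"
    by standard (rule field_of_subalgebra)
  have "AE x in M. condE E (\<lambda>x. f x - condE E' f x) x = condE E f x - condE E (condE E' f) x"
    by (intro real_cond_exp_diff L2_integrable f condE_L2)
  moreover have "AE x in M. condE E (condE E' f) x = condE E' (condE E f) x"
    using condE_commute[OF E f] condE_commute[OF E(2,1) f] by (auto simp: Int_commute)
  ultimately have "AE x in M. condE E (\<lambda>x. f x - condE E' f x) x = condE E f x - condE E' (condE E f) x"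
    by auto
  then have "L2_norm M (condE E (\<lambda>x. f x - condE E' f x)) = L2_norm M (\<lambda>x. condE E f x - condE E' (condE E f) x)"
    by (rule L2_norm_cong_AE) auto
  moreover have "L2_norm M (condE E (condE E' f)) = L2_norm M (condE E' (condE E f))"
    using condE_norm_Int[OF E f] condE_norm_Int[OF E(2,1) f] by (simp add: Int_commute)
  ultimately show ?thesis
    using real_cond_exp_Pythagoras[OF sub_sigma_field_field_of[of E'] condE_L2(2)[OF f, of E]] by simp
qed

end

section \<open>The Borel field on compact sets\<close>

text \<open>Away from the cuts, membership is locally constant. The random set is compared with open
  sets first; the finite rest is handled later by the vanishing mass of points.\<close>

lemma elementary_open_part:
  assumes "elementary E"
  obtains U T where "open U" "elementary U" "finite T" "E = U \<union> T" "U \<inter> T = {}"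
proof -
  obtain T where T: "cuts T E" using elementary_cuts[OF assms] by auto
  then have fin: "finite T" by (simp add: cuts_def)
  have "open (E - T)"
    unfolding open_dist
  proof
    fix x assume x: "x \<in> E - T"
    have "open (- T)" using finite_imp_closed[OF fin] by (simp add: open_Compl)
    then obtain e where e: "e > 0" "ball x e \<subseteq> - T" using x unfolding open_contains_ball by auto
    have "y \<in> E - T" if "dist y x < e" for y
    proof -
      have b: "{x - e<..<x + e} \<inter> T = {}" using e(2) by (auto simp: ball_eq_greaterThanLessThan)
      have "y \<in> {x - e<..<x + e}" "x \<in> {x - e<..<x + e}"
        using that e(1) by (auto simp: dist_real_def)
      then show ?thesis using cuts_constant[OF T b] x b by blast
    qed
    then show "\<exists>e>0. \<forall>y. dist y x < e \<longrightarrow> y \<in> E - T" using e(1) by blast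
  qed
  moreover have "elementary (E - T)"
    by (rule cuts_elementary[of T]) (use T in \<open>auto simp: cuts_def\<close>)
  moreover have "finite (E \<inter> T)" using fin by simp
  moreover have "E = (E - T) \<union> (E \<inter> T)" "(E - T) \<inter> (E \<inter> T) = {}" by auto
  ultimately show ?thesis by (rule that)
qed

lemma elementary_countable_closed:
  assumes "elementary E"
  obtains D :: "nat \<Rightarrow> real set" where "\<And>n. closed (D n)" "E = (\<Union>n. D n)"
proof -
  obtain U T where U: "open U" "finite T" "E = U \<union> T"
    using elementary_open_part[OF assms] by metis
  obtain C where C: "\<And>n::nat. compact (C n)" "\<Union>(range C) = U"
    using open_Union_compact_subsets[OF U(1)] by metis
  show ?thesis
  proof (rule that)
    show "closed (C n \<union> T)" for n
      using C(1) U(2) by (intro closed_Un compact_imp_closed finite_imp_closed)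
    show "E = (\<Union>n. C n \<union> T)" using U(3) C(2) by auto
  qed
qed

text \<open>The complement of \<open>E\<close> is a countable union of closed sets, and containment
  in an intersection is containment in every member. Measurability questions thus reduce to open
  sets.\<close>

lemma compacts_in_Gdelta:
  assumes "elementary E"
  obtains V :: "nat \<Rightarrow> real set" where "\<And>n. open (V n)" "E = (\<Inter>n. V n)"
    "compacts_in E = (\<Inter>n. compacts_in (V n))"
proof -
  obtain D :: "nat \<Rightarrow> real set" where D: "\<And>n. closed (D n)" "- E = (\<Union>n. D n)"
    using elementary_countable_closed[OF elementary_compl[OF assms]] by metis
  have "E = (\<Inter>n. - D n)" using D(2) by auto
  moreover from this have "compacts_in E = (\<Inter>n. compacts_in (- D n))"
    unfolding compacts_in_def by blast
  ultimately show ?thesis using D(1) by (intro that[of "\<lambda>n. - D n"]) auto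
qed

lemma compacts_in_Int: "compacts_in (E \<inter> E') = compacts_in E \<inter> compacts_in E'"
  unfolding compacts_in_def by auto

lemma space_borel_compacts: "space borel_compacts = {K. compact K}"
  and sets_borel_compacts: "sets borel_compacts = sigma_sets {K. compact K} {U. open_compacts U}"
proof -
  have "{U. open_compacts U} \<subseteq> Pow {K. compact K}" by (auto simp: open_compacts_def)
  then show "space borel_compacts = {K. compact K}"
    "sets borel_compacts = sigma_sets {K. compact K} {U. open_compacts U}"
    by (simp_all add: borel_compacts_def space_measure_of sets_measure_of)
qed

lemma open_compacts_compacts_in:
  assumes U: "open U" shows "open_compacts (compacts_in U)"
  unfolding open_compacts_def
proof (intro conjI ballI)
  show "compacts_in U \<subseteq> {K. compact K}" by (auto simp: compacts_in_def)
  fix K assume "K \<in> compacts_in U"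
  then have K: "compact K" "K \<subseteq> U" by (auto simp: compacts_in_def)
  show "\<exists>e>0. \<forall>L. compact L \<and> hausdorff_dist K L < e \<longrightarrow> L \<in> compacts_in U"
  proof (cases "K = {}")
    case True
    \<comment> \<open>Nonempty sets have distance exactly 1 from \<open>{}\<close>, so radius 1
      isolates it.\<close>
    then show ?thesis
      by (intro exI[of _ 1]) (auto simp: hausdorff_dist_def compacts_in_def split: if_splits)
  next
    case False
    obtain e where e: "e > 0" "(\<Union>x\<in>K. ball x e) \<subseteq> U"
      using compact_subset_open_imp_ball_epsilon_subset[OF K(1) U K(2)] by metis
    have "L \<in> compacts_in U" if L: "compact L" "hausdorff_dist K L < min e 1" for L
    proof (cases "L = {}")
      case True
      then show ?thesis using L by (simp add: compacts_in_def)
    next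
      case Lne: False
      have sup: "(SUP y\<in>L. infdist y K) < e"
        using L(2) False Lne by (simp add: hausdorff_dist_def)
      have "compact ((\<lambda>y. infdist y K) ` L)"
        by (intro compact_continuous_image L continuous_intros)
      then have bdd: "bdd_above ((\<lambda>y. infdist y K) ` L)"
        by (simp add: bounded_imp_bdd_above compact_imp_bounded)
      have "y \<in> U" if y: "y \<in> L" for y
      proof -
        have "infdist y K < e" using cSUP_upper[OF y bdd] sup by simp
        moreover obtain x where "x \<in> K" "infdist y K = dist y x"
          using infdist_attains_inf[OF compact_imp_closed[OF K(1)] False] by metis
        ultimately have "y \<in> ball x e" by (simp add: dist_commute)
        then show ?thesis using e(2) \<open>x \<in> K\<close> by blast
      qed
      then show ?thesis using L by (auto simp: compacts_in_def)
    qed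
    then show ?thesis using e(1) by (intro exI[of _ "min e 1"]) auto
  qed
qed

lemma compacts_in_measurable:
  assumes "elementary E" shows "compacts_in E \<in> sets borel_compacts"
proof -
  obtain V :: "nat \<Rightarrow> real set" where V: "\<And>n. open (V n)" "compacts_in E = (\<Inter>n. compacts_in (V n))"
    using compacts_in_Gdelta[OF assms] by metis
  have "compacts_in (V n) \<in> sets borel_compacts" for n
    unfolding sets_borel_compacts using open_compacts_compacts_in[OF V(1)] by (auto intro: sigma_sets.Basic)
  then show ?thesis unfolding V(2) by (intro sets.countable_INT) auto
qed

text \<open>Basic sets of the Vietoris topology built from rational intervals; lists of rational
  pairs are countable. The empty list yields the singleton of \<open>{}\<close>.\<close>

definition vietoris :: "(rat \<times> rat) list \<Rightarrow> real set set" where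
  "vietoris L = {K. compact K \<and> K \<subseteq> (\<Union>p\<in>set L. {of_rat (fst p)<..<of_rat (snd p)}) \<and>
    (\<forall>p\<in>set L. K \<inter> {of_rat (fst p)<..<of_rat (snd p)} \<noteq> {})}"

text \<open>Hitting an interval is the negation of being contained in its complement, which is again
  elementary.\<close>

lemma vietoris_sigma:
  "vietoris L \<in> sigma_sets {K. compact K} (compacts_in ` {E. elementary E})"
proof -
  let ?I = "\<lambda>p. {real_of_rat (fst p)<..<real_of_rat (snd p)}"
  let ?S = "sigma_sets {K. compact K} (compacts_in ` {E. elementary E})"
  interpret S: sigma_algebra "{K. compact K}" ?S
    by (rule sigma_algebra_sigma_sets) (auto simp: compacts_in_def)
  have el: "elementary (?I p)" for p
    by (auto intro!: elementary_interval simp: is_interval_1)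
  have "compacts_in (\<Union>p\<in>set L. ?I p) \<in> ?S"
    by (intro sigma_sets.Basic imageI CollectI elementary_UN el) simp
  moreover have "compacts_in (- ?I p) \<in> ?S" for p
    by (intro sigma_sets.Basic imageI CollectI elementary_compl el)
  then have "(\<Union>p\<in>set L. compacts_in (- ?I p)) \<in> ?S" by (intro S.finite_UN) auto
  ultimately have "compacts_in (\<Union>p\<in>set L. ?I p) - (\<Union>p\<in>set L. compacts_in (- ?I p)) \<in> ?S"
    by (rule S.Diff)
  moreover have "vietoris L = compacts_in (\<Union>p\<in>set L. ?I p) - (\<Union>p\<in>set L. compacts_in (- ?I p))"
    unfolding vietoris_def compacts_in_def by (auto simp: disjoint_iff subset_iff)
  ultimately show ?thesis by simp
qed

lemma vietoris_neighbourhood: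
  assumes K: "compact K" and e: "e > 0"
  obtains L where "K \<in> vietoris L" "\<And>K'. K' \<in> vietoris L \<Longrightarrow> compact K' \<and> hausdorff_dist K K' < e"
proof (cases "K = {}")
  case True
  show ?thesis by (rule that[of "[]"]) (use True e in \<open>auto simp: vietoris_def hausdorff_dist_def\<close>)
next
  case False
  let ?I = "\<lambda>p. {real_of_rat (fst p)<..<real_of_rat (snd p)}"
  \<comment> \<open>Two sets in the same basic set both meet every interval and are covered by them,
    so intervals shorter than \<open>e / 2\<close> put each point of one within \<open>e / 2\<close>
    of the other. The halving keeps the suprema strictly below \<open>e\<close>.\<close>
  have "\<exists>p. x \<in> ?I p \<and> real_of_rat (snd p) - real_of_rat (fst p) < e / 2" for x
  proof -
    obtain a b where a: "a \<in> \<rat>" "x - e / 4 < a" "a < x" and b: "b \<in> \<rat>" "x < b" "b < x + e / 4"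
      using Rats_dense_in_real[of "x - e / 4" x] Rats_dense_in_real[of x "x + e / 4"] e by auto
    obtain a' b' where "a = of_rat a'" "b = of_rat b'" using a(1) b(1) by (auto elim!: Rats_cases)
    then show ?thesis using a b by (intro exI[of _ "(a', b')"]) auto
  qed
  then obtain p where p: "\<And>x. x \<in> ?I (p x)" "\<And>x. real_of_rat (snd (p x)) - real_of_rat (fst (p x)) < e / 2"
    by metis
  have op: "open (?I q)" for q by auto
  have cover: "K \<subseteq> (\<Union>x\<in>K. ?I (p x))" using p(1) by blast
  obtain C where C: "C \<subseteq> K" "finite C" "K \<subseteq> (\<Union>x\<in>C. ?I (p x))"
    using compactE_image[OF K, of K "\<lambda>x. ?I (p x)"] op cover by blast
  obtain cs where cs: "set cs = C" using finite_list[OF C(2)] by auto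
  let ?L = "map p cs"
  have KL: "K \<in> vietoris ?L"
  proof -
    have "K \<inter> ?I (p x) \<noteq> {}" if "x \<in> C" for x using p(1)[of x] C(1) that by blast
    then show ?thesis using K C(3) cs by (auto simp: vietoris_def)
  qed
  have near: "\<exists>y\<in>A. dist x y < e / 2" if A: "A \<in> vietoris ?L" and B: "B \<in> vietoris ?L" "x \<in> B" for A B x
  proof -
    obtain c where c: "c \<in> C" "x \<in> ?I (p c)" using B cs by (auto simp: vietoris_def)
    obtain y where y: "y \<in> A" "y \<in> ?I (p c)" using A c(1) cs by (fastforce simp: vietoris_def)
    have "x - y < e / 2" "y - x < e / 2"
      using c(2) y(2) p(2)[of c] by auto
    then have "dist x y < e / 2" unfolding dist_real_def by linarith
    then show ?thesis using y(1) by auto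
  qed
  have inf: "infdist x A \<le> e / 2" if "A \<in> vietoris ?L" "B \<in> vietoris ?L" "x \<in> B" for A B x
    using near[OF that] infdist_le2 by (meson less_imp_le)
  show ?thesis
  proof (rule that[OF KL])
    fix K' assume K': "K' \<in> vietoris ?L"
    obtain x where "x \<in> K" using False by auto
    then have ne: "K' \<noteq> {}" using near[OF K' KL] by auto
    have "(SUP x\<in>K. infdist x K') \<le> e / 2" by (intro cSUP_least inf[OF K' KL] False)
    moreover have "(SUP y\<in>K'. infdist y K) \<le> e / 2" by (intro cSUP_least inf[OF KL K'] ne)
    ultimately have "hausdorff_dist K K' < e" using False ne e by (simp add: hausdorff_dist_def)
    then show "compact K' \<and> hausdorff_dist K K' < e" using K' by (simp add: vietoris_def)
  qed
qed

text \<open>The countably many \<open>vietoris\<close> sets contained in an open set cover it, so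
  open sets are countable unions of sets generated by the \<open>compacts_in E\<close>.\<close>

lemma sets_borel_compacts_elementary:
  "sets borel_compacts = sigma_sets {K. compact K} (compacts_in ` {E. elementary E})" (is "_ = ?S")
proof
  interpret S: sigma_algebra "{K. compact K}" ?S
    by (rule sigma_algebra_sigma_sets) (auto simp: compacts_in_def)
  have "U \<in> ?S" if U: "open_compacts U" for U
  proof -
    have "U = (\<Union>L\<in>{L. vietoris L \<subseteq> U}. vietoris L)"
    proof (intro equalityI subsetI)
      fix K assume K: "K \<in> U"
      then have "compact K" using U by (auto simp: open_compacts_def)
      obtain e where e: "e > 0" "\<And>L. compact L \<Longrightarrow> hausdorff_dist K L < e \<Longrightarrow> L \<in> U"
        using U K by (auto simp: open_compacts_def)
      obtain L where "K \<in> vietoris L" "\<And>K'. K' \<in> vietoris L \<Longrightarrow> compact K' \<and> hausdorff_dist K K' < e"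
        using vietoris_neighbourhood[OF \<open>compact K\<close> e(1)] by metis
      then show "K \<in> (\<Union>L\<in>{L. vietoris L \<subseteq> U}. vietoris L)" using e(2) by blast
    qed blast
    moreover have "(\<Union>L\<in>{L. vietoris L \<subseteq> U}. vietoris L) \<in> ?S"
      using vietoris_sigma by (intro S.countable_UN'') auto
    ultimately show ?thesis by simp
  qed
  then show "sets borel_compacts \<subseteq> ?S"
    unfolding sets_borel_compacts by (intro S.sigma_sets_subset) auto
  show "?S \<subseteq> sets borel_compacts"
    using sets.sigma_sets_subset[of "compacts_in ` {E. elementary E}" borel_compacts] compacts_in_measurable
    by (auto simp: space_borel_compacts)
qed

lemma Int_stable_compacts_in: "Int_stable (compacts_in ` {E. elementary E})"
  by (rule Int_stableI) (auto simp: compacts_in_Int[symmetric] intro!: imageI elementary_Int)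

section \<open>Measures from weighted binary trees\<close>

primrec tree_left :: "(bool list \<Rightarrow> real) \<Rightarrow> bool list \<Rightarrow> real" where
  "tree_left w [] = 0"
| "tree_left w (b # s) = (if b then tree_left w s else tree_left w s + w (True # s))"

text \<open>For \<open>x\<close> in the root interval this is the node of depth \<open>n\<close>
  whose interval contains \<open>x\<close>.\<close>

primrec tree_path :: "(bool list \<Rightarrow> real) \<Rightarrow> real \<Rightarrow> nat \<Rightarrow> bool list" where
  "tree_path w x 0 = []"
| "tree_path w x (Suc n) =
    (x < tree_left w (tree_path w x n) + w (True # tree_path w x n)) # tree_path w x n"

lemma length_tree_path [simp]: "length (tree_path w x n) = n"
  by (induction n) auto

definition tree_interval :: "(bool list \<Rightarrow> real) \<Rightarrow> bool list \<Rightarrow> real set" where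
  "tree_interval w s = {tree_left w s..<tree_left w s + w s}"

text \<open>Lists grow at the head, so \<open>length s\<close> is the step at which the bit
  \<open>b\<close> was added; \<open>I\<close> refers to steps, not to list positions.\<close>

primrec ones_on :: "nat set \<Rightarrow> bool list \<Rightarrow> bool" where
  "ones_on I [] \<longleftrightarrow> True"
| "ones_on I (b # s) \<longleftrightarrow> (length s \<in> I \<longrightarrow> b) \<and> ones_on I s"

definition sequences :: "nat \<Rightarrow> nat set \<Rightarrow> bool list set" where
  "sequences n I = {s. length s = n \<and> ones_on I s}"

lemma sequences_0: "sequences 0 I = {[]}"
  by (auto simp: sequences_def)

lemma sequences_Suc:
  "sequences (Suc n) I = (#) True ` sequences n I \<union> (if n \<in> I then {} else (#) False ` sequences n I)"
  unfolding sequences_def by (auto simp: length_Suc_conv)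

lemma finite_sequences: "finite (sequences n I)"
  by (induction n) (auto simp: sequences_0 sequences_Suc)

lemma sum_sequences_Suc:
  fixes g :: "bool list \<Rightarrow> real"
  shows "(\<Sum>s\<in>sequences (Suc n) I. g s) =
    (\<Sum>s\<in>sequences n I. g (True # s) + (if n \<in> I then 0 else g (False # s)))"
  unfolding sequences_Suc
  by (subst sum.union_disjoint) (auto simp: finite_sequences sum.reindex inj_on_def sum.distrib)

text \<open>
  The nodes of a binary tree with consistent weights are laid out as nested intervals, newest bit
  first, so that a point of the root interval picks a random path.
\<close>

lemma tree_measure:
  fixes w :: "bool list \<Rightarrow> real"
  assumes nonneg: "\<And>s. 0 \<le> w s" and split: "\<And>s. w s = w (True # s) + w (False # s)"
  obtains N :: "real measure" and B :: "nat \<Rightarrow> real set"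
  where "finite_measure N" "\<And>n. B n \<in> sets N"
    "\<And>n I. measure N {x \<in> space N. \<forall>i\<in>I. i < n \<longrightarrow> x \<in> B i} = (\<Sum>s\<in>sequences n I. w s)"
proof -
  \<comment> \<open>Lebesgue measure on this interval has total mass \<open>w []\<close>, the weight
    of the root.\<close>
  define R where "R = {0..<w []}"
  define N where "N = restrict_space lborel R"
  let ?p = "tree_path w"
  have [measurable]: "R \<in> sets borel" unfolding R_def by simp
  have spN: "space N = R" by (simp add: N_def)
  have setsN: "X \<in> sets N" if "X \<in> sets borel" "X \<subseteq> R" for X
    using that by (auto simp: N_def sets_restrict_space_iff)
  \<comment> \<open>Half-open intervals divide a parent exactly between its two children, so nodes
    of one depth partition \<open>R\<close>.\<close>
  have inR: "x \<in> tree_interval w s \<longleftrightarrow> x \<in> R \<and> ?p x (length s) = s" for x s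
  proof (induction s)
    case Nil
    then show ?case by (simp add: tree_interval_def R_def)
  next
    case (Cons b s)
    have "x \<in> tree_interval w (b # s) \<longleftrightarrow>
        x \<in> tree_interval w s \<and> b = (x < tree_left w s + w (True # s))"
      using nonneg[of "True # s"] nonneg[of "False # s"] split[of s]
      by (cases b) (auto simp: tree_interval_def)
    then show ?case using Cons.IH by auto
  qed
  have meas: "measure N (tree_interval w s) = w s" "tree_interval w s \<in> sets N" for s
  proof -
    have sub: "tree_interval w s \<subseteq> R" using inR by auto
    then show "tree_interval w s \<in> sets N" by (intro setsN) (simp add: tree_interval_def)
    have "measure N (tree_interval w s) = measure lborel (tree_interval w s)"
      unfolding N_def using sub by (intro measure_restrict_space) auto
    then show "measure N (tree_interval w s) = w s" using nonneg by (simp add: tree_interval_def)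
  qed
  have "emeasure N (space N) = emeasure lborel R"
    unfolding spN by (simp add: N_def emeasure_restrict_space)
  then have fin: "finite_measure N" by (intro finite_measureI) (simp add: R_def nonneg)
  interpret N: finite_measure N by (rule fin)
  have ev: "{x \<in> R. Q (?p x n)} = (\<Union>s\<in>{s. length s = n \<and> Q s}. tree_interval w s)" for n Q
    using inR by auto
  have fin_len: "finite {s :: bool list. length s = n \<and> Q s}" for n Q
    by (rule finite_subset[OF _ finite_lists_length_eq[of UNIV n]]) auto
  \<comment> \<open>\<open>hd\<close> is the newest bit, so this is the event that step
    \<open>n\<close> went to the \<open>True\<close> child.\<close>
  define B where "B n = {x \<in> R. hd (?p x (Suc n))}" for n
  have B: "B n \<in> sets N" for n
    unfolding B_def ev by (intro sets.finite_UN fin_len meas)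
  have ones: "x \<in> R \<Longrightarrow> ones_on I (?p x n) \<longleftrightarrow> (\<forall>i\<in>I. i < n \<longrightarrow> x \<in> B i)" for x I n
  proof (induction n)
    case (Suc n)
    then show ?case by (auto simp: B_def less_Suc_eq)
  qed simp
  show ?thesis
  proof (rule that[OF fin B])
    fix n I
    have "{x \<in> space N. \<forall>i\<in>I. i < n \<longrightarrow> x \<in> B i} = {x \<in> R. ones_on I (?p x n)}"
      using ones unfolding spN by auto
    also have "\<dots> = (\<Union>s\<in>sequences n I. tree_interval w s)"
      unfolding sequences_def by (rule ev)
    also have "measure N \<dots> = (\<Sum>s\<in>sequences n I. measure N (tree_interval w s))"
    proof (rule N.finite_measure_finite_Union[OF finite_sequences])
      show "disjoint_family_on (tree_interval w) (sequences n I)"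
        unfolding disjoint_family_on_def by (auto simp: inR sequences_def)
    qed (use meas in auto)
    finally show "measure N {x \<in> space N. \<forall>i\<in>I. i < n \<longrightarrow> x \<in> B i} = (\<Sum>s\<in>sequences n I. w s)"
      by (simp add: meas)
  qed
qed

section \<open>Spectral measures\<close>

text \<open>The family is countable, closed under finite unions and intersections, and has a member
  between any compact set and an open neighbourhood of it; the construction of the random set rests
  on these three properties.\<close>

definition rational_compact :: "nat \<Rightarrow> real set" where
  "rational_compact n =
     (\<Union>p\<in>set (from_nat n :: (rat \<times> rat) list). {real_of_rat (fst p)..real_of_rat (snd p)})"

lemma rational_compact_to_nat:
  "rational_compact (to_nat L) = (\<Union>p\<in>set L. {real_of_rat (fst p)..real_of_rat (snd p)})"
  by (simp add: rational_compact_def)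

lemma compact_rational_compact: "compact (rational_compact n)"
  unfolding rational_compact_def by (intro compact_UN) auto

lemma elementary_rational_compact: "elementary (rational_compact n)"
  unfolding rational_compact_def by (intro elementary_UN elementary_interval) (auto simp: is_interval_cc)

lemma rational_compact_Un: "\<exists>k. rational_compact k = rational_compact i \<union> rational_compact j"
proof -
  define L L' :: "(rat \<times> rat) list" where "L = from_nat i" and "L' = from_nat j"
  then have L: "rational_compact i = (\<Union>p\<in>set L. {real_of_rat (fst p)..real_of_rat (snd p)})"
    "rational_compact j = (\<Union>p\<in>set L'. {real_of_rat (fst p)..real_of_rat (snd p)})"
    by (simp_all add: rational_compact_def)
  then show ?thesis by (intro exI[of _ "to_nat (L @ L')"]) (simp add: rational_compact_to_nat UN_Un)
qed

lemma rational_compact_Int: "\<exists>k. rational_compact k = rational_compact i \<inter> rational_compact j"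
proof -
  define L L' :: "(rat \<times> rat) list" where "L = from_nat i" and "L' = from_nat j"
  then have L: "rational_compact i = (\<Union>p\<in>set L. {real_of_rat (fst p)..real_of_rat (snd p)})"
    "rational_compact j = (\<Union>p\<in>set L'. {real_of_rat (fst p)..real_of_rat (snd p)})"
    by (simp_all add: rational_compact_def)
  \<comment> \<open>If two intervals are disjoint, the new end points are reversed and give the
    empty interval.\<close>
  define m where "m = (\<lambda>(p :: rat \<times> rat, q :: rat \<times> rat). (max (fst p) (fst q), min (snd p) (snd q)))"
  have max: "real_of_rat (max a b) = max (real_of_rat a) (real_of_rat b)"
    and min: "real_of_rat (min a b) = min (real_of_rat a) (real_of_rat b)" for a b
    by (auto simp: max_def min_def of_rat_less_eq)
  have "(\<Union>p\<in>set (map m (List.product L L')). {real_of_rat (fst p)..real_of_rat (snd p)}) =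
      (\<Union>p\<in>set L. \<Union>q\<in>set L'. {real_of_rat (fst p)..real_of_rat (snd p)} \<inter>
        {real_of_rat (fst q)..real_of_rat (snd q)})"
    unfolding set_map set_product by (simp add: m_def max min Int_atLeastAtMost UN_UN_split_split_eq split_beta Sigma_def)
  also have "\<dots> = rational_compact i \<inter> rational_compact j"
    unfolding L by blast
  finally show ?thesis
    by (intro exI[of _ "to_nat (map m (List.product L L'))"]) (simp only: rational_compact_to_nat)
qed

lemma rational_compact_UN:
  "finite I \<Longrightarrow> \<exists>k. rational_compact k = (\<Union>i\<in>I. rational_compact i)"
proof (induction rule: finite_induct)
  case empty
  then show ?case by (intro exI[of _ "to_nat ([] :: (rat \<times> rat) list)"]) (simp add: rational_compact_to_nat)
next
  case (insert i I)
  then obtain k where "rational_compact k = (\<Union>i\<in>I. rational_compact i)" by auto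
  then show ?case using rational_compact_Un[of i k] by simp
qed

lemma rational_compact_between:
  assumes C: "compact C" and U: "open U" "C \<subseteq> U"
  shows "\<exists>n. C \<subseteq> rational_compact n \<and> rational_compact n \<subseteq> U"
proof -
  have "\<exists>p. x \<in> {real_of_rat (fst p)<..<real_of_rat (snd p)} \<and>
      {real_of_rat (fst p)..real_of_rat (snd p)} \<subseteq> U" (is "\<exists>p. ?Q x p") if x: "x \<in> C" for x
  proof -
    obtain e where e: "e > 0" "ball x e \<subseteq> U" using U x by (meson open_contains_ball subsetD)
    obtain a b where a: "a \<in> \<rat>" "x - e < a" "a < x" and b: "b \<in> \<rat>" "x < b" "b < x + e"
      using Rats_dense_in_real[of "x - e" x] Rats_dense_in_real[of x "x + e"] e by auto
    obtain a' b' where "a = of_rat a'" "b = of_rat b'" using a(1) b(1) by (auto elim!: Rats_cases)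
    moreover have "{a..b} \<subseteq> ball x e" using a b by (auto simp: ball_eq_greaterThanLessThan)
    ultimately show ?thesis using a b e(2) by (intro exI[of _ "(a', b')"]) auto
  qed
  then have "\<forall>x\<in>C. \<exists>p. ?Q x p" by blast
  from bchoice[OF this] obtain p where "\<forall>x\<in>C. ?Q x (p x)" by (rule exE)
  then have p: "\<And>x. x \<in> C \<Longrightarrow> x \<in> {real_of_rat (fst (p x))<..<real_of_rat (snd (p x))}"
    "\<And>x. x \<in> C \<Longrightarrow> {real_of_rat (fst (p x))..real_of_rat (snd (p x))} \<subseteq> U" by blast+
  let ?I = "\<lambda>p. {real_of_rat (fst p)<..<real_of_rat (snd p)}"
  have op: "open (?I q)" for q by auto
  have cover: "C \<subseteq> (\<Union>x\<in>C. ?I (p x))" using p(1) by blast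
  obtain D where D: "D \<subseteq> C" "finite D" "C \<subseteq> (\<Union>x\<in>D. ?I (p x))"
    using compactE_image[OF C, of C "\<lambda>x. ?I (p x)"] op cover by blast
  obtain ds where ds: "set ds = D" using finite_list[OF D(2)] by auto
  have "C \<subseteq> (\<Union>x\<in>D. {real_of_rat (fst (p x))..real_of_rat (snd (p x))})"
    using D(3) by (rule order_trans) (intro UN_mono greaterThanLessThan_subseteq_atLeastAtMost_iff[THEN iffD2], auto)
  moreover have "(\<Union>x\<in>D. {real_of_rat (fst (p x))..real_of_rat (snd (p x))}) \<subseteq> U"
    using p(2) D(1) by blast
  ultimately show ?thesis
    by (intro exI[of _ "to_nat (map p ds)"]) (simp add: rational_compact_to_nat ds)
qed

text \<open>
  \<open>B i\<close> plays the event that the random set is contained in \<open>K i\<close>; so the set is the intersection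
  of all \<open>K i\<close> whose event occurs.
\<close>

lemma random_compact_set:
  fixes N :: "real measure" and B :: "nat \<Rightarrow> real set" and v :: "real set \<Rightarrow> real"
  defines "K \<equiv> rational_compact"
  assumes N: "finite_measure N" and B: "\<And>n. B n \<in> sets N"
    and v: "\<And>I. finite I \<Longrightarrow> measure N {x \<in> space N. \<forall>i\<in>I. x \<in> B i} = v (\<Inter>i\<in>I. K i)"
    and lim: "\<And>U e. open U \<Longrightarrow> (\<And>m. K (e m) \<subseteq> K (e (Suc m))) \<Longrightarrow> (\<And>m. K (e m) \<subseteq> U) \<Longrightarrow>
      (\<And>C. compact C \<Longrightarrow> C \<subseteq> U \<Longrightarrow> \<exists>m. C \<subseteq> K (e m)) \<Longrightarrow> (\<lambda>m. v (K (e m))) \<longlonglongrightarrow> v U"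
  shows "\<exists>\<mu>. sets \<mu> = sets borel_compacts \<and> finite_measure \<mu> \<and>
    (\<forall>U. open U \<longrightarrow> elementary U \<longrightarrow> measure \<mu> (compacts_in U) = v U)"
proof -
  interpret N: finite_measure N by (rule N)
  note [measurable] = B
  \<comment> \<open>On \<open>Good\<close> the sets \<open>K i\<close> whose events occur behave
    like a filter. There are countably many conditions, and each fails with probability 0 because
    measures of joint events depend only on the intersection of the \<open>K i\<close>.\<close>
  define Good where "Good = {x \<in> space N. \<forall>i j k. K i \<inter> K j \<subseteq> K k \<longrightarrow> x \<in> B i \<longrightarrow> x \<in> B j \<longrightarrow> x \<in> B k}"
  have Good_sets [measurable]: "Good \<in> sets N" unfolding Good_def by measurable
  have AE_Good: "AE x in N. x \<in> Good"
  proof -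
    have "AE x in N. K i \<inter> K j \<subseteq> K k \<longrightarrow> x \<in> B i \<longrightarrow> x \<in> B j \<longrightarrow> x \<in> B k" for i j k
    proof (cases "K i \<inter> K j \<subseteq> K k")
      case True
      let ?A = "{x \<in> space N. \<forall>l\<in>{i, j}. x \<in> B l}" and ?C = "{x \<in> space N. \<forall>l\<in>{i, j, k}. x \<in> B l}"
      have "measure N (?A - ?C) = measure N ?A - measure N ?C"
        by (intro N.finite_measure_Diff) auto
      also have "\<dots> = 0"
        using v[of "{i, j}"] v[of "{i, j, k}"] True by (simp add: Int_absorb2 Int_assoc[symmetric])
      finally have "?A - ?C \<in> null_sets N"
        by (auto simp: null_sets_def N.emeasure_eq_measure)
      then have "AE x in N. x \<notin> ?A - ?C" by (rule AE_not_in)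
      then show ?thesis by (rule AE_mp) (auto intro!: AE_I2)
    qed simp
    then have "AE x in N. \<forall>i j k. K i \<inter> K j \<subseteq> K k \<longrightarrow> x \<in> B i \<longrightarrow> x \<in> B j \<longrightarrow> x \<in> B k"
      by (simp only: AE_all_countable) blast
    then show ?thesis by (rule AE_mp) (auto intro!: AE_I2 simp: Good_def)
  qed
  \<comment> \<open>At least one event must occur for the intersection to be bounded, hence compact.
    That almost every point qualifies is shown near the end.\<close>
  define Bd where "Bd = Good \<inter> (\<Union>i. B i)"
  have Bd_sets [measurable]: "Bd \<in> sets N" unfolding Bd_def by measurable
  define Z where "Z x = (if x \<in> Bd then \<Inter>i\<in>{i. x \<in> B i}. K i else {})" for x
  have Kc: "compact (K i)" for i unfolding K_def by (rule compact_rational_compact)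
  have Zc: "compact (Z x)" for x
  proof (cases "x \<in> Bd")
    case True
    then obtain i where "x \<in> B i" by (auto simp: Bd_def)
    then have "Z x = K i \<inter> (\<Inter>i\<in>{i. x \<in> B i}. K i)" using True by (auto simp: Z_def)
    also have "compact \<dots>" by (intro compact_Int_closed closed_INT ballI compact_imp_closed Kc)
    finally show ?thesis .
  qed (simp add: Z_def)
  have Z_iff: "Z x \<subseteq> U \<longleftrightarrow> (\<exists>k. x \<in> B k \<and> K k \<subseteq> U)" if x: "x \<in> Bd" and U: "open U" for x U
  proof
    assume "\<exists>k. x \<in> B k \<and> K k \<subseteq> U"
    then show "Z x \<subseteq> U" using x by (auto simp: Z_def)
  next
    assume ZU: "Z x \<subseteq> U"
    obtain i where i: "x \<in> B i" using x by (auto simp: Bd_def)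
    \<comment> \<open>The compact set \<open>K i - U\<close> misses the full intersection, so it
      misses a finite one; on \<open>Good\<close> that finite intersection is again some
      \<open>K k\<close> whose event occurs.\<close>
    have "(K i - U) \<inter> (\<Inter>j\<in>{j. x \<in> B j}. K j) = {}"
      using ZU x by (auto simp: Z_def)
    moreover have "compact (K i - U)" by (intro compact_diff Kc U)
    ultimately obtain J where J: "finite J" "J \<subseteq> {j. x \<in> B j}" "(K i - U) \<inter> (\<Inter>j\<in>J. K j) = {}"
      using compact_imp_fip_image[of "K i - U" "{j. x \<in> B j}" K] compact_imp_closed[OF Kc] by blast
    have "\<exists>k. x \<in> B k \<and> K k \<subseteq> K i \<inter> (\<Inter>j\<in>J. K j)"
      using J(1,2)
    proof (induction rule: finite_induct)
      case empty
      then show ?case using i by auto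
    next
      case (insert j J)
      then obtain k where k: "x \<in> B k" "K k \<subseteq> K i \<inter> (\<Inter>j\<in>J. K j)" and j: "x \<in> B j" by auto
      obtain l where l: "K l = K k \<inter> K j"
        using rational_compact_Int[of k j] by (auto simp: K_def)
      have "K k \<inter> K j \<subseteq> K l" by (simp add: l)
      then have "x \<in> B l" using x k(1) j unfolding Bd_def Good_def by blast
      then show ?case using l k(2) by (intro exI[of _ l]) auto
    qed
    then show "\<exists>k. x \<in> B k \<and> K k \<subseteq> U" using J(3) by blast
  qed
  have Z_open_sets: "{x \<in> space N. Z x \<subseteq> U} \<in> sets N" if U: "open U" for U
  proof -
    have "{x \<in> space N. Z x \<subseteq> U} = (space N - Bd) \<union> (\<Union>k\<in>{k. K k \<subseteq> U}. Bd \<inter> B k)"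
    proof (intro equalityI subsetI)
      fix x assume "x \<in> {x \<in> space N. Z x \<subseteq> U}"
      then show "x \<in> (space N - Bd) \<union> (\<Union>k\<in>{k. K k \<subseteq> U}. Bd \<inter> B k)"
        using Z_iff[OF _ U, of x] by auto
    next
      fix x assume x: "x \<in> (space N - Bd) \<union> (\<Union>k\<in>{k. K k \<subseteq> U}. Bd \<inter> B k)"
      then have "x \<in> space N" using sets.sets_into_space[OF Bd_sets] by auto
      moreover have "Z x \<subseteq> U"
      proof (cases "x \<in> Bd")
        case True
        then show ?thesis using x Z_iff[OF True U] by auto
      qed (simp add: Z_def)
      ultimately show "x \<in> {x \<in> space N. Z x \<subseteq> U}" by simp
    qed
    also have "\<dots> \<in> sets N" by measurable
    finally show ?thesis .
  qed
  have Zm: "Z \<in> measurable N borel_compacts"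
  proof (rule measurable_sigma_sets[OF sets_borel_compacts_elementary])
    show "compacts_in ` {E. elementary E} \<subseteq> Pow {K. compact K}" by (auto simp: compacts_in_def)
    show "Z \<in> space N \<rightarrow> {K. compact K}" using Zc by auto
    fix Y assume "Y \<in> compacts_in ` {E. elementary E}"
    then obtain E where E: "elementary E" "Y = compacts_in E" by auto
    obtain V :: "nat \<Rightarrow> real set" where V: "\<And>n. open (V n)" "E = (\<Inter>n. V n)"
      using compacts_in_Gdelta[OF E(1)] by metis
    have "Z -` Y \<inter> space N = (\<Inter>n. {x \<in> space N. Z x \<subseteq> V n})"
      using Zc unfolding E(2) V(2) compacts_in_def by auto
    also have "\<dots> \<in> sets N" using Z_open_sets[OF V(1)] by (intro sets.countable_INT) auto
    finally show "Z -` Y \<inter> space N \<in> sets N" .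
  qed
  \<comment> \<open>Restricting to \<open>Bd\<close> excludes the points with the default value
    \<open>{}\<close>, which lies in every \<open>U\<close>.\<close>
  have part: "measure N {x \<in> Bd. Z x \<subseteq> U} = v U" if U: "open U" for U
  proof -
    have "\<exists>k. K k = (\<Union>i\<in>{i. i \<le> m \<and> K i \<subseteq> U}. K i)" for m
      unfolding K_def by (rule rational_compact_UN) simp
    \<comment> \<open>\<open>K (e m)\<close> unites those of the first sets, up to index
      \<open>m\<close>, that lie in \<open>U\<close>. The sequence increases and eventually contains
      any given \<open>K k\<close> inside \<open>U\<close>.\<close>
    then obtain e where e: "\<And>m. K (e m) = (\<Union>i\<in>{i. i \<le> m \<and> K i \<subseteq> U}. K i)" by metis
    have mono: "K (e m) \<subseteq> K (e (Suc m))" for m unfolding e by (rule UN_mono) auto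
    have inU: "K (e m) \<subseteq> U" for m unfolding e by auto
    have sup: "K k \<subseteq> K (e k)" if "K k \<subseteq> U" for k unfolding e using that by auto
    have "\<exists>m. C \<subseteq> K (e m)" if C: "compact C" "C \<subseteq> U" for C
      using rational_compact_between[OF C(1) U C(2)] sup unfolding K_def by (meson order_trans)
    from lim[OF U mono inU this] have lim': "(\<lambda>m. v (K (e m))) \<longlonglongrightarrow> v U" by simp
    define A where "A m = Good \<inter> B (e m)" for m
    have A: "A m \<in> sets N" for m unfolding A_def by measurable
    have "incseq A"
    proof (rule incseq_SucI, rule subsetI)
      fix m x assume x: "x \<in> A m"
      have "K (e m) \<inter> K (e m) \<subseteq> K (e (Suc m))" using mono[of m] by simp
      then have "x \<in> B (e (Suc m))" using x unfolding A_def Good_def by blast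
      then show "x \<in> A (Suc m)" using x by (simp add: A_def)
    qed
    then have "(\<lambda>m. measure N (A m)) \<longlonglongrightarrow> measure N (\<Union>m. A m)"
      using A by (intro N.finite_Lim_measure_incseq) auto
    moreover have "measure N (A m) = v (K (e m))" for m
    proof -
      have "measure N (A m) = measure N {x \<in> space N. \<forall>i\<in>{e m}. x \<in> B i}"
        using AE_Good sets.sets_into_space[OF B] unfolding A_def by (intro N.finite_measure_eq_AE) auto
      then show ?thesis using v[of "{e m}"] by simp
    qed
    moreover have "(\<Union>m. A m) = {x \<in> Bd. Z x \<subseteq> U}"
    proof (intro equalityI subsetI)
      fix x assume "x \<in> (\<Union>m. A m)"
      then obtain m where "x \<in> Good" "x \<in> B (e m)" by (auto simp: A_def)
      then have "x \<in> Bd" by (auto simp: Bd_def)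
      moreover have "Z x \<subseteq> U"
        using Z_iff[OF \<open>x \<in> Bd\<close> U] inU[of m] \<open>x \<in> B (e m)\<close> by blast
      ultimately show "x \<in> {x \<in> Bd. Z x \<subseteq> U}" by simp
    next
      fix x assume "x \<in> {x \<in> Bd. Z x \<subseteq> U}"
      then obtain k where k: "x \<in> Bd" "x \<in> B k" "K k \<subseteq> U" using Z_iff[OF _ U] by auto
      have "K k \<inter> K k \<subseteq> K (e k)" using sup[OF k(3)] by simp
      then have "x \<in> B (e k)" using k(1,2) unfolding Bd_def Good_def by blast
      then show "x \<in> (\<Union>m. A m)" using k(1) by (auto simp: A_def Bd_def)
    qed
    ultimately show ?thesis using LIMSEQ_unique[OF lim'] by simp
  qed
  \<comment> \<open>The empty intersection is \<open>UNIV\<close>, so \<open>v UNIV\<close> is the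
    total mass of \<open>N\<close>, and \<open>part\<close> for \<open>UNIV\<close> says that
    \<open>Bd\<close> has all of it.\<close>
  have "measure N Bd = measure N (space N)"
    using part[of UNIV] v[of "{}"] by simp
  then have "measure N (space N - Bd) = 0" using N.finite_measure_compl[OF Bd_sets] by simp
  then have "space N - Bd \<in> null_sets N" by (auto simp: null_sets_def N.emeasure_eq_measure)
  then have AE_Bd: "AE x in N. x \<in> Bd" by (rule AE_mp[OF AE_not_in]) (auto intro!: AE_I2)
  show ?thesis
  proof (intro exI[of _ "distr N borel_compacts Z"] conjI allI impI)
    show "finite_measure (distr N borel_compacts Z)" by (rule N.finite_measure_distr[OF Zm])
    fix U :: "real set" assume U: "open U" "elementary U"
    have "measure (distr N borel_compacts Z) (compacts_in U) = measure N (Z -` compacts_in U \<inter> space N)"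
      by (rule measure_distr[OF Zm compacts_in_measurable[OF U(2)]])
    also have "Z -` compacts_in U \<inter> space N = {x \<in> space N. Z x \<subseteq> U}"
      using Zc by (auto simp: compacts_in_def)
    also have "measure N \<dots> = measure N {x \<in> Bd. Z x \<subseteq> U}"
    proof (rule N.finite_measure_eq_AE)
      show "AE x in N. x \<in> {x \<in> space N. Z x \<subseteq> U} \<longleftrightarrow> x \<in> {x \<in> Bd. Z x \<subseteq> U}"
        using AE_Bd by (rule AE_mp) (auto intro!: AE_I2)
      show "{x \<in> space N. Z x \<subseteq> U} \<in> sets N" by (rule Z_open_sets[OF U(1)])
      have "{x \<in> Bd. Z x \<subseteq> U} = Bd \<inter> {x \<in> space N. Z x \<subseteq> U}"
        using sets.sets_into_space[OF Bd_sets] by auto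
      then show "{x \<in> Bd. Z x \<subseteq> U} \<in> sets N" using Z_open_sets[OF U(1)] by simp
    qed
    finally show "measure (distr N borel_compacts Z) (compacts_in U) = v U" using part[OF U(1)] by simp
  qed simp
qed

section \<open>Existence and uniqueness of spectral measures, and the decomposition\<close>

context continuous_factorization
begin

lemma field_of_cong:
  assumes "finite (sym_diff E E')" shows "field_of E = field_of E'"
proof -
  have "sets (field_of E) = sets (field_of E')"
    by (intro equalityI field_of_mono; rule finite_subset[OF _ assms]; blast)
  then show ?thesis
    by (intro measure_eqI) (simp_all add: field_of_def emeasure_sigma)
qed

lemma condE_UNIV_norm:
  assumes "f \<in> L2 M M" shows "L2_norm M (condE UNIV f) = L2_norm M f"
proof -
  interpret finite_measure_subalgebra M "field_of UNIV" by standard (rule field_of_subalgebra)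
  have "sets M \<subseteq> sets (field_of UNIV)"
    unfolding generates
    by (intro sigma_algebra.sigma_sets_subset[OF field_of_sigma_algebra] UN_least F_le_field_of) auto
  then have "subalgebra (field_of UNIV) M" by (simp add: subalgebra_def space_field_of)
  moreover have "f \<in> borel_measurable M" using assms by (simp add: L2_def)
  ultimately have "f \<in> borel_measurable (field_of UNIV)" by (rule measurable_from_subalg)
  then have "AE x in M. condE UNIV f x = f x"
    by (intro real_cond_exp_F_meas L2_integrable assms)
  then show ?thesis by (rule L2_norm_cong_AE) (use assms in \<open>auto simp: L2_def\<close>)
qed

primrec tree_vector :: "('a \<Rightarrow> real) \<Rightarrow> bool list \<Rightarrow> 'a \<Rightarrow> real" where
  "tree_vector f [] = f"
| "tree_vector f (b # s) =
    (if b then condE (rational_compact (length s)) (tree_vector f s)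
     else (\<lambda>x. tree_vector f s x - condE (rational_compact (length s)) (tree_vector f s) x))"

lemma tree_vector_L2: "f \<in> L2 M M \<Longrightarrow> tree_vector f s \<in> L2 M M"
  by (induction s) (auto intro!: L2_intros condE_L2)

text \<open>Summing over a free bit undoes a splitting by Pythagoras, and a bit forced to
  \<open>True\<close> replaces \<open>E\<close> by its intersection with the set of that step. The
  outer \<open>condE E\<close> gives the induction room to absorb these sets.\<close>

lemma tree_vector_norm_sum:
  assumes f: "f \<in> L2 M M" and E: "elementary E"
  shows "(\<Sum>s\<in>sequences n I. (L2_norm M (condE E (tree_vector f s)))\<^sup>2) =
    (L2_norm M (condE (E \<inter> (\<Inter>i\<in>{i\<in>I. i < n}. rational_compact i)) f))\<^sup>2"
  using E
proof (induction n arbitrary: E)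
  case 0
  then show ?case by (simp add: sequences_0)
next
  case (Suc n)
  let ?K = "rational_compact n" and ?t = "tree_vector f"
  have K: "elementary ?K" by (rule elementary_rational_compact)
  have len: "length s = n" if "s \<in> sequences n I" for s using that by (simp add: sequences_def)
  show ?case
  proof (cases "n \<in> I")
    case True
    have "(\<Sum>s\<in>sequences (Suc n) I. (L2_norm M (condE E (?t s)))\<^sup>2) =
        (\<Sum>s\<in>sequences n I. (L2_norm M (condE (?K \<inter> E) (?t s)))\<^sup>2)"
      unfolding sum_sequences_Suc using True
      by (intro sum.cong refl) (simp add: len condE_norm_Int[OF K Suc.prems tree_vector_L2[OF f]])
    also have "\<dots> = (L2_norm M (condE ((?K \<inter> E) \<inter> (\<Inter>i\<in>{i\<in>I. i < n}. rational_compact i)) f))\<^sup>2"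
      by (intro Suc.IH elementary_Int K Suc.prems)
    also have "(?K \<inter> E) \<inter> (\<Inter>i\<in>{i\<in>I. i < n}. rational_compact i) =
        E \<inter> (\<Inter>i\<in>{i\<in>I. i < Suc n}. rational_compact i)"
      using True by (auto simp: less_Suc_eq)
    finally show ?thesis .
  next
    case False
    have "(\<Sum>s\<in>sequences (Suc n) I. (L2_norm M (condE E (?t s)))\<^sup>2) =
        (\<Sum>s\<in>sequences n I. (L2_norm M (condE E (?t s)))\<^sup>2)"
      unfolding sum_sequences_Suc using False
      by (intro sum.cong refl) (simp add: len condE_norm_split[OF Suc.prems K tree_vector_L2[OF f], symmetric])
    also have "\<dots> = (L2_norm M (condE (E \<inter> (\<Inter>i\<in>{i\<in>I. i < n}. rational_compact i)) f))\<^sup>2"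
      by (rule Suc.IH[OF Suc.prems])
    also have "{i\<in>I. i < n} = {i\<in>I. i < Suc n}" using False by (auto simp: less_Suc_eq)
    finally show ?thesis .
  qed
qed

theorem spectral_measure_exists:
  assumes f: "f \<in> L2 M M"
  shows "\<exists>\<mu>. is_spectral_measure M F f \<mu>"
proof -
  define v where "v E = (L2_norm M (condE E f))\<^sup>2" for E
  define w where "w s = (L2_norm M (tree_vector f s))\<^sup>2" for s
  have "w s = w (True # s) + w (False # s)" for s
    unfolding w_def using real_cond_exp_Pythagoras[OF sub_sigma_field_field_of tree_vector_L2[OF f]] by simp
  then obtain N :: "real measure" and B :: "nat \<Rightarrow> real set" where N: "finite_measure N" "\<And>n. B n \<in> sets N"
    and NB: "\<And>n I. measure N {x \<in> space N. \<forall>i\<in>I. i < n \<longrightarrow> x \<in> B i} = (\<Sum>s\<in>sequences n I. w s)"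
    using tree_measure[of w] by (auto simp: w_def)
  have vI: "measure N {x \<in> space N. \<forall>i\<in>I. x \<in> B i} = v (\<Inter>i\<in>I. rational_compact i)"
    if I: "finite I" for I
  proof -
    obtain n where n: "\<forall>i\<in>I. i < n" using finite_nat_set_iff_bounded[of I] I by auto
    \<comment> \<open>Conditioning on \<open>field_of UNIV\<close> preserves norms, so the weights
      are the case \<open>E = UNIV\<close> of the sum formula.\<close>
    have "(\<Sum>s\<in>sequences n I. w s) = (\<Sum>s\<in>sequences n I. (L2_norm M (condE UNIV (tree_vector f s)))\<^sup>2)"
      unfolding w_def by (simp add: condE_UNIV_norm tree_vector_L2 f)
    also have "\<dots> = v (UNIV \<inter> (\<Inter>i\<in>{i\<in>I. i < n}. rational_compact i))"
      unfolding v_def by (intro tree_vector_norm_sum f elementary_interval) simp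
    also have "{i\<in>I. i < n} = I" using n by auto
    finally show ?thesis using NB[of I n] n by (simp cong: conj_cong)
  qed
  have lim: "(\<lambda>m. v (rational_compact (e m))) \<longlonglongrightarrow> v U"
    if U: "open U" and e: "\<And>m. rational_compact (e m) \<subseteq> rational_compact (e (Suc m))"
      "\<And>m. rational_compact (e m) \<subseteq> U"
      "\<And>C. compact C \<Longrightarrow> C \<subseteq> U \<Longrightarrow> \<exists>m. C \<subseteq> rational_compact (e m)" for U and e :: "nat \<Rightarrow> nat"
    unfolding v_def
    by (rule L2_martingale_norm[OF sub_sigma_field_field_of field_of_subset[OF e(1)]
          sub_sigma_field_field_of field_of_UN[OF U e(3,2)] f])
  have "\<exists>\<mu>. sets \<mu> = sets borel_compacts \<and> finite_measure \<mu> \<and>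
      (\<forall>U. open U \<longrightarrow> elementary U \<longrightarrow> measure \<mu> (compacts_in U) = v U)"
    by (rule random_compact_set[OF N vI lim])
  then obtain \<mu> where \<mu>: "sets \<mu> = sets borel_compacts" "finite_measure \<mu>"
    and "\<forall>U. open U \<longrightarrow> elementary U \<longrightarrow> measure \<mu> (compacts_in U) = v U"
    by (elim exE conjE)
  then have open_v: "\<And>U. open U \<Longrightarrow> elementary U \<Longrightarrow> measure \<mu> (compacts_in U) = v U" by simp
  interpret \<mu>: finite_measure \<mu> by fact
  have cm: "compacts_in E \<in> sets \<mu>" if "elementary E" for E
    using compacts_in_measurable[OF that] \<mu>(1) by simp
  have "space \<mu> = compacts_in UNIV"
    using sets_eq_imp_space_eq[OF \<mu>(1)] by (simp add: space_borel_compacts compacts_in_def)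
  then have total: "measure \<mu> (space \<mu>) = v UNIV"
    using open_v[of UNIV] by (simp add: elementary_interval)
  have point: "measure \<mu> (space \<mu> - compacts_in (- {t})) = 0" for t
  proof -
    have el: "elementary (- {t})" by (intro elementary_compl elementary_interval) (auto simp: is_interval_1)
    \<comment> \<open>Deleting a point leaves the field unchanged, so the open set
      \<open>- {t}\<close> receives the full mass and the compacts containing \<open>t\<close>
      receive none.\<close>
    have "field_of (- {t}) = field_of UNIV" by (rule field_of_cong) simp
    then have "v (- {t}) = v UNIV" by (simp add: v_def)
    then show ?thesis
      using \<mu>.finite_measure_compl[OF cm[OF el]] open_v[OF _ el] total by (simp add: open_Compl)
  qed
  have "measure \<mu> (compacts_in E) = v E" if E: "elementary E" for E
  proof -
    obtain U T where U: "open U" "elementary U" "finite T" "E = U \<union> T" "U \<inter> T = {}"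
      using elementary_open_part[OF E] by metis
    have el: "elementary (- {t})" for t by (intro elementary_compl elementary_interval) (auto simp: is_interval_1)
    have "sym_diff E U \<subseteq> T" using U(4) by auto
    then have "finite (sym_diff E U)" using U(3) by (rule finite_subset)
    then have "field_of E = field_of U" by (rule field_of_cong)
    then have vE: "v E = measure \<mu> (compacts_in U)" by (simp add: v_def open_v[OF U(1,2)])
    \<comment> \<open>The compacts meeting \<open>T\<close>. A compact subset of \<open>E\<close>
      that misses \<open>T\<close> lies in \<open>U\<close>, so passing from \<open>U\<close> to
      \<open>E\<close> adds at most the zero mass of \<open>?X\<close>.\<close>
    let ?X = "\<Union>t\<in>T. space \<mu> - compacts_in (- {t})"
    have X: "?X \<in> sets \<mu>" using U(3) cm[OF el] by (intro sets.finite_UN) auto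
    have "compacts_in E \<subseteq> compacts_in U \<union> ?X"
      unfolding \<open>space \<mu> = compacts_in UNIV\<close> using U(4) by (auto simp: compacts_in_def)
    then have "measure \<mu> (compacts_in E) \<le> measure \<mu> (compacts_in U \<union> ?X)"
      using cm[OF U(2)] X by (intro \<mu>.finite_measure_mono) auto
    also have "\<dots> \<le> measure \<mu> (compacts_in U) + measure \<mu> ?X"
      by (rule measure_Un_le[OF cm[OF U(2)] X])
    also have "measure \<mu> ?X \<le> (\<Sum>t\<in>T. measure \<mu> (space \<mu> - compacts_in (- {t})))"
      using U(3) cm[OF el] by (intro \<mu>.finite_measure_subadditive_finite) auto
    also have "\<dots> = 0" by (simp add: point)
    finally have "measure \<mu> (compacts_in E) \<le> measure \<mu> (compacts_in U)" by simp
    moreover have "measure \<mu> (compacts_in U) \<le> measure \<mu> (compacts_in E)"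
      using U(4) cm[OF E] by (intro \<mu>.finite_measure_mono) (auto simp: compacts_in_def)
    ultimately show ?thesis using vE by simp
  qed
  then show ?thesis
    using \<mu> by (intro exI[of _ \<mu>]) (simp add: is_spectral_measure_def v_def elementary_field_eq)
qed

lemma is_spectral_measure_unique:
  assumes \<mu>: "is_spectral_measure M F f \<mu>" and \<nu>: "is_spectral_measure M F f \<nu>"
  shows "\<mu> = \<nu>"
proof -
  interpret \<mu>: finite_measure \<mu> using \<mu> by (simp add: is_spectral_measure_def)
  interpret \<nu>: finite_measure \<nu> using \<nu> by (simp add: is_spectral_measure_def)
  show ?thesis
  proof (rule measure_eqI_generator_eq[OF Int_stable_compacts_in, where \<Omega> = "{K. compact K}" and A = "\<lambda>_. compacts_in UNIV"])
    show "emeasure \<mu> X = emeasure \<nu> X" if "X \<in> compacts_in ` {E. elementary E}" for X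
      using that \<mu> \<nu> by (auto simp: is_spectral_measure_def \<mu>.emeasure_eq_measure \<nu>.emeasure_eq_measure)
    show "range (\<lambda>_. compacts_in UNIV) \<subseteq> compacts_in ` {E. elementary E}"
      by (auto simp: elementary_interval)
  qed (use \<mu> \<nu> in \<open>auto simp: is_spectral_measure_def sets_borel_compacts_elementary compacts_in_def\<close>)
qed

lemma spectral_measure_eq:
  "is_spectral_measure M F f \<mu> \<Longrightarrow> spectral_measure M F f = \<mu>"
  unfolding spectral_measure_def by (rule the_equality) (auto intro: is_spectral_measure_unique)

lemma spectral_measure: "f \<in> L2 M M \<Longrightarrow> is_spectral_measure M F f (spectral_measure M F f)"
  using spectral_measure_exists spectral_measure_eq by metis

lemma L2_norm_proj_elementary:
  assumes "f \<in> L2 M M" "elementary E"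
  shows "(L2_norm M (L2_proj M (L2 M (elementary_field M F E)) f))\<^sup>2 =
    (L2_norm M (real_cond_exp M (elementary_field M F E) f))\<^sup>2"
  using L2_norm_real_cond_exp[OF sub_sigma_field_field_of assms(1)]
  by (simp add: elementary_field_eq[OF assms(2)])

text \<open>The measure given by squared projection norms of \<open>H\<close> has the prescribed
  values on every \<open>compacts_in E\<close>, so it is the spectral measure by uniqueness. This
  yields both the norm formula and the uniqueness of \<open>H\<close>.\<close>

lemma decomposition_spectral:
  assumes H: "orthogonal_decomposition M borel_compacts H"
    and HE: "\<And>E. elementary E \<Longrightarrow> H (compacts_in E) = L2 M (elementary_field M F E)"
    and f: "f \<in> L2 M M" and X: "X \<in> sets borel_compacts"
  shows "(L2_norm M (L2_proj M (H X) f))\<^sup>2 = measure (spectral_measure M F f) X"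
proof -
  note D = decomposition_measure[OF H f]
  have "is_spectral_measure M F f (decomposition_measure borel_compacts H f)"
    unfolding is_spectral_measure_def
    using D L2_norm_proj_elementary[OF f] by (simp add: compacts_in_measurable HE)
  then show ?thesis using D(3)[OF X] by (simp add: spectral_measure_eq)
qed

lemma spectral_decomposition:
  shows "orthogonal_decomposition M borel_compacts
      (restrict (spectral_subspace (spectral_measure M F)) (sets borel_compacts))" (is "?A")
    and "elementary E \<Longrightarrow> restrict (spectral_subspace (spectral_measure M F)) (sets borel_compacts)
      (compacts_in E) = L2 M (elementary_field M F E)" (is "_ \<Longrightarrow> ?B")
proof -
  let ?\<mu> = "spectral_measure M F"
  have sp: "sets (?\<mu> f) = sets borel_compacts" "finite_measure (?\<mu> f)"
    "\<And>E. elementary E \<Longrightarrow> measure (?\<mu> f) (compacts_in E) =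
      (L2_norm M (L2_proj M (L2 M (elementary_field M F E)) f))\<^sup>2" if "f \<in> L2 M M" for f
    using spectral_measure[OF that] L2_norm_proj_elementary[OF that] by (auto simp: is_spectral_measure_def)
  have closed: "closed_subspace M (L2 M (elementary_field M F E))" if "elementary E" for E
    unfolding elementary_field_eq[OF that] by (rule closed_subspace_L2[OF sub_sigma_field_field_of])
  have total: "measure (?\<mu> f) (space borel_compacts) = (L2_norm M f)\<^sup>2" if f: "f \<in> L2 M M" for f
  proof -
    have el: "elementary UNIV" by (simp add: elementary_interval)
    have "space borel_compacts = compacts_in UNIV" by (simp add: space_borel_compacts compacts_in_def)
    then have "measure (?\<mu> f) (space borel_compacts) = (L2_norm M (real_cond_exp M (elementary_field M F UNIV) f))\<^sup>2"
      using sp(3)[OF f el] L2_norm_proj_elementary[OF f el] by simp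
    then show ?thesis using condE_UNIV_norm[OF f] by (simp add: elementary_field_eq[OF el])
  qed
  have gen: "sets borel_compacts = sigma_sets (space borel_compacts) (compacts_in ` {E. elementary E})"
    by (simp add: space_borel_compacts sets_borel_compacts_elementary)
  have proj: "\<exists>S. closed_subspace M S \<and> (\<forall>f\<in>L2 M M. (L2_norm M (L2_proj M S f))\<^sup>2 = measure (?\<mu> f) X)"
    if "X \<in> compacts_in ` {E. elementary E}" for X
  proof -
    from that obtain E where E: "elementary E" "X = compacts_in E" by auto
    show ?thesis
      unfolding E(2) using closed[OF E(1)] sp(3)[OF _ E(1)]
      by (intro exI[of _ "L2 M (elementary_field M F E)"]) simp
  qed
  note Dynkin = spectral_subspace_Dynkin[OF sp(1,2) total gen Int_stable_compacts_in proj]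
  show ?A
    by (rule orthogonal_decomposition_spectral[OF sp(1,2) total Dynkin])
  show ?B if E: "elementary E"
    using spectral_subspace_eq[OF closed[OF E] sp(3)[OF _ E, symmetric]] compacts_in_measurable[OF E]
    by simp
qed

end

theorem theorem3p4p12:
  fixes M :: "'a measure" and F :: "real \<Rightarrow> real \<Rightarrow> 'a measure"
  assumes "continuous_factorization M F"
  shows "(\<exists>!H. orthogonal_decomposition M borel_compacts H \<and>
            (\<forall>E. elementary E \<longrightarrow> H (compacts_in E) = L2 M (elementary_field M F E))) \<and>
         (\<forall>H. orthogonal_decomposition M borel_compacts H \<and>
            (\<forall>E. elementary E \<longrightarrow> H (compacts_in E) = L2 M (elementary_field M F E)) \<longrightarrow>
            (\<forall>f\<in>L2 M M. \<forall>\<M>\<in>sets borel_compacts.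
               (L2_norm M (L2_proj M (H \<M>) f))\<^sup>2 = measure (spectral_measure M F f) \<M>))"
proof -
  interpret continuous_factorization M F by fact
  let ?P = "\<lambda>H. orthogonal_decomposition M borel_compacts H \<and>
    (\<forall>E. elementary E \<longrightarrow> H (compacts_in E) = L2 M (elementary_field M F E))"
  let ?H = "restrict (spectral_subspace (spectral_measure M F)) (sets borel_compacts)"
  have "H = ?H" if H: "?P H" for H
  proof (rule extensionalityI)
    \<comment> \<open>Outside the Borel field both families have the same default value, so only
      Borel sets need to be compared.\<close>
    show "H \<in> extensional (sets borel_compacts)" using H orthogonal_decompositionD(3) by blast
    fix X assume X: "X \<in> sets borel_compacts"
    have "spectral_subspace (spectral_measure M F) X = H X"
    proof (rule spectral_subspace_eq)
      show "closed_subspace M (H X)" using H X orthogonal_decompositionD(1) by blast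
      show "(L2_norm M (L2_proj M (H X) f))\<^sup>2 = measure (spectral_measure M F f) X"
        if "f \<in> L2 M M" for f
        using H X that by (intro decomposition_spectral) auto
    qed
    then show "H X = ?H X" using X by simp
  qed simp
  then have "\<exists>!H. ?P H"
    using spectral_decomposition by (intro ex1I[of ?P ?H]) auto
  moreover have "(L2_norm M (L2_proj M (H X) f))\<^sup>2 = measure (spectral_measure M F f) X"
    if "?P H" "f \<in> L2 M M" "X \<in> sets borel_compacts" for H f X
    using that by (intro decomposition_spectral) auto
  ultimately show ?thesis by blast
qed

end
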